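(* The eigenfunctions of problem (P), augmented to become eigenfunctions of $A$, are complete in $H$; that is, if $\{\Phi_n=(\phi_n(x),N'(\phi_n)):n\in\mathbb{N}\}$ is a maximal set of orthonormal eigenfunctions of $A$, where $\{\phi_n(x):n\in\mathbb{N}\}$ are eigenfunctions of (P), then for all $F\in H$, $$F=\sum_{n=1}^{\infty}\langle F,\Phi_n\rangle\Phi_n .$$
   Context: Data. Let $-1<h_1<h_2<h_3<1$ and $I=[-1,h_1)\cup(h_1,h_2)\cup(h_2,h_3)\cup(h_3,1]$. Let $p_1,p_2,p_3,p_4$ be nonzero real constants, and let $p(x)=p_1^2$ on $[-1,h_1)$, $p(x)=p_2^2$ on $(h_1,h_2)$, $p(x)=p_3^2$ on $(h_2,h_3)$, $p(x)=p_4^2$ on $(h_3,1]$. Let $q\in L^1(I,\mathbb{R})$, and let $\alpha_i,\beta_i$ ($i=1,\dots,8$), $\beta_1',\beta_2'$ be real numbers (primes on $\beta_1',\beta_2'$ are part of the name). Assume throughout $$\theta=\alpha_3\beta_4-\beta_3\alpha_4>0,\quad \gamma=\alpha_5\beta_6-\beta_5\alpha_6>0,\quad \xi=\alpha_7\beta_8-\beta_7\alpha_8>0,\quad \rho=\beta_1'\beta_2-\beta_1\beta_2'>0,\quad |\alpha_1|+|\alpha_2|\neq 0.$$ Expressions. $\tau u=-(p u')'+qu$ on $I$; $\tau_1u=\alpha_1u(-1)+\alpha_2u'(-1)$; $\tau_3u=u(h_1+0)-\alpha_3u(h_1-0)-\beta_3u'(h_1-0)$, $\tau_4u=u'(h_1+0)-\alpha_4u(h_1-0)-\beta_4u'(h_1-0)$,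 $\tau_5u=u(h_2+0)-\alpha_5u(h_2-0)-\beta_5u'(h_2-0)$, $\tau_6u=u'(h_2+0)-\alpha_6u(h_2-0)-\beta_6u'(h_2-0)$, $\tau_7u=u(h_3+0)-\alpha_7u(h_3-0)-\beta_7u'(h_3-0)$, $\tau_8u=u'(h_3+0)-\alpha_8u(h_3-0)-\beta_8u'(h_3-0)$, where $\pm0$ denotes one-sided limits. Also $N(f)=\beta_1f(1)-\beta_2f'(1)$ and $N'(f)=\beta_1'f(1)-\beta_2'f'(1)$. Problem (P), with eigenparameter $\lambda\in\mathbb{C}$: $\tau u=\lambda u$ on $I$, $\tau_1u=0$, $\lambda N'(u)+N(u)=0$, and $\tau_3u=\tau_4u=\tau_5u=\tau_6u=\tau_7u=\tau_8u=0$ (with $u,u'$ absolutely continuous on each of the four subintervals). $\lambda$ is an eigenvalue of (P) if a nontrivial solution $u$ (an eigenfunction) exists. Hilbert space. $H_1$ is the complex space $L^2(I)$ with inner product $$\langle f,g\rangle_1=\frac1{p_1^2}\int_{-1}^{h_1}f\overline g\,dx+\frac1{p_2^2\theta}\int_{h_1}^{h_2}f\overline g\,dx+\frac1{p_3^2\theta\gamma}\int_{h_2}^{h_3}f\overline g\,dx+\frac1{p_4^2\theta\gamma\xi}\int_{h_3}^{1}f\overline g\,dx,$$ and $H=H_1\oplus\mathbb{C}$ has inner product $\langle(f,h),(g,k)\rangle=\langle f,g\rangle_1+\frac1{\rho\theta\gamma\xi}h\overline k$. Operator. $D(A)$ is the set of $(f,h)\in H$ such that $f$ and $f'$ are locally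 absolutely continuous on each of $(-1,h_1)$, $(h_1,h_2)$, $(h_2,h_3)$, $(h_3,1)$, $\tau f\in H_1$, $\tau_1f=\tau_3f=\tau_4f=\tau_5f=\tau_6f=\tau_7f=\tau_8f=0$, and $h=N'(f)$. (For such $f$, the functions $f,f'$ extend continuously to the closure of each of the four intervals, which gives meaning to the boundary values and one-sided limits.) For $F=(f,N'(f))\in D(A)$, $AF=(\tau f,-N(f))$. The eigenvalues of (P) coincide with those of $A$, and the eigenfunctions of (P) are the first components of the corresponding eigenfunctions of $A$. *)

theory Defs
  imports "HOL-Analysis.Analysis"
begin

text \<open>
  The coefficients of the problem. Numbered families of coefficients are functions
  on \<^typ>\<open>nat\<close>, of which only the values at \<open>1, \<dots>, 8\<close> are used;
  \<open>sl_beta1'\<close> and \<open>sl_beta2'\<close> are the two separate constants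
  \<open>\<beta>\<^sub>1'\<close> and \<open>\<beta>\<^sub>2'\<close>.
\<close>

record sl_data =
  sl_h1 :: real
  sl_h2 :: real
  sl_h3 :: real
  sl_p1 :: real
  sl_p2 :: real
  sl_p3 :: real
  sl_p4 :: real
  sl_q :: "real \<Rightarrow> real"
  sl_alpha :: "nat \<Rightarrow> real"
  sl_beta :: "nat \<Rightarrow> real"
  sl_beta1' :: real
  sl_beta2' :: real

definition sl_I :: "sl_data \<Rightarrow> real set" where
  "sl_I D = {-1..<sl_h1 D} \<union> {sl_h1 D<..<sl_h2 D} \<union> {sl_h2 D<..<sl_h3 D} \<union> {sl_h3 D<..1}"

text \<open>The values of \<open>sl_p\<close> outside \<open>sl_I\<close> are irrelevant.\<close>

definition sl_p :: "sl_data \<Rightarrow> real \<Rightarrow> real" where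
  "sl_p D x = (if x < sl_h1 D then (sl_p1 D)\<^sup>2
               else if x < sl_h2 D then (sl_p2 D)\<^sup>2
               else if x < sl_h3 D then (sl_p3 D)\<^sup>2
               else (sl_p4 D)\<^sup>2)"

definition sl_theta :: "sl_data \<Rightarrow> real" where
  "sl_theta D = sl_alpha D 3 * sl_beta D 4 - sl_beta D 3 * sl_alpha D 4"

definition sl_gamma :: "sl_data \<Rightarrow> real" where
  "sl_gamma D = sl_alpha D 5 * sl_beta D 6 - sl_beta D 5 * sl_alpha D 6"

definition sl_xi :: "sl_data \<Rightarrow> real" where
  "sl_xi D = sl_alpha D 7 * sl_beta D 8 - sl_beta D 7 * sl_alpha D 8"

definition sl_rho :: "sl_data \<Rightarrow> real" where
  "sl_rho D = sl_beta1' D * sl_beta D 2 - sl_beta D 1 * sl_beta2' D"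

definition sl_valid :: "sl_data \<Rightarrow> bool" where
  "sl_valid D \<longleftrightarrow>
     -1 < sl_h1 D \<and> sl_h1 D < sl_h2 D \<and> sl_h2 D < sl_h3 D \<and> sl_h3 D < 1 \<and>
     sl_p1 D \<noteq> 0 \<and> sl_p2 D \<noteq> 0 \<and> sl_p3 D \<noteq> 0 \<and> sl_p4 D \<noteq> 0 \<and>
     integrable (lebesgue_on (sl_I D)) (sl_q D) \<and>
     sl_theta D > 0 \<and> sl_gamma D > 0 \<and> sl_xi D > 0 \<and> sl_rho D > 0 \<and>
     \<bar>sl_alpha D 1\<bar> + \<bar>sl_alpha D 2\<bar> \<noteq> 0"


text \<open>
  Absolute continuity of a function of a real variable on a set (usually an interval).
  The elements \<open>(a, b)\<close> of \<open>J\<close> are the endpoints of non-overlapping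
  compact intervals.
\<close>

definition abs_cont_on :: "real set \<Rightarrow> (real \<Rightarrow> complex) \<Rightarrow> bool" where
  "abs_cont_on S f \<longleftrightarrow>
     (\<forall>\<epsilon>>0. \<exists>\<delta>>0. \<forall>J :: (real \<times> real) set.
        finite J \<and> (\<forall>(a, b)\<in>J. a \<le> b \<and> {a..b} \<subseteq> S) \<and>
        disjoint_family_on (\<lambda>(a, b). {a<..<b}) J \<and>
        (\<Sum>(a, b)\<in>J. b - a) < \<delta> \<longrightarrow>
        (\<Sum>(a, b)\<in>J. norm (f b - f a)) < \<epsilon>)"

definition loc_abs_cont_on :: "real set \<Rightarrow> (real \<Rightarrow> complex) \<Rightarrow> bool" where
  "loc_abs_cont_on S f \<longleftrightarrow> (\<forall>c d. {c..d} \<subseteq> S \<longrightarrow> abs_cont_on {c..d} f)"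

definition sl_deriv :: "(real \<Rightarrow> complex) \<Rightarrow> real \<Rightarrow> complex" where
  "sl_deriv f x = vector_derivative f (at x)"

definition sl_subintervals :: "sl_data \<Rightarrow> real set set" where
  "sl_subintervals D =
     {{-1<..<sl_h1 D}, {sl_h1 D<..<sl_h2 D}, {sl_h2 D<..<sl_h3 D}, {sl_h3 D<..<1}}"

text \<open>
  The derivative \<open>(p f')'\<close> exists almost everywhere on \<open>sl_I\<close> for the functions
  \<open>f\<close> considered below; the values of \<open>sl_tau\<close> elsewhere are unspecified.
\<close>

definition sl_tau :: "sl_data \<Rightarrow> (real \<Rightarrow> complex) \<Rightarrow> real \<Rightarrow> complex" where
  "sl_tau D f x =
     - sl_deriv (\<lambda>y. of_real (sl_p D y) * sl_deriv f y) x + of_real (sl_q D x) * f x"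

text \<open>
  One-sided limits. The boundary values at \<open>-1\<close> and \<open>1\<close> are also taken as limits from
  inside the interval, i.e. as values of the continuous extensions.
\<close>

abbreviation lim_plus :: "(real \<Rightarrow> complex) \<Rightarrow> real \<Rightarrow> complex" where
  "lim_plus f c \<equiv> Lim (at_right c) f"

abbreviation lim_minus :: "(real \<Rightarrow> complex) \<Rightarrow> real \<Rightarrow> complex" where
  "lim_minus f c \<equiv> Lim (at_left c) f"

definition sl_tau1 :: "sl_data \<Rightarrow> (real \<Rightarrow> complex) \<Rightarrow> complex" where
  "sl_tau1 D u = of_real (sl_alpha D 1) * lim_plus u (-1)
               + of_real (sl_alpha D 2) * lim_plus (sl_deriv u) (-1)"

definition sl_tau3 :: "sl_data \<Rightarrow> (real \<Rightarrow> complex) \<Rightarrow> complex" where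
  "sl_tau3 D u = lim_plus u (sl_h1 D)
     - of_real (sl_alpha D 3) * lim_minus u (sl_h1 D)
     - of_real (sl_beta D 3) * lim_minus (sl_deriv u) (sl_h1 D)"

definition sl_tau4 :: "sl_data \<Rightarrow> (real \<Rightarrow> complex) \<Rightarrow> complex" where
  "sl_tau4 D u = lim_plus (sl_deriv u) (sl_h1 D)
     - of_real (sl_alpha D 4) * lim_minus u (sl_h1 D)
     - of_real (sl_beta D 4) * lim_minus (sl_deriv u) (sl_h1 D)"

definition sl_tau5 :: "sl_data \<Rightarrow> (real \<Rightarrow> complex) \<Rightarrow> complex" where
  "sl_tau5 D u = lim_plus u (sl_h2 D)
     - of_real (sl_alpha D 5) * lim_minus u (sl_h2 D)
     - of_real (sl_beta D 5) * lim_minus (sl_deriv u) (sl_h2 D)"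

definition sl_tau6 :: "sl_data \<Rightarrow> (real \<Rightarrow> complex) \<Rightarrow> complex" where
  "sl_tau6 D u = lim_plus (sl_deriv u) (sl_h2 D)
     - of_real (sl_alpha D 6) * lim_minus u (sl_h2 D)
     - of_real (sl_beta D 6) * lim_minus (sl_deriv u) (sl_h2 D)"

definition sl_tau7 :: "sl_data \<Rightarrow> (real \<Rightarrow> complex) \<Rightarrow> complex" where
  "sl_tau7 D u = lim_plus u (sl_h3 D)
     - of_real (sl_alpha D 7) * lim_minus u (sl_h3 D)
     - of_real (sl_beta D 7) * lim_minus (sl_deriv u) (sl_h3 D)"

definition sl_tau8 :: "sl_data \<Rightarrow> (real \<Rightarrow> complex) \<Rightarrow> complex" where
  "sl_tau8 D u = lim_plus (sl_deriv u) (sl_h3 D)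
     - of_real (sl_alpha D 8) * lim_minus u (sl_h3 D)
     - of_real (sl_beta D 8) * lim_minus (sl_deriv u) (sl_h3 D)"

definition sl_N :: "sl_data \<Rightarrow> (real \<Rightarrow> complex) \<Rightarrow> complex" where
  "sl_N D f = of_real (sl_beta D 1) * lim_minus f 1
            - of_real (sl_beta D 2) * lim_minus (sl_deriv f) 1"

definition sl_N' :: "sl_data \<Rightarrow> (real \<Rightarrow> complex) \<Rightarrow> complex" where
  "sl_N' D f = of_real (sl_beta1' D) * lim_minus f 1
             - of_real (sl_beta2' D) * lim_minus (sl_deriv f) 1"

text \<open>
  The conditions that do not involve the eigenparameter: at \<open>-1\<close> and at the three
  interior points.
\<close>

definition sl_bc :: "sl_data \<Rightarrow> (real \<Rightarrow> complex) \<Rightarrow> bool" where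
  "sl_bc D u \<longleftrightarrow> sl_tau1 D u = 0 \<and> sl_tau3 D u = 0 \<and> sl_tau4 D u = 0 \<and> sl_tau5 D u = 0 \<and>
                  sl_tau6 D u = 0 \<and> sl_tau7 D u = 0 \<and> sl_tau8 D u = 0"


text \<open>
  Problem (P). Both the equation and nontriviality are understood almost everywhere
  on \<open>sl_I\<close>, since \<open>sl_q\<close> is merely integrable and the values of \<open>u\<close> at the
  points \<open>-1\<close> and \<open>1\<close> are immaterial.
\<close>

definition sl_solution :: "sl_data \<Rightarrow> complex \<Rightarrow> (real \<Rightarrow> complex) \<Rightarrow> bool" where
  "sl_solution D \<mu> u \<longleftrightarrow>
     (\<forall>S\<in>sl_subintervals D. abs_cont_on S u \<and> (\<forall>x\<in>S. u differentiable (at x)) \<and>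
                            abs_cont_on S (sl_deriv u)) \<and>
     (AE x in lebesgue_on (sl_I D). sl_tau D u x = \<mu> * u x) \<and>
     sl_bc D u \<and> \<mu> * sl_N' D u + sl_N D u = 0"

definition sl_eigenfunction :: "sl_data \<Rightarrow> (real \<Rightarrow> complex) \<Rightarrow> bool" where
  "sl_eigenfunction D u \<longleftrightarrow>
     (\<exists>\<mu>. sl_solution D \<mu> u) \<and> \<not> (AE x in lebesgue_on (sl_I D). u x = 0)"


text \<open>
  Elements of \<open>L\<^sup>2(I)\<close> are represented by functions, of which only the restriction to
  \<open>sl_I\<close> matters; two representatives denote the same element iff they agree almost
  everywhere on \<open>sl_I\<close>. Equality in \<open>H\<close> is therefore \<open>sl_Heq\<close>, and \<open>sl_Hnorm\<close> is a
  norm modulo \<open>sl_Heq\<close>.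
\<close>

definition sl_H1 :: "sl_data \<Rightarrow> (real \<Rightarrow> complex) set" where
  "sl_H1 D = {f. f \<in> borel_measurable (lebesgue_on (sl_I D)) \<and>
                 integrable (lebesgue_on (sl_I D)) (\<lambda>x. (norm (f x))\<^sup>2)}"

definition sl_inner1 :: "sl_data \<Rightarrow> (real \<Rightarrow> complex) \<Rightarrow> (real \<Rightarrow> complex) \<Rightarrow> complex" where
  "sl_inner1 D f g =
     of_real (1 / (sl_p1 D)\<^sup>2)
       * (LINT x|lebesgue_on {-1<..<sl_h1 D}. f x * cnj (g x)) +
     of_real (1 / ((sl_p2 D)\<^sup>2 * sl_theta D))
       * (LINT x|lebesgue_on {sl_h1 D<..<sl_h2 D}. f x * cnj (g x)) +
     of_real (1 / ((sl_p3 D)\<^sup>2 * sl_theta D * sl_gamma D))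
       * (LINT x|lebesgue_on {sl_h2 D<..<sl_h3 D}. f x * cnj (g x)) +
     of_real (1 / ((sl_p4 D)\<^sup>2 * sl_theta D * sl_gamma D * sl_xi D))
       * (LINT x|lebesgue_on {sl_h3 D<..<1}. f x * cnj (g x))"

type_synonym sl_pair = "(real \<Rightarrow> complex) \<times> complex"

definition sl_H :: "sl_data \<Rightarrow> sl_pair set" where
  "sl_H D = sl_H1 D \<times> UNIV"

definition sl_Heq :: "sl_data \<Rightarrow> sl_pair \<Rightarrow> sl_pair \<Rightarrow> bool" where
  "sl_Heq D F G \<longleftrightarrow> (AE x in lebesgue_on (sl_I D). fst F x = fst G x) \<and> snd F = snd G"

definition sl_inner :: "sl_data \<Rightarrow> sl_pair \<Rightarrow> sl_pair \<Rightarrow> complex" where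
  "sl_inner D F G = sl_inner1 D (fst F) (fst G)
     + of_real (1 / (sl_rho D * sl_theta D * sl_gamma D * sl_xi D)) * snd F * cnj (snd G)"

definition sl_Hnorm :: "sl_data \<Rightarrow> sl_pair \<Rightarrow> real" where
  "sl_Hnorm D F = sqrt (Re (sl_inner D F F))"

definition sl_Hscale :: "complex \<Rightarrow> sl_pair \<Rightarrow> sl_pair" where
  "sl_Hscale c F = ((\<lambda>x. c * fst F x), c * snd F)"

text \<open>\<open>sl_Hsums D G F\<close>: the series \<open>\<Sum>n. G n\<close> converges to \<open>F\<close> in the norm of \<open>H\<close>.\<close>

definition sl_Hsums :: "sl_data \<Rightarrow> (nat \<Rightarrow> sl_pair) \<Rightarrow> sl_pair \<Rightarrow> bool" where
  "sl_Hsums D G F \<longleftrightarrow>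
     (\<lambda>m. sl_Hnorm D ((\<lambda>x. fst F x - (\<Sum>n<m. fst (G n) x)), snd F - (\<Sum>n<m. snd (G n))))
       \<longlonglongrightarrow> 0"


text \<open>
  The domain consists of the (locally absolutely continuous) representatives. If \<open>f\<close> is
  locally absolutely continuous and \<open>f'\<close> agrees almost everywhere with a locally absolutely
  continuous function, then \<open>f\<close> is continuously differentiable, so that differentiability
  at every point is part of the requirement on \<open>f'\<close>.
\<close>

definition sl_domain :: "sl_data \<Rightarrow> sl_pair set" where
  "sl_domain D = {(f, h). (f, h) \<in> sl_H D \<and>
     (\<forall>S\<in>sl_subintervals D. loc_abs_cont_on S f \<and> (\<forall>x\<in>S. f differentiable (at x)) \<and>
                            loc_abs_cont_on S (sl_deriv f)) \<and>
     sl_tau D f \<in> sl_H1 D \<and> sl_bc D f \<and> h = sl_N' D f}"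

definition sl_A :: "sl_data \<Rightarrow> sl_pair \<Rightarrow> sl_pair" where
  "sl_A D F = (sl_tau D (fst F), - sl_N D (fst F))"

definition sl_A_eigenfunctions :: "sl_data \<Rightarrow> sl_pair set" where
  "sl_A_eigenfunctions D = {F \<in> sl_domain D. \<not> sl_Heq D F ((\<lambda>x. 0), 0) \<and>
     (\<exists>\<mu>. sl_Heq D (sl_A D F) (sl_Hscale \<mu> F))}"

definition sl_augment :: "sl_data \<Rightarrow> (real \<Rightarrow> complex) \<Rightarrow> sl_pair" where
  "sl_augment D u = (u, sl_N' D u)"

text \<open>
  An orthonormal set contains at most one representative of each element of \<open>H\<close>, because
  two representatives of the same unit vector have inner product 1.
\<close>

definition sl_orthonormal :: "sl_data \<Rightarrow> sl_pair set \<Rightarrow> bool" where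
  "sl_orthonormal D S \<longleftrightarrow> (\<forall>F\<in>S. \<forall>G\<in>S. sl_inner D F G = (if F = G then 1 else 0))"

definition sl_maximal_orthonormal_eigenfunctions :: "sl_data \<Rightarrow> sl_pair set \<Rightarrow> bool" where
  "sl_maximal_orthonormal_eigenfunctions D S \<longleftrightarrow>
     S \<subseteq> sl_A_eigenfunctions D \<and> sl_orthonormal D S \<and>
     (\<forall>T. S \<subseteq> T \<and> T \<subseteq> sl_A_eigenfunctions D \<and> sl_orthonormal D T \<longrightarrow> T = S)"

end

theory Submission
  imports Defs "HOL-Library.Function_Algebras" "HOL-Complex_Analysis.Great_Picard"
begin

text \<open>
  The operator \<open>A\<close> is self-adjoint with compact resolvent, and the eigenvectors of such an operator
  span the space.

  Symmetry is the Lagrange identity on each of the four intervals (\<open>graph_symmetric\<close>). The boundary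
  terms cancel because the transmission conditions at a point multiply the Wronskian of two functions
  by the determinant \<open>\<theta>\<close>, \<open>\<gamma>\<close> or \<open>\<xi>\<close>, by which the weight of the inner product is divided there; the term
  at \<open>1\<close> is absorbed by the component in \<open>\<complex>\<close>.

  For nonreal \<open>\<mu>\<close> the equation \<open>(A - \<mu>) Y = F\<close> is solved by shooting (\<open>resolvent_bounded\<close>). The
  initial value problem is solvable on each interval with bounds that depend on the norm of \<open>F\<close> only,
  the transmission conditions continue the solution to the next interval, and the condition at \<open>1\<close> is
  met by adding a multiple of the homogeneous solution. This is possible because by symmetry \<open>\<mu>\<close> is not
  an eigenvalue. The bounds make the solutions for bounded \<open>F\<close> equi-Lipschitz, so the resolvent is
  compact by the Arzela-Ascoli theorem (\<open>resolvent_compactness\<close>).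

  Given an orthonormal sequence of eigenvectors, Bessel's inequality and completeness of \<open>H\<close> show that
  the Fourier series of \<open>F\<close> converges; the difference between \<open>F\<close> and its sum is orthogonal to the
  sequence. The orthogonal complement of the sequence is invariant under the resolvents at \<open>\<plusminus>\<i>\<close>. If it
  contained a vector of positive norm, compactness would provide a vector at which the resolvent on
  the complement attains its norm, and from it an eigenvector in the complement
  (\<open>exists_eigenvector_orthogonal\<close>), contrary to maximality.

  The remaining work connects pointwise and integral descriptions. The argument above lives in a
  relation \<open>graph\<close> of pairs whose second derivatives are integrable functions that integrate to the
  first derivatives. Lebesgue's differentiation theorem shows that its eigenvectors are eigenfunctions
  of \<open>A\<close> (\<open>graph_eigenvector_sl_A\<close>). Conversely, a solution of the problem has an absolutely continuous
  derivative, which by Lebesgue's fundamental theorem of calculus (\<open>absolutely_continuous_FTC\<close>) is the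
  integral of its derivative, so solutions lie in \<open>graph\<close> (\<open>solution_in_graph\<close>). The fundamental theorem
  is derived from the Radon-Nikodym theorem for the Lebesgue-Stieltjes measure of a monotone function.
\<close>

section \<open>Self-adjoint relations with compact resolvent\<close>

text \<open>Elements of \<open>L\<^sup>2\<close> are represented by functions, so the inner product is only semidefinite and
  completeness holds up to vectors of seminorm zero. The space is a subset \<open>H\<close> of its type
  because square integrability singles out some of the functions.\<close>

locale semi_hilbert = vector_space scale
  for scale :: "complex \<Rightarrow> 'v::ab_group_add \<Rightarrow> 'v" (infixr "*\<^sub>H" 75) +
  fixes H :: "'v set" and ip :: "'v \<Rightarrow> 'v \<Rightarrow> complex"
  assumes subspace_H: "subspace H"
    and ip_add: "\<lbrakk>x \<in> H; y \<in> H; z \<in> H\<rbrakk> \<Longrightarrow> ip (x + y) z = ip x z + ip y z"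
    and ip_scale: "\<lbrakk>x \<in> H; z \<in> H\<rbrakk> \<Longrightarrow> ip (c *\<^sub>H x) z = c * ip x z"
    and ip_cnj: "\<lbrakk>x \<in> H; y \<in> H\<rbrakk> \<Longrightarrow> ip y x = cnj (ip x y)"
    and ip_nonneg: "x \<in> H \<Longrightarrow> 0 \<le> Re (ip x x)"
    and complete_H: "\<lbrakk>\<And>n. X n \<in> H;
        \<And>e. e > 0 \<Longrightarrow> \<exists>N. \<forall>m\<ge>N. \<forall>n\<ge>N. sqrt (Re (ip (X m - X n) (X m - X n))) < e\<rbrakk>
      \<Longrightarrow> \<exists>y\<in>H. (\<lambda>n. sqrt (Re (ip (X n - y) (X n - y)))) \<longlonglongrightarrow> 0"
begin

definition sn :: "'v \<Rightarrow> real" where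
  "sn x = sqrt (Re (ip x x))"

lemma H_zero [simp, intro]: "0 \<in> H"
  and H_add [simp, intro]: "x \<in> H \<Longrightarrow> y \<in> H \<Longrightarrow> x + y \<in> H"
  and H_scale [simp, intro]: "x \<in> H \<Longrightarrow> c *\<^sub>H x \<in> H"
  and H_diff [simp, intro]: "x \<in> H \<Longrightarrow> y \<in> H \<Longrightarrow> x - y \<in> H"
  and H_sum [intro]: "(\<And>i. i \<in> I \<Longrightarrow> f i \<in> H) \<Longrightarrow> sum f I \<in> H"
  using subspace_H by (auto intro: subspace_0 subspace_add subspace_scale subspace_diff subspace_sum)

lemma ip_diff: "\<lbrakk>x \<in> H; y \<in> H; z \<in> H\<rbrakk> \<Longrightarrow> ip (x - y) z = ip x z - ip y z"
  using ip_add[of "x - y" y z] by simp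

lemma ip_add_right: "\<lbrakk>x \<in> H; y \<in> H; z \<in> H\<rbrakk> \<Longrightarrow> ip x (y + z) = ip x y + ip x z"
  by (subst (1 2 3) ip_cnj) (auto simp: ip_add)

lemma ip_diff_right: "\<lbrakk>x \<in> H; y \<in> H; z \<in> H\<rbrakk> \<Longrightarrow> ip x (y - z) = ip x y - ip x z"
  by (subst (1 2 3) ip_cnj) (auto simp: ip_diff)

lemma ip_scale_right: "\<lbrakk>x \<in> H; z \<in> H\<rbrakk> \<Longrightarrow> ip x (c *\<^sub>H z) = cnj c * ip x z"
  by (subst (1 2) ip_cnj) (auto simp: ip_scale)

lemmas ip_simps = ip_add ip_diff ip_add_right ip_diff_right ip_scale ip_scale_right

lemma ip_zero [simp]: "z \<in> H \<Longrightarrow> ip 0 z = 0" "z \<in> H \<Longrightarrow> ip z 0 = 0"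
  using ip_diff[of z z z] ip_diff_right[of z z z] by auto

lemma ip_sum: "\<lbrakk>\<And>i. i \<in> I \<Longrightarrow> f i \<in> H; z \<in> H\<rbrakk> \<Longrightarrow> ip (sum f I) z = (\<Sum>i\<in>I. ip (f i) z)"
  by (induction I rule: infinite_finite_induct) (auto simp: ip_add H_sum)

lemma sn_nonneg [simp]: "x \<in> H \<Longrightarrow> 0 \<le> sn x"
  by (simp add: sn_def ip_nonneg)

lemma sn_squared: "x \<in> H \<Longrightarrow> (sn x)\<^sup>2 = Re (ip x x)"
  by (simp add: sn_def ip_nonneg)

lemma ip_self: "x \<in> H \<Longrightarrow> ip x x = of_real ((sn x)\<^sup>2)"
  using ip_cnj[of x x] by (simp add: sn_squared complex_eq_iff)

lemma sn_zero [simp]: "sn 0 = 0"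
  by (simp add: sn_def)

lemma sn_scale: "x \<in> H \<Longrightarrow> sn (c *\<^sub>H x) = cmod c * sn x"
proof -
  assume x: "x \<in> H"
  have "ip (c *\<^sub>H x) (c *\<^sub>H x) = (c * cnj c) * ip x x"
    using x by (simp add: ip_simps)
  also have "\<dots> = of_real ((cmod c)\<^sup>2 * (sn x)\<^sup>2)"
    unfolding complex_norm_square[symmetric] ip_self[OF x] by simp
  finally have "ip (c *\<^sub>H x) (c *\<^sub>H x) = of_real ((cmod c)\<^sup>2 * (sn x)\<^sup>2)" .
  then have "(sn (c *\<^sub>H x))\<^sup>2 = (cmod c * sn x)\<^sup>2"
    using x by (simp add: sn_squared[OF H_scale] power_mult_distrib)
  then show ?thesis using x by (simp add: power2_eq_iff_nonneg)
qed

lemma Cauchy_Schwarz: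
  assumes x: "x \<in> H" and y: "y \<in> H"
  shows "cmod (ip x y) \<le> sn x * sn y"
proof -
  define a where "a = ip x y"
  have quad: "0 \<le> (sn x)\<^sup>2 - 2 * t * (cmod a)\<^sup>2 + t\<^sup>2 * (cmod a)\<^sup>2 * (sn y)\<^sup>2" for t :: real
  proof -
    let ?z = "x - (of_real t * a) *\<^sub>H y"
    have "ip ?z ?z = ip x x - cnj (of_real t * a) * a - (of_real t * a) * (cnj a)
        + (of_real t * a) * cnj (of_real t * a) * ip y y"
      using x y ip_cnj[OF x y] by (simp add: ip_simps a_def algebra_simps)
    also have "\<dots> = of_real ((sn x)\<^sup>2) - of_real (2 * t) * (a * cnj a) + of_real (t\<^sup>2) * (a * cnj a) * of_real ((sn y)\<^sup>2)"
      using x y by (simp add: ip_self algebra_simps power2_eq_square)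
    also have "\<dots> = of_real ((sn x)\<^sup>2 - 2 * t * (cmod a)\<^sup>2 + t\<^sup>2 * (cmod a)\<^sup>2 * (sn y)\<^sup>2)"
      unfolding complex_norm_square[symmetric] by simp
    finally have "Re (ip ?z ?z) = (sn x)\<^sup>2 - 2 * t * (cmod a)\<^sup>2 + t\<^sup>2 * (cmod a)\<^sup>2 * (sn y)\<^sup>2"
      by simp
    then show ?thesis using ip_nonneg[of ?z] x y by simp
  qed
  have "(cmod a)\<^sup>2 \<le> (sn x * sn y)\<^sup>2"
  proof (cases "sn y = 0")
    case True
    have "cmod a = 0"
    proof (rule ccontr)
      assume "cmod a \<noteq> 0"
      then have pos: "(cmod a)\<^sup>2 > 0" by simp
      \<comment> \<open>With \<open>sn y = 0\<close> the lower bound is affine in \<open>t\<close>, so it fails for some \<open>t\<close> unless \<open>a = 0\<close>.\<close>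
      have "2 * (((sn x)\<^sup>2 + 1) / (2 * (cmod a)\<^sup>2)) * (cmod a)\<^sup>2 = (sn x)\<^sup>2 + 1"
        using pos by simp
      then show False using quad[of "((sn x)\<^sup>2 + 1) / (2 * (cmod a)\<^sup>2)"] True by simp
    qed
    then show ?thesis by simp
  next
    case False
    then have pos: "(sn y)\<^sup>2 > 0" by simp
    have "(1 / (sn y)\<^sup>2)\<^sup>2 * (cmod a)\<^sup>2 * (sn y)\<^sup>2 = (cmod a)\<^sup>2 / (sn y)\<^sup>2"
      using pos by (simp add: power2_eq_square)
    then have "0 \<le> (sn x)\<^sup>2 - (cmod a)\<^sup>2 / (sn y)\<^sup>2"
      using quad[of "1 / (sn y)\<^sup>2"] by simp
    then show ?thesis using pos by (simp add: field_simps power_mult_distrib)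
  qed
  then show ?thesis unfolding a_def
    using x y by (simp add: power2_le_iff_abs_le)
qed

lemma sn_triangle:
  assumes x: "x \<in> H" and y: "y \<in> H"
  shows "sn (x + y) \<le> sn x + sn y"
proof -
  have "(sn (x + y))\<^sup>2 = (sn x)\<^sup>2 + (sn y)\<^sup>2 + 2 * Re (ip x y)"
    using x y ip_cnj[OF x y] by (simp add: sn_squared ip_simps)
  also have "\<dots> \<le> (sn x)\<^sup>2 + (sn y)\<^sup>2 + 2 * (sn x * sn y)"
    using Cauchy_Schwarz[OF x y] complex_Re_le_cmod[of "ip x y"] by linarith
  also have "\<dots> = (sn x + sn y)\<^sup>2" by (simp add: power2_sum)
  finally show ?thesis using x y by (simp add: power2_le_iff_abs_le)
qed

lemma sn_minus_commute: "\<lbrakk>x \<in> H; y \<in> H\<rbrakk> \<Longrightarrow> sn (x - y) = sn (y - x)"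
  unfolding sn_def by (simp add: ip_simps algebra_simps)

lemma sn_triangle_diff: "\<lbrakk>x \<in> H; y \<in> H; z \<in> H\<rbrakk> \<Longrightarrow> sn (x - z) \<le> sn (x - y) + sn (y - z)"
  using sn_triangle[of "x - y" "y - z"] by simp

lemma sn_diff_le: "\<lbrakk>x \<in> H; y \<in> H\<rbrakk> \<Longrightarrow> \<bar>sn x - sn y\<bar> \<le> sn (x - y)"
  using sn_triangle_diff[of x y 0] sn_triangle_diff[of y x 0] sn_minus_commute[of x y] by auto

text \<open>Vectors matter only up to vectors of seminorm zero, so seminorms of differences replace equality
  and convergence from here on.\<close>

lemma ip_null:
  assumes "x \<in> H" "y \<in> H" "z \<in> H" "sn (x - y) = 0"
  shows "ip x z = ip y z"
  using Cauchy_Schwarz[of "x - y" z] assms by (simp add: ip_simps)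

lemma ip_limit:
  assumes X: "\<And>n. X n \<in> H" and x: "x \<in> H" and z: "z \<in> H"
    and lim: "(\<lambda>n. sn (X n - x)) \<longlonglongrightarrow> 0"
  shows "(\<lambda>n. ip (X n) z) \<longlonglongrightarrow> ip x z"
proof -
  have "(\<lambda>n. ip (X n) z - ip x z) \<longlonglongrightarrow> 0"
  proof (rule Lim_null_comparison)
    show "\<forall>\<^sub>F n in sequentially. norm (ip (X n) z - ip x z) \<le> sn (X n - x) * sn z"
      using Cauchy_Schwarz[OF H_diff[OF X x] z] X x z by (simp add: ip_diff)
    show "(\<lambda>n. sn (X n - x) * sn z) \<longlonglongrightarrow> 0"
      using tendsto_mult_right[OF lim, of "sn z"] by simp
  qed
  then show ?thesis by (simp add: LIM_zero_iff)
qed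

lemma sn_limit:
  assumes X: "\<And>n. X n \<in> H" and x: "x \<in> H"
    and lim: "(\<lambda>n. sn (X n - x)) \<longlonglongrightarrow> 0"
  shows "(\<lambda>n. sn (X n)) \<longlonglongrightarrow> sn x"
proof -
  have "(\<lambda>n. sn (X n) - sn x) \<longlonglongrightarrow> 0"
    by (rule Lim_null_comparison[OF _ lim]) (use X x sn_diff_le in auto)
  then show ?thesis by (simp add: LIM_zero_iff)
qed

text \<open>By Bessel's inequality the squared coefficients are summable, which makes the remainders of the
  Fourier series a Cauchy sequence.\<close>

lemma Fourier_series_limit:
  assumes x: "x \<in> H" and e: "\<And>n. e n \<in> H"
    and orth: "\<And>m n. ip (e m) (e n) = (if m = n then 1 else 0)"
  obtains y where "y \<in> H" "(\<lambda>m. sn (x - (\<Sum>n<m. ip x (e n) *\<^sub>H e n) - y)) \<longlonglongrightarrow> 0"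
    "\<And>n. ip y (e n) = 0"
proof -
  define S where "S m = (\<Sum>n<m. ip x (e n) *\<^sub>H e n)" for m
  define c where "c n = (cmod (ip x (e n)))\<^sup>2" for n
  have SH: "S m \<in> H" for m unfolding S_def by (auto simp: e)
  have S_orth: "ip (S m) (e k) = (if k < m then ip x (e k) else 0)" for m k
    unfolding S_def by (subst ip_sum) (auto simp: e ip_scale orth if_distrib cong: if_cong)
  have Sx: "ip (S m) x = of_real (sum c {..<m})" for m
  proof -
    have "ip (S m) x = (\<Sum>n<m. ip x (e n) * ip (e n) x)"
      unfolding S_def by (subst ip_sum) (auto simp: e x ip_scale)
    also have "\<dots> = (\<Sum>n<m. of_real (c n))"
      unfolding c_def by (intro sum.cong refl) (simp add: ip_cnj[OF x e] complex_norm_square del: of_real_power)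
    finally show ?thesis by simp
  qed
  have SS: "ip (S k) (S m) = of_real (sum c {..<min k m})" for k m
  proof -
    have "ip (S m) (S k) = (\<Sum>n<m. ip x (e n) * ip (e n) (S k))"
      unfolding S_def[of m] by (subst ip_sum) (auto simp: e SH ip_scale)
    also have "\<dots> = (\<Sum>n<m. if n < k then of_real (c n) else 0)"
      unfolding c_def by (intro sum.cong refl) (simp add: ip_cnj[OF SH e] S_orth complex_norm_square del: of_real_power)
    also have "\<dots> = of_real (sum c {..<min k m})"
    proof -
      have "{..<m} \<inter> {n. n < k} = {..<min k m}" by auto
      then show ?thesis by (simp add: sum.If_cases)
    qed
    finally have "ip (S m) (S k) = of_real (sum c {..<min k m})" .
    then show ?thesis by (subst ip_cnj[OF SH SH]) simp
  qed
  have c0: "c n \<ge> 0" for n by (simp add: c_def)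
  have bessel: "sum c {..<m} \<le> (sn x)\<^sup>2" for m
  proof -
    have "ip x (S m) = of_real (sum c {..<m})" using ip_cnj[OF SH x, of m] Sx[of m] by simp
    then have "Re (ip (x - S m) (x - S m)) = (sn x)\<^sup>2 - sum c {..<m}"
      using x SH[of m] by (simp add: ip_simps Sx SS sn_squared)
    then show ?thesis using ip_nonneg[of "x - S m"] x SH[of m] by simp
  qed
  have "summable c"
    by (rule summableI_nonneg_bounded[OF c0 bessel])
  then have cauchy: "Cauchy (\<lambda>m. sum c {..<m})"
    by (simp add: summable_iff_convergent convergent_Cauchy)
  have dist: "(sn (S m - S n))\<^sup>2 = \<bar>sum c {..<m} - sum c {..<n}\<bar>" for m n
  proof -
    have "(sn (S m - S n))\<^sup>2 = sum c {..<m} + sum c {..<n} - 2 * sum c {..<min m n}"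
      using SH by (simp add: sn_squared ip_simps SS min.commute)
    moreover have mono: "sum c {..<m} \<le> sum c {..<n}" if "m \<le> n" for m n
      using that by (intro sum_mono2) (auto simp: c0)
    ultimately show ?thesis
      using mono[of m n] mono[of n m] by (cases "m \<le> n") (auto simp: min_def)
  qed
  have "\<exists>y\<in>H. (\<lambda>n. sqrt (Re (ip ((x - S n) - y) ((x - S n) - y)))) \<longlonglongrightarrow> 0"
  proof (rule complete_H)
    show "x - S n \<in> H" for n using x SH by auto
    fix d :: real assume d: "d > 0"
    then obtain N where N: "\<And>m n. m \<ge> N \<Longrightarrow> n \<ge> N \<Longrightarrow> \<bar>sum c {..<m} - sum c {..<n}\<bar> < d\<^sup>2"
      using cauchy unfolding Cauchy_def dist_real_def by (metis zero_less_power)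
    have "sn (x - S m - (x - S n)) < d" if "m \<ge> N" "n \<ge> N" for m n
    proof -
      have "(sn (S n - S m))\<^sup>2 < d\<^sup>2" using N[OF that(2,1)] by (simp add: dist)
      then show ?thesis using d by (simp add: power_less_imp_less_base)
    qed
    then show "\<exists>N. \<forall>m\<ge>N. \<forall>n\<ge>N. sqrt (Re (ip (x - S m - (x - S n)) (x - S m - (x - S n)))) < d"
      unfolding sn_def by blast
  qed
  then obtain y where y: "y \<in> H" "(\<lambda>n. sn (x - S n - y)) \<longlonglongrightarrow> 0"
    unfolding sn_def by blast
  have "ip y (e k) = 0" for k
  proof -
    have "(\<lambda>n. ip (x - S n) (e k)) \<longlonglongrightarrow> ip y (e k)"
      by (rule ip_limit) (use x SH y e in auto)
    moreover have "\<forall>\<^sub>F n in sequentially. ip (x - S n) (e k) = 0"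
      by (rule eventually_sequentiallyI[of "Suc k"]) (use x SH e in \<open>auto simp: ip_diff S_orth\<close>)
    ultimately show ?thesis
      using tendsto_unique[OF _ _ tendsto_eventually] by (metis sequentially_bot)
  qed
  then show thesis using that[OF y(1)] y(2) unfolding S_def by blast
qed

end

text \<open>The operator is given by a linear relation because the image of a vector is only determined up to
  vectors of seminorm zero. A symmetric relation \<open>A\<close> is self-adjoint as soon as \<open>A - \<i>\<close> and \<open>A + \<i>\<close>
  are surjective; the resolvent at \<open>\<i>\<close> is moreover compact, and \<open>resolvent_compact\<close> contains its
  existence.\<close>

locale self_adjoint_relation = semi_hilbert scale H ip
  for scale :: "complex \<Rightarrow> 'v::ab_group_add \<Rightarrow> 'v" (infixr "*\<^sub>H" 75) and H ip +
  fixes Gr :: "('v \<times> 'v) set"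
  assumes single_valued: "\<lbrakk>(x, x') \<in> Gr; sn x = 0\<rbrakk> \<Longrightarrow> sn x' = 0"
    and Gr_H: "(x, x') \<in> Gr \<Longrightarrow> x \<in> H \<and> x' \<in> H"
    and Gr_add: "\<lbrakk>(x, x') \<in> Gr; (y, y') \<in> Gr\<rbrakk> \<Longrightarrow> (x + y, x' + y') \<in> Gr"
    and Gr_scale: "(x, x') \<in> Gr \<Longrightarrow> (c *\<^sub>H x, c *\<^sub>H x') \<in> Gr"
    and Gr_null: "\<lbrakk>(x, x') \<in> Gr; x'' \<in> H; sn (x'' - x') = 0\<rbrakk> \<Longrightarrow> (x, x'') \<in> Gr"
    and symmetric: "\<lbrakk>(x, x') \<in> Gr; (y, y') \<in> Gr\<rbrakk> \<Longrightarrow> ip x' y = ip x y'"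
    and resolvent_minus: "x \<in> H \<Longrightarrow> \<exists>y. (y, x - \<i> *\<^sub>H y) \<in> Gr"
    and resolvent_compact: "\<lbrakk>\<And>n. X n \<in> H; \<And>n. sn (X n) \<le> C\<rbrakk> \<Longrightarrow>
      \<exists>Y y r. (\<forall>n. (Y n, X n + \<i> *\<^sub>H Y n) \<in> Gr) \<and> y \<in> H \<and> strict_mono (r :: nat \<Rightarrow> nat) \<and>
        (\<lambda>n. sn (Y (r n) - y)) \<longlonglongrightarrow> 0"
begin

lemma Gr_minus: "\<lbrakk>(x, x') \<in> Gr; (y, y') \<in> Gr\<rbrakk> \<Longrightarrow> (x - y, x' - y') \<in> Gr"
  using Gr_add[of x x' "- y" "- y'"] Gr_scale[of y y' "- 1"] by (simp add: scale_minus_left)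

lemma resolvent_plus:
  assumes "x \<in> H" shows "\<exists>y. (y, x + \<i> *\<^sub>H y) \<in> Gr"
  using resolvent_compact[of "\<lambda>_. x" "sn x"] assms by auto

text \<open>As \<open>ip (A y) y\<close> is real, the imaginary part of \<open>ip x y\<close> is \<open>(sn y)\<^sup>2\<close> up to sign.\<close>

lemma sn_resolvent:
  assumes xy: "(y, x + c *\<^sub>H y) \<in> Gr" and x: "x \<in> H" and c: "c = \<i> \<or> c = - \<i>"
  shows "sn y \<le> sn x"
proof -
  have y: "y \<in> H" using Gr_H[OF xy] by simp
  have "ip (x + c *\<^sub>H y) y = ip y (x + c *\<^sub>H y)"
    by (rule symmetric[OF xy xy])
  then have eq: "ip x y + c * ip y y = ip y x + cnj c * ip y y"
    using x y by (simp add: ip_simps)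
  have "cmod (ip x y) \<ge> (sn y)\<^sup>2"
  proof -
    have "Im (ip x y) + Im (c * ip y y) = Im (cnj (ip x y)) + Im (cnj c * ip y y)"
      using arg_cong[OF eq, of Im] ip_cnj[OF x y] by simp
    then have "Im (ip x y) = (sn y)\<^sup>2 \<or> Im (ip x y) = - (sn y)\<^sup>2"
      using c by (auto simp: ip_self[OF y] simp del: of_real_power)
    then have "\<bar>Im (ip x y)\<bar> = (sn y)\<^sup>2" by auto
    then show ?thesis using abs_Im_le_cmod[of "ip x y"] by simp
  qed
  then have "sn y * sn y \<le> sn x * sn y"
    using Cauchy_Schwarz[OF x y] by (simp add: power2_eq_square)
  then show ?thesis
    using sn_nonneg[OF x] sn_nonneg[OF y] by (cases "sn y = 0") (auto simp: mult_le_cancel_right)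
qed

lemma sn_resolvent_diff:
  assumes xy: "(y, x + c *\<^sub>H y) \<in> Gr" "(y', x' + c *\<^sub>H y') \<in> Gr" and x: "x \<in> H" "x' \<in> H"
    and c: "c = \<i> \<or> c = - \<i>"
  shows "sn (y - y') \<le> sn (x - x')"
proof (rule sn_resolvent[OF _ _ c])
  have "(x + c *\<^sub>H y) - (x' + c *\<^sub>H y') = (x - x') + c *\<^sub>H (y - y')"
    unfolding scale_right_diff_distrib by (simp only: diff_conv_add_uminus minus_add_distrib ac_simps)
  then show "(y - y', x - x' + c *\<^sub>H (y - y')) \<in> Gr"
    using Gr_minus[OF xy] by metis
qed (use x in auto)

lemma eigenvalue_real:
  assumes e: "(e, c *\<^sub>H e) \<in> Gr" and nz: "sn e \<noteq> 0"
  shows "cnj c = c"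
proof -
  have eH: "e \<in> H" using Gr_H[OF e] by simp
  have "c * ip e e = cnj c * ip e e"
    using symmetric[OF e e] eH by (simp add: ip_simps)
  then show ?thesis using nz by (simp add: ip_self[OF eH])
qed

text \<open>Symmetry gives \<open>c * ip y e = l * ip y e\<close>, where \<open>l\<close> is real and \<open>c\<close> is not.\<close>

lemma resolvent_orthogonal:
  assumes xy: "(y, x + c *\<^sub>H y) \<in> Gr" and x: "x \<in> H" and c: "c = \<i> \<or> c = - \<i>"
    and e: "(e, l *\<^sub>H e) \<in> Gr" and orth: "ip x e = 0"
  shows "ip y e = 0"
proof (cases "sn e = 0")
  case True
  then show ?thesis using Cauchy_Schwarz[of y e] Gr_H[OF xy] Gr_H[OF e] by simp
next
  case False
  have H: "y \<in> H" "e \<in> H" using Gr_H[OF xy] Gr_H[OF e] by auto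
  have l: "cnj l = l" by (rule eigenvalue_real[OF e False])
  have "ip (x + c *\<^sub>H y) e = ip y (l *\<^sub>H e)" by (rule symmetric[OF xy e])
  then have "c * ip y e = l * ip y e" using H x orth l by (simp add: ip_simps)
  moreover have "c \<noteq> l" using l c by (auto simp: complex_eq_iff)
  ultimately show ?thesis by simp
qed

text \<open>The orthogonal complement \<open>M\<close> of the eigenvectors is invariant under the resolvents \<open>R\<close> and \<open>R'\<close> at
  \<open>\<i>\<close> and \<open>- \<i>\<close>, which are adjoint to each other. By compactness the norm \<open>m\<close> of \<open>R\<close> on \<open>M\<close> is attained,
  and a maximising vector \<open>x\<close> satisfies \<open>R' (R x) = m\<^sup>2 *\<^sub>H x\<close>. The relation then maps the span of \<open>x\<close> and
  \<open>R x\<close> into itself, and an eigenvector can be written down.\<close>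

lemma exists_eigenvector_orthogonal:
  fixes e :: "'i \<Rightarrow> 'v"
  assumes e: "\<And>n. (e n, l n *\<^sub>H e n) \<in> Gr"
    and f: "f \<in> H" "sn f \<noteq> 0" "\<And>n. ip f (e n) = 0"
  shows "\<exists>z k. (z, of_real k *\<^sub>H z) \<in> Gr \<and> sn z \<noteq> 0 \<and> (\<forall>n. ip z (e n) = 0)"
proof -
  have eH: "e n \<in> H" for n using Gr_H[OF e] by simp
  define M where "M = {x \<in> H. \<forall>n. ip x (e n) = 0}"
  have MH: "x \<in> M \<Longrightarrow> x \<in> H" for x by (simp add: M_def)
  have M_res: "y \<in> M" if "(y, x + c *\<^sub>H y) \<in> Gr" "x \<in> M" "c = \<i> \<or> c = - \<i>" for x y c
    using resolvent_orthogonal[OF that(1) _ that(3) e] that(1,2) Gr_H unfolding M_def by blast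
  have M_scale: "c *\<^sub>H x \<in> M" if "x \<in> M" for c x
    using that eH by (auto simp: M_def ip_simps)
  have M_add: "x + y \<in> M" if "x \<in> M" "y \<in> M" for x y
    using that eH by (auto simp: M_def ip_simps)
  obtain R where R: "\<And>x. x \<in> H \<Longrightarrow> (R x, x + \<i> *\<^sub>H R x) \<in> Gr"
    using resolvent_plus by metis
  obtain R' where "\<And>x. x \<in> H \<Longrightarrow> (R' x, x - \<i> *\<^sub>H R' x) \<in> Gr"
    using resolvent_minus by metis
  then have R': "(R' x, x + (- \<i>) *\<^sub>H R' x) \<in> Gr" if "x \<in> H" for x
    using that by simp
  have RH: "R x \<in> H" "R' x \<in> H" if "x \<in> H" for x using Gr_H R R' that by blast+
  have RM: "R x \<in> M" if "x \<in> M" for x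
    using M_res[OF R that] MH[OF that] by simp
  have R'M: "R' x \<in> M" if "x \<in> M" for x
    using M_res[OF R' that] MH[OF that] by simp
  have adj: "ip (R' x) y = ip x (R y)" if x: "x \<in> H" and y: "y \<in> H" for x y
  proof -
    have "ip (x + (- \<i>) *\<^sub>H R' x) (R y) = ip (R' x) (y + \<i> *\<^sub>H R y)"
      by (rule symmetric[OF R' R]) (use x y in auto)
    then show ?thesis using x y RH by (simp add: ip_simps)
  qed
  define m where "m = (SUP x\<in>{x\<in>M. sn x = 1}. sn (R x))"
  have bdd: "bdd_above ((\<lambda>x. sn (R x)) ` {x\<in>M. sn x = 1})"
    by (rule bdd_aboveI[of _ 1]) (use sn_resolvent[OF R] MH in force)
  have R_le: "sn (R x) \<le> m * sn x" if x: "x \<in> M" for x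
  proof (cases "sn x = 0")
    case True
    then show ?thesis using sn_resolvent[OF R] MH[OF x] by fastforce
  next
    case False
    define x1 where "x1 = of_real (1 / sn x) *\<^sub>H x"
    have x1: "x1 \<in> M" "sn x1 = 1"
      using x False sn_nonneg[OF MH[OF x]] by (auto simp: x1_def M_scale sn_scale MH norm_divide)
    have "sn (R x1) \<le> m" unfolding m_def by (rule cSUP_upper[OF _ bdd]) (use x1 in auto)
    moreover have "sn (R x1 - of_real (1 / sn x) *\<^sub>H R x) \<le> sn (x1 - x1)"
    proof (rule sn_resolvent_diff[OF R])
      show "(of_real (1 / sn x) *\<^sub>H R x, x1 + \<i> *\<^sub>H (of_real (1 / sn x) *\<^sub>H R x)) \<in> Gr"
        using Gr_scale[OF R[OF MH[OF x]], of "of_real (1 / sn x)"]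
        by (simp add: x1_def scale_right_distrib mult.commute)
    qed (use x1 MH in auto)
    then have "sn (R x1) = sn (of_real (1 / sn x) *\<^sub>H R x)"
      using sn_diff_le[of "R x1" "of_real (1 / sn x) *\<^sub>H R x"] RH MH x x1 by simp
    ultimately show ?thesis
      using False sn_nonneg[OF MH[OF x]] RH[OF MH[OF x]] by (simp add: sn_scale norm_divide field_simps)
  qed
  have R_pos: "sn (R x) \<noteq> 0" if x: "x \<in> M" and nz: "sn x \<noteq> 0" for x
  proof
    assume 0: "sn (R x) = 0"
    have "sn (x + \<i> *\<^sub>H R x) = 0" by (rule single_valued[OF R 0]) (use MH[OF x] in auto)
    moreover have "x = (x + \<i> *\<^sub>H R x) + (- \<i>) *\<^sub>H R x" by simp
    then have "sn x \<le> sn (x + \<i> *\<^sub>H R x) + sn ((- \<i>) *\<^sub>H R x)"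
      using sn_triangle[of "x + \<i> *\<^sub>H R x" "(- \<i>) *\<^sub>H R x"] MH[OF x] RH(1)[OF MH[OF x]]
        H_scale[OF RH(1)[OF MH[OF x]], of "- \<i>"] by simp
    ultimately show False
      using 0 nz sn_nonneg[OF MH[OF x]] RH(1)[OF MH[OF x]] sn_scale[of "R x" "- \<i>"] by simp
  qed
  have fM: "f \<in> M" using f by (simp add: M_def)
  have m_pos: "m > 0"
  proof -
    have "0 < sn (R f)" using R_pos[OF fM f(2)] sn_nonneg[OF RH(1)[OF f(1)]] by linarith
    then have "0 < m * sn f" using R_le[OF fM] by linarith
    then show ?thesis using sn_nonneg[OF f(1)] f(2) by (simp add: zero_less_mult_iff)
  qed
  have ne: "{x \<in> M. sn x = 1} \<noteq> {}"
  proof -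
    have "of_real (1 / sn f) *\<^sub>H f \<in> M" "sn (of_real (1 / sn f) *\<^sub>H f) = 1"
      using fM f(1,2) sn_nonneg[OF f(1)] by (simp_all add: M_scale sn_scale norm_divide)
    then show ?thesis by blast
  qed
  have m_le: "m \<le> 1" unfolding m_def
    by (rule cSUP_least[OF ne]) (use sn_resolvent[OF R] MH in force)
  have "\<exists>x. x \<in> M \<and> sn x = 1 \<and> m - 1 / Suc n < sn (R x)" for n
  proof -
    have "m - 1 / Suc n < m" by simp
    then show ?thesis unfolding m_def by (subst (asm) less_cSUP_iff[OF ne bdd]) auto
  qed
  then obtain X where X: "\<And>n. X n \<in> M" "\<And>n. sn (X n) = 1" "\<And>n. m - 1 / Suc n < sn (R (X n))"
    by metis
  have XH: "X n \<in> H" for n using MH X by blast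
  obtain Y y r where Y: "\<And>n. (Y n, X n + \<i> *\<^sub>H Y n) \<in> Gr" and y: "y \<in> H" and r: "strict_mono r"
    and lim: "(\<lambda>n. sn (Y (r n) - y)) \<longlonglongrightarrow> 0"
    using resolvent_compact[of X 1] X XH by auto
  have YH: "Y n \<in> H" for n using Gr_H[OF Y] by simp
  have YR: "sn (Y n - R (X n)) = 0" for n
  proof -
    have "sn (Y n - R (X n)) \<le> sn (X n - X n)"
      by (rule sn_resolvent_diff[OF Y R[OF XH]]) (use XH in auto)
    then show ?thesis using sn_nonneg[OF H_diff[OF YH[of n] RH(1)[OF XH[of n]]]] by simp
  qed
  have nY: "sn (Y n) = sn (R (X n))" for n
    using sn_diff_le[of "Y n" "R (X n)"] YR[of n] YH RH[OF XH] by simp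
  define W where "W n = R' (Y n)" for n
  have YM: "Y n \<in> M" for n using M_res[OF Y X(1)] by simp
  have WM: "W n \<in> M" for n using R'M YM by (simp add: W_def)
  have WH: "W n \<in> H" for n using MH WM by blast
  \<comment> \<open>A maximising sequence consists of approximate eigenvectors of the positive operator \<open>R' \<circ> R\<close>:
    \<open>W n\<close> is \<open>R' (R (X n))\<close> up to a null vector, and \<open>W n - m\<^sup>2 *\<^sub>H X n\<close> tends to \<open>0\<close>.\<close>
  have ipWX: "ip (W n) (X n) = of_real ((sn (Y n))\<^sup>2)" for n
  proof -
    have "ip (W n) (X n) = ip (Y n) (R (X n))" unfolding W_def by (rule adj[OF YH XH])
    also have "\<dots> = cnj (ip (R (X n)) (Y n))" by (rule ip_cnj[OF RH(1)[OF XH] YH])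
    also have "ip (R (X n)) (Y n) = ip (Y n) (Y n)"
      by (rule ip_null) (use YH RH XH YR sn_minus_commute in auto)
    finally show ?thesis by (simp add: ip_self[OF YH])
  qed
  have W_le: "sn (W n) \<le> m * sn (Y n)" for n
  proof -
    have "of_real ((sn (W n))\<^sup>2) = ip (W n) (W n)" by (simp add: ip_self[OF WH])
    also have "\<dots> = ip (Y n) (R (W n))" unfolding W_def by (rule adj) (use YH RH in auto)
    finally have "(sn (W n))\<^sup>2 = cmod (ip (Y n) (R (W n)))"
      by (metis abs_power2 norm_of_real)
    also have "\<dots> \<le> sn (Y n) * sn (R (W n))" by (rule Cauchy_Schwarz) (use YH RH WH in auto)
    also have "\<dots> \<le> sn (Y n) * (m * sn (W n))"
      using R_le[OF WM] sn_nonneg[OF YH] by (simp add: mult_left_mono)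
    finally have "sn (W n) * sn (W n) \<le> (m * sn (Y n)) * sn (W n)"
      by (simp add: power2_eq_square mult_ac)
    then show ?thesis using sn_nonneg[OF WH, of n] sn_nonneg[OF YH, of n] m_pos
      by (cases "sn (W n) = 0") (auto simp: mult_le_cancel_right)
  qed
  have W_X: "(sn (W n - of_real (m\<^sup>2) *\<^sub>H X n))\<^sup>2 \<le> m\<^sup>2 * (m\<^sup>2 - (sn (Y n))\<^sup>2)" for n
  proof -
    have "ip (X n) (W n) = of_real ((sn (Y n))\<^sup>2)" using ip_cnj[OF WH XH, of n n] ipWX[of n] by simp
    then have "ip (W n - of_real (m\<^sup>2) *\<^sub>H X n) (W n - of_real (m\<^sup>2) *\<^sub>H X n) =
        of_real ((sn (W n))\<^sup>2 - 2 * m\<^sup>2 * (sn (Y n))\<^sup>2 + m\<^sup>2 * m\<^sup>2)"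
      using WH[of n] XH[of n] X(2)[of n] ip_self[OF WH, of n] ip_self[OF XH, of n]
      by (simp add: ip_simps ipWX algebra_simps power2_eq_square power4_eq_xxxx)
    then have "(sn (W n - of_real (m\<^sup>2) *\<^sub>H X n))\<^sup>2 = (sn (W n))\<^sup>2 - 2 * m\<^sup>2 * (sn (Y n))\<^sup>2 + m\<^sup>2 * m\<^sup>2"
      using sn_squared[of "W n - of_real (m\<^sup>2) *\<^sub>H X n"] WH[of n] XH[of n]
      by (simp del: of_real_power of_real_mult of_real_diff of_real_add)
    moreover have "(sn (W n))\<^sup>2 \<le> m\<^sup>2 * (sn (Y n))\<^sup>2"
      using power_mono[OF W_le sn_nonneg[OF WH], of n 2] by (simp add: power_mult_distrib)
    ultimately show ?thesis by (simp add: algebra_simps)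
  qed
  have m_lim: "(\<lambda>n. sn (Y n)) \<longlonglongrightarrow> m"
  proof (rule tendsto_sandwich[of "\<lambda>n. m - 1 / Suc n" _ _ "\<lambda>_. m"])
    show "(\<lambda>n. m - 1 / Suc n) \<longlonglongrightarrow> m"
      using tendsto_diff[OF tendsto_const[of m] LIMSEQ_Suc[OF lim_1_over_n]] by simp
    show "\<forall>\<^sub>F n in sequentially. m - 1 / Suc n \<le> sn (Y n)"
      using X(3) by (auto simp: nY intro!: always_eventually less_imp_le)
    show "\<forall>\<^sub>F n in sequentially. sn (Y n) \<le> m"
      using R_le[OF X(1)] X(2) by (simp add: nY)
  qed auto
  have WX_lim: "(\<lambda>n. sn (W n - of_real (m\<^sup>2) *\<^sub>H X n)) \<longlonglongrightarrow> 0"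
  proof (rule Lim_null_comparison)
    show "\<forall>\<^sub>F n in sequentially. norm (sn (W n - of_real (m\<^sup>2) *\<^sub>H X n)) \<le> sqrt (m\<^sup>2 * (m\<^sup>2 - (sn (Y n))\<^sup>2))"
      using W_X WH XH by (auto intro!: always_eventually real_le_rsqrt)
    have "(\<lambda>n. sqrt (m\<^sup>2 * (m\<^sup>2 - (sn (Y n))\<^sup>2))) \<longlonglongrightarrow> sqrt (m\<^sup>2 * (m\<^sup>2 - m\<^sup>2))"
      by (intro tendsto_intros m_lim)
    then show "(\<lambda>n. sqrt (m\<^sup>2 * (m\<^sup>2 - (sn (Y n))\<^sup>2))) \<longlonglongrightarrow> 0" by simp
  qed
  define w where "w = R' y"
  have wH: "w \<in> H" using RH y by (simp add: w_def)
  define x where "x = of_real (1 / m\<^sup>2) *\<^sub>H w"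
  have xH: "x \<in> H" using wH by (simp add: x_def)
  have mm: "complex_of_real (m\<^sup>2) * of_real (1 / m\<^sup>2) = 1" "of_real (1 / m\<^sup>2) * complex_of_real (m\<^sup>2) = 1"
    using m_pos by simp_all
  have X_lim: "(\<lambda>n. sn (X (r n) - x)) \<longlonglongrightarrow> 0"
  proof (rule Lim_null_comparison)
    have "sn (X (r n) - x) \<le> (1 / m\<^sup>2) * (sn (W (r n) - of_real (m\<^sup>2) *\<^sub>H X (r n)) + sn (Y (r n) - y))" for n
    proof -
      have "X (r n) - x = of_real (1 / m\<^sup>2) *\<^sub>H (of_real (m\<^sup>2) *\<^sub>H X (r n) - w)"
        unfolding x_def scale_right_diff_distrib scale_scale mm by simp
      then have "sn (X (r n) - x) = (1 / m\<^sup>2) * sn (of_real (m\<^sup>2) *\<^sub>H X (r n) - w)"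
        using XH wH by (simp add: sn_scale norm_divide norm_power del: of_real_power)
      moreover have "sn (of_real (m\<^sup>2) *\<^sub>H X (r n) - w) \<le> sn (of_real (m\<^sup>2) *\<^sub>H X (r n) - W (r n)) + sn (W (r n) - w)"
        by (rule sn_triangle_diff) (use XH WH wH in auto)
      moreover have "sn (W (r n) - w) \<le> sn (Y (r n) - y)"
        unfolding W_def w_def by (rule sn_resolvent_diff[OF R' R']) (use YH y in auto)
      moreover have "sn (of_real (m\<^sup>2) *\<^sub>H X (r n) - W (r n)) = sn (W (r n) - of_real (m\<^sup>2) *\<^sub>H X (r n))"
        by (rule sn_minus_commute) (use XH WH in auto)
      ultimately show ?thesis using m_pos by (simp add: divide_right_mono)
    qed
    then show "\<forall>\<^sub>F n in sequentially. norm (sn (X (r n) - x)) \<le>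
        (1 / m\<^sup>2) * (sn (W (r n) - of_real (m\<^sup>2) *\<^sub>H X (r n)) + sn (Y (r n) - y))"
      using XH xH by (auto intro!: always_eventually)
    have "(\<lambda>n. (1 / m\<^sup>2) * (sn (W (r n) - of_real (m\<^sup>2) *\<^sub>H X (r n)) + sn (Y (r n) - y))) \<longlonglongrightarrow> (1 / m\<^sup>2) * (0 + 0)"
      using LIMSEQ_subseq_LIMSEQ[OF WX_lim r] lim by (intro tendsto_intros) (simp_all add: o_def)
    then show "(\<lambda>n. (1 / m\<^sup>2) * (sn (W (r n) - of_real (m\<^sup>2) *\<^sub>H X (r n)) + sn (Y (r n) - y))) \<longlonglongrightarrow> 0" by simp
  qed
  have sn_x: "sn x = 1"
    using LIMSEQ_unique[OF sn_limit[OF XH xH X_lim]] X(2) by simp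
  have x_orth: "ip x (e n) = 0" for n
  proof -
    have "ip (X (r k)) (e n) = 0" for k using X(1) by (simp add: M_def)
    then show ?thesis using LIMSEQ_unique[OF ip_limit[OF XH xH eH X_lim]] by simp
  qed
  have xM: "x \<in> M" using xH x_orth by (simp add: M_def)
  define v where "v = R x"
  have vH: "v \<in> H" using RH xH by (simp add: v_def)
  have vM: "v \<in> M" using RM xM by (simp add: v_def)
  have vy: "sn (y - v) = 0"
  proof -
    have "(\<lambda>n. sn (Y (r n) - v)) \<longlonglongrightarrow> 0"
    proof (rule Lim_null_comparison[OF _ X_lim])
      have "sn (Y (r n) - v) \<le> sn (X (r n) - x)" for n
        unfolding v_def by (rule sn_resolvent_diff[OF Y R]) (use XH xH in auto)
      then show "\<forall>\<^sub>F n in sequentially. norm (sn (Y (r n) - v)) \<le> sn (X (r n) - x)"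
        using YH vH by (auto intro!: always_eventually)
    qed
    then have "(\<lambda>n. sn (Y (r n) - y) + sn (Y (r n) - v)) \<longlonglongrightarrow> 0"
      using tendsto_add[OF lim] by fastforce
    moreover have "sn (y - v) \<le> sn (Y (r n) - y) + sn (Y (r n) - v)" for n
      using sn_triangle_diff[OF y YH vH, of "r n"] sn_minus_commute[OF y YH, of "r n"] by simp
    ultimately have "sn (y - v) \<le> 0" by (intro LIMSEQ_le_const) auto
    then show ?thesis using sn_nonneg[OF H_diff[OF y vH]] by simp
  qed
  have v_Gr: "(v, x + \<i> *\<^sub>H v) \<in> Gr" using R[OF xH] by (simp add: v_def)
  have w_Gr: "(w, v - \<i> *\<^sub>H w) \<in> Gr"
  proof (rule Gr_null[OF R'[OF y, folded w_def]])
    show "sn (v - \<i> *\<^sub>H w - (y + - \<i> *\<^sub>H w)) = 0"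
      using vy sn_minus_commute[OF y vH] by (simp add: scale_minus_left)
  qed (use vH wH in auto)
  \<comment> \<open>In the basis \<open>v\<close>, \<open>x\<close> the relation is the matrix with rows \<open>(\<i>, s)\<close> and \<open>(1, - \<i>)\<close>, whose
    eigenvalues are the two square roots of \<open>s - 1\<close>.\<close>
  define s where "s = complex_of_real (1 / m\<^sup>2)"
  have x_Gr: "(x, s *\<^sub>H v - \<i> *\<^sub>H x) \<in> Gr"
    using Gr_scale[OF w_Gr, of s] by (simp add: x_def s_def scale_right_diff_distrib mult.commute)
  define k where "k = sqrt (1 / m\<^sup>2 - 1)"
  have "m\<^sup>2 \<le> 1" using m_le m_pos by (simp add: power_le_one)
  then have k2: "k\<^sup>2 = 1 / m\<^sup>2 - 1" using m_pos by (simp add: k_def)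
  have s_k: "s = (of_real k)\<^sup>2 + 1" by (simp add: s_def k2 flip: of_real_power)
  define z where "z = s *\<^sub>H v + (of_real k - \<i>) *\<^sub>H x"
  have zH: "z \<in> H" using vH xH by (simp add: z_def)
  have z_Gr: "(z, of_real k *\<^sub>H z) \<in> Gr"
  proof -
    have "s *\<^sub>H (x + \<i> *\<^sub>H v) + (of_real k - \<i>) *\<^sub>H (s *\<^sub>H v - \<i> *\<^sub>H x)
      = (s + (of_real k - \<i>) * (- \<i>)) *\<^sub>H x + (s * \<i> + (of_real k - \<i>) * s) *\<^sub>H v"
      by (simp only: scale_right_distrib scale_left_distrib scale_right_diff_distrib scale_scale scale_minus_left diff_conv_add_uminus scale_minus_right)
        (simp add: algebra_simps)
    also have "s + (of_real k - \<i>) * (- \<i>) = of_real k * (of_real k - \<i>)"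
      unfolding s_k by (simp add: algebra_simps power2_eq_square)
    also have "s * \<i> + (of_real k - \<i>) * s = of_real k * s" by (simp add: algebra_simps)
    finally show ?thesis
      using Gr_add[OF Gr_scale[OF v_Gr, of s] Gr_scale[OF x_Gr, of "of_real k - \<i>"]]
      by (simp add: z_def scale_right_distrib add.commute)
  qed
  have z_orth: "ip z (e n) = 0" for n
  proof -
    have "z \<in> M" unfolding z_def by (intro M_add M_scale vM xM)
    then show ?thesis by (simp add: M_def)
  qed
  show ?thesis
  proof (cases "sn z = 0")
    case False
    then show ?thesis using z_Gr z_orth by blast
  next
    case True
    \<comment> \<open>If the candidate for the eigenvalue \<open>k\<close> is null, then \<open>s *\<^sub>H v\<close> is \<open>(\<i> - k) *\<^sub>H x\<close> up to a null vector, and \<open>x\<close> itself is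
      an eigenvector, for the eigenvalue \<open>- k\<close>.\<close>
    have "(x, of_real (- k) *\<^sub>H x) \<in> Gr"
    proof (rule Gr_null[OF x_Gr])
      have "of_real (- k) *\<^sub>H x - (s *\<^sub>H v - \<i> *\<^sub>H x) = - z"
        by (simp add: z_def scale_left_diff_distrib)
      then show "sn (of_real (- k) *\<^sub>H x - (s *\<^sub>H v - \<i> *\<^sub>H x)) = 0"
        using True sn_scale[OF zH, of "- 1"] by (simp add: scale_minus_left)
    qed (rule H_scale[OF xH])
    then show ?thesis using sn_x x_orth by (metis zero_neq_one)
  qed
qed

text \<open>The remainders converge to a vector orthogonal to all \<open>e n\<close>. Unless it is null, the complement
  contains a further eigenvector, against maximality.\<close>

theorem Fourier_series_converges:
  assumes e: "\<And>n. (e n, l n *\<^sub>H e n) \<in> Gr"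
    and orth: "\<And>m n. ip (e m) (e n) = (if m = n then 1 else 0)"
    and maximal: "\<And>z k. \<lbrakk>(z, of_real k *\<^sub>H z) \<in> Gr; \<And>n. ip z (e n) = 0\<rbrakk> \<Longrightarrow> sn z = 0"
    and x: "x \<in> H"
  shows "(\<lambda>m. sn (x - (\<Sum>n<m. ip x (e n) *\<^sub>H e n))) \<longlonglongrightarrow> 0"
proof -
  have eH: "e n \<in> H" for n using Gr_H[OF e] by simp
  obtain y where y: "y \<in> H" "(\<lambda>m. sn (x - (\<Sum>n<m. ip x (e n) *\<^sub>H e n) - y)) \<longlonglongrightarrow> 0"
    "\<And>n. ip y (e n) = 0"
    using Fourier_series_limit[OF x eH orth] by blast
  have "sn y = 0"
  proof (rule ccontr)
    assume "sn y \<noteq> 0"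
    from exists_eigenvector_orthogonal[of e l, OF e y(1) this y(3)] maximal show False by blast
  qed
  show ?thesis
  proof (rule Lim_null_comparison[OF _ y(2)])
    have "sn (x - (\<Sum>n<m. ip x (e n) *\<^sub>H e n)) \<le> sn (x - (\<Sum>n<m. ip x (e n) *\<^sub>H e n) - y)" for m
    proof -
      have *: "x - (\<Sum>n<m. ip x (e n) *\<^sub>H e n) \<in> H" using x eH by (intro H_diff H_sum H_scale) auto
      show ?thesis using sn_triangle[OF H_diff[OF * y(1)] y(1)] \<open>sn y = 0\<close> by simp
    qed
    then show "\<forall>\<^sub>F m in sequentially. norm (sn (x - (\<Sum>n<m. ip x (e n) *\<^sub>H e n))) \<le>
        sn (x - (\<Sum>n<m. ip x (e n) *\<^sub>H e n) - y)"
      using sn_nonneg[OF H_diff[OF x H_sum[of _ "\<lambda>n. ip x (e n) *\<^sub>H e n", OF H_scale[OF eH]]]]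
      by (auto intro!: always_eventually)
  qed
qed

end

section \<open>Absolutely continuous functions\<close>

definition nonoverlapping :: "real set \<Rightarrow> (real \<times> real) set \<Rightarrow> bool" where
  "nonoverlapping S J \<longleftrightarrow> finite J \<and> (\<forall>(a, b)\<in>J. a < b \<and> {a..b} \<subseteq> S) \<and>
     disjoint_family_on (\<lambda>(a, b). {a<..<b}) J"

definition total_length :: "(real \<times> real) set \<Rightarrow> real" where
  "total_length J = (\<Sum>(a, b)\<in>J. b - a)"

definition var_sum :: "(real \<Rightarrow> 'a::real_normed_vector) \<Rightarrow> (real \<times> real) set \<Rightarrow> real" where
  "var_sum f J = (\<Sum>(a, b)\<in>J. norm (f b - f a))"

text \<open>Absolute continuity for functions with values in any normed space, as the variation function below
  is real. Members of a family are nondegenerate, so that distinct members have distinct interiors.\<close>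

definition small_variation_on :: "real set \<Rightarrow> (real \<Rightarrow> 'a::real_normed_vector) \<Rightarrow> bool" where
  "small_variation_on S f \<longleftrightarrow>
     (\<forall>\<epsilon>>0. \<exists>\<delta>>0. \<forall>J. nonoverlapping S J \<and> total_length J < \<delta> \<longrightarrow> var_sum f J < \<epsilon>)"

lemma abs_cont_on_small_variation: "abs_cont_on S f \<Longrightarrow> small_variation_on S f"
  unfolding abs_cont_on_def small_variation_on_def nonoverlapping_def total_length_def var_sum_def
  by (simp add: case_prod_unfold) (meson less_imp_le)

lemma nonoverlapping_empty [simp]: "nonoverlapping S {}"
  by (simp add: nonoverlapping_def disjoint_family_on_def)

lemma var_sum_empty [simp]: "var_sum f {} = 0"
  by (simp add: var_sum_def)

lemma nonoverlapping_single: "a < b \<Longrightarrow> {a..b} \<subseteq> S \<Longrightarrow> nonoverlapping S {(a, b)}"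
  by (simp add: nonoverlapping_def disjoint_family_on_def)

lemma nonoverlapping_mono: "nonoverlapping S J \<Longrightarrow> S \<subseteq> T \<Longrightarrow> nonoverlapping T J"
  unfolding nonoverlapping_def by fast

lemma total_length_measure:
  assumes "nonoverlapping S J"
  shows "total_length J = measure lborel (\<Union>(a, b)\<in>J. {a<..<b})"
proof -
  have "measure lborel (\<Union>(a, b)\<in>J. {a<..<b}) = (\<Sum>p\<in>J. measure lborel (case p of (a, b) \<Rightarrow> {a<..<b}))"
    by (rule measure_finite_Union) (use assms in \<open>auto simp: nonoverlapping_def\<close>)
  also have "\<dots> = total_length J"
    unfolding total_length_def using assms
    by (intro sum.cong refl) (auto simp: nonoverlapping_def)
  finally show ?thesis by simp
qed

lemma total_length_le:
  assumes "nonoverlapping {c..d} J" "c \<le> d"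
  shows "total_length J \<le> d - c"
proof -
  have "total_length J \<le> measure lborel {c..d}"
    unfolding total_length_measure[OF assms(1)]
  proof (rule measure_mono_fmeasurable)
    show "(\<Union>(x, y)\<in>J. {x<..<y}) \<subseteq> {c..d}"
      using assms(1) unfolding nonoverlapping_def by fastforce
    have "open (\<Union>(x, y)\<in>J. {x<..<y})" by (intro open_UN) auto
    then show "(\<Union>(x, y)\<in>J. {x<..<y}) \<in> sets lborel" by simp
    show "{c..d} \<in> fmeasurable lborel" using assms(2) by (simp add: fmeasurable_def)
  qed
  then show ?thesis using assms by simp
qed

text \<open>A family that subdivides the members of a short family is short again, so one \<open>\<delta>\<close> of the definition
  of absolute continuity serves all subdivisions.\<close>

lemma nonoverlapping_refine:
  assumes K: "nonoverlapping S K" and J: "\<And>k. k \<in> K \<Longrightarrow> nonoverlapping {fst k..snd k} (J k)"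
  shows "nonoverlapping S (\<Union>k\<in>K. J k)"
    and "total_length (\<Union>k\<in>K. J k) = (\<Sum>k\<in>K. total_length (J k))"
    and "var_sum f (\<Union>k\<in>K. J k) = (\<Sum>k\<in>K. var_sum f (J k))"
proof -
  have sub: "{a<..<b} \<subseteq> {fst k<..<snd k}" "a < b" "{a..b} \<subseteq> {fst k..snd k}" if "k \<in> K" "(a, b) \<in> J k" for a b k
    using J[OF that(1)] that(2) unfolding nonoverlapping_def by force+
  have disj: "{fst k<..<snd k} \<inter> {fst k'<..<snd k'} = {}" if "k \<in> K" "k' \<in> K" "k \<noteq> k'" for k k'
    using K that unfolding nonoverlapping_def disjoint_family_on_def by (auto simp: case_prod_unfold)
  have JJ: "J k \<inter> J k' = {}" if k: "k \<in> K" "k' \<in> K" "k \<noteq> k'" for k k'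
  proof (rule ccontr)
    assume "J k \<inter> J k' \<noteq> {}"
    then obtain a b where ab: "(a, b) \<in> J k" "(a, b) \<in> J k'" by auto
    have "(a + b) / 2 \<in> {a<..<b}" using sub(2)[OF k(1) ab(1)] by simp
    then show False using sub(1)[OF k(1) ab(1)] sub(1)[OF k(2) ab(2)] disj[OF k] by blast
  qed
  have fin: "finite K" "\<And>k. k \<in> K \<Longrightarrow> finite (J k)"
    using K J by (auto simp: nonoverlapping_def)
  show "nonoverlapping S (\<Union>k\<in>K. J k)"
    unfolding nonoverlapping_def
  proof (intro conjI)
    show "finite (\<Union>k\<in>K. J k)" using fin by auto
    have KS: "{fst k..snd k} \<subseteq> S" if "k \<in> K" for k using K that by (auto simp: nonoverlapping_def case_prod_unfold)
    show "\<forall>(a, b)\<in>\<Union>k\<in>K. J k. a < b \<and> {a..b} \<subseteq> S"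
      using sub(2,3) KS by blast
    show "disjoint_family_on (\<lambda>(a, b). {a<..<b}) (\<Union>k\<in>K. J k)"
      unfolding disjoint_family_on_def
    proof (intro ballI impI)
      fix p q assume "p \<in> (\<Union>k\<in>K. J k)" "q \<in> (\<Union>k\<in>K. J k)" and pq: "p \<noteq> q"
      then obtain k k' where k: "k \<in> K" "p \<in> J k" "k' \<in> K" "q \<in> J k'" by auto
      show "(case p of (a, b) \<Rightarrow> {a<..<b}) \<inter> (case q of (a, b) \<Rightarrow> {a<..<b}) = {}"
      proof (cases "k = k'")
        case True
        then show ?thesis using J[OF k(1)] k pq unfolding nonoverlapping_def disjoint_family_on_def by blast
      next
        case False
        then show ?thesis using sub(1)[of k "fst p" "snd p"] sub(1)[of k' "fst q" "snd q"] disj[OF k(1,3) False] k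
          unfolding case_prod_unfold prod.collapse by blast
      qed
    qed
  qed
  show "total_length (\<Union>k\<in>K. J k) = (\<Sum>k\<in>K. total_length (J k))"
    "var_sum f (\<Union>k\<in>K. J k) = (\<Sum>k\<in>K. var_sum f (J k))"
    unfolding total_length_def var_sum_def
    by (rule sum.UNION_disjoint; use fin JJ in blast)+
qed

lemma nonoverlapping_append:
  assumes J: "nonoverlapping {c..d} J" and de: "c \<le> d" "d < e"
  shows "nonoverlapping {c..e} (insert (d, e) J)"
    and "var_sum f (insert (d, e) J) = var_sum f J + norm (f e - f d)"
proof -
  have sub: "a < b" "c \<le> a" "b \<le> d" if "(a, b) \<in> J" for a b
    using J that unfolding nonoverlapping_def by force+
  have nin: "(d, e) \<notin> J" using sub(3)[of d e] de by auto
  show "nonoverlapping {c..e} (insert (d, e) J)"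
    unfolding nonoverlapping_def
  proof (intro conjI)
    show "finite (insert (d, e) J)" using J by (simp add: nonoverlapping_def)
    show "\<forall>(a, b)\<in>insert (d, e) J. a < b \<and> {a..b} \<subseteq> {c..e}"
    proof clarify
      fix a b assume "(a, b) \<in> insert (d, e) J"
      then show "a < b \<and> {a..b} \<subseteq> {c..e}" using sub[of a b] de by auto
    qed
    have "(case p of (a, b) \<Rightarrow> {a<..<b}) \<inter> {d<..<e} = {}" if "p \<in> J" for p
      using sub(3)[of "fst p" "snd p"] that by (auto simp: case_prod_unfold)
    then show "disjoint_family_on (\<lambda>(a, b). {a<..<b}) (insert (d, e) J)"
      using J unfolding nonoverlapping_def disjoint_family_on_insert[OF nin] by auto
  qed
  show "var_sum f (insert (d, e) J) = var_sum f J + norm (f e - f d)"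
    using J nin unfolding var_sum_def nonoverlapping_def by simp
qed

text \<open>Cutting at \<open>d\<close>: an interval \<open>(a, b)\<close> leaves \<open>(min a d, min b d)\<close> on the left and
  \<open>(max a d, max b d)\<close> on the right, one of which is degenerate and dropped unless \<open>a < d < b\<close>.\<close>

lemma nonoverlapping_cut:
  fixes f :: "real \<Rightarrow> 'a::real_normed_vector"
  assumes J: "nonoverlapping {c..e} J" and d: "c \<le> d" "d \<le> e"
  obtains L R where "nonoverlapping {c..d} L" "nonoverlapping {d..e} R"
    "var_sum f J \<le> var_sum f L + var_sum f R"
proof -
  have image: "nonoverlapping T {p \<in> h ` J. fst p < snd p} \<and>
      var_sum f {p \<in> h ` J. fst p < snd p} = (\<Sum>(a, b)\<in>J. norm (f (snd (h (a, b))) - f (fst (h (a, b)))))"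
    if h: "\<And>a b. (a, b) \<in> J \<Longrightarrow> fst (h (a, b)) \<le> snd (h (a, b)) \<and>
        {fst (h (a, b))<..<snd (h (a, b))} \<subseteq> {a<..<b} \<and> {fst (h (a, b))..snd (h (a, b))} \<subseteq> T"
    for h :: "real \<times> real \<Rightarrow> real \<times> real" and T
  proof -
    have fin: "finite J" using J by (simp add: nonoverlapping_def)
    have hp: "fst (h p) \<le> snd (h p)" "{fst (h p)<..<snd (h p)} \<subseteq> {fst p<..<snd p}"
      "{fst (h p)..snd (h p)} \<subseteq> T" if "p \<in> J" for p
      using h[of "fst p" "snd p"] that by simp_all
    have disj: "p = q" if "p \<in> J" "q \<in> J" "{fst (h p)<..<snd (h p)} \<inter> {fst (h q)<..<snd (h q)} \<noteq> {}" for p q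
    proof (rule ccontr)
      assume "p \<noteq> q"
      then have "{fst p<..<snd p} \<inter> {fst q<..<snd q} = {}"
        using J that(1,2) unfolding nonoverlapping_def disjoint_family_on_def case_prod_unfold by blast
      then show False using hp(2)[OF that(1)] hp(2)[OF that(2)] that(3) by blast
    qed
    have "nonoverlapping T {p \<in> h ` J. fst p < snd p}"
      unfolding nonoverlapping_def
    proof (intro conjI)
      show "\<forall>(a, b)\<in>{p \<in> h ` J. fst p < snd p}. a < b \<and> {a..b} \<subseteq> T"
        unfolding case_prod_unfold using hp(3) by blast
      show "disjoint_family_on (\<lambda>(a, b). {a<..<b}) {p \<in> h ` J. fst p < snd p}"
        unfolding disjoint_family_on_def case_prod_unfold
      proof (intro ballI impI)
        fix u w assume "u \<in> {p \<in> h ` J. fst p < snd p}" "w \<in> {p \<in> h ` J. fst p < snd p}" "u \<noteq> w"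
        then obtain p q where "p \<in> J" "q \<in> J" "u = h p" "w = h q" by auto
        then show "{fst u<..<snd u} \<inter> {fst w<..<snd w} = {}"
          using disj[of p q] \<open>u \<noteq> w\<close> by metis
      qed
      show "finite {p \<in> h ` J. fst p < snd p}" using fin by simp
    qed
    moreover have "var_sum f {p \<in> h ` J. fst p < snd p} = var_sum f (h ` J)"
      unfolding var_sum_def
    proof (rule sum.mono_neutral_left)
      show "\<forall>i\<in>h ` J - {p \<in> h ` J. fst p < snd p}. (case i of (a, b) \<Rightarrow> norm (f b - f a)) = 0"
      proof
        fix u assume u: "u \<in> h ` J - {p \<in> h ` J. fst p < snd p}"
        then obtain p where p: "p \<in> J" "u = h p" by auto
        have "\<not> fst u < snd u" using u by simp
        then have "fst u = snd u" using hp(1)[OF p(1)] p(2) by simp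
        then show "(case u of (a, b) \<Rightarrow> norm (f b - f a)) = 0" by (simp add: case_prod_unfold)
      qed
    qed (use fin in auto)
    moreover have "var_sum f (h ` J) = (\<Sum>p\<in>J. (case h p of (a, b) \<Rightarrow> norm (f b - f a)))"
      unfolding var_sum_def
    proof (subst sum.reindex_nontrivial[OF fin])
      fix p q assume pq: "p \<in> J" "q \<in> J" "p \<noteq> q" "h p = h q"
      then have "{fst (h p)<..<snd (h p)} = {}" using disj[of p q] by auto
      then have "fst (h p) = snd (h p)" using h[of "fst p" "snd p"] pq by (simp add: order_antisym)
      then show "(case h p of (a, b) \<Rightarrow> norm (f b - f a)) = 0" by (simp add: case_prod_unfold)
    qed (simp add: o_def)
    ultimately show ?thesis unfolding case_prod_unfold by (simp add: case_prod_unfold)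
  qed
  define l where "l = (\<lambda>(a, b). (min a d, min b d))"
  define r where "r = (\<lambda>(a, b). (max a d, max b d))"
  have ab: "a < b" "c \<le> a" "b \<le> e" if "(a, b) \<in> J" for a b
    using J that unfolding nonoverlapping_def by force+
  have L: "nonoverlapping {c..d} {p \<in> l ` J. fst p < snd p} \<and>
      var_sum f {p \<in> l ` J. fst p < snd p} = (\<Sum>(a, b)\<in>J. norm (f (snd (l (a, b))) - f (fst (l (a, b)))))"
  proof (rule image)
    fix a b assume "(a, b) \<in> J"
    from ab[OF this] d show "fst (l (a, b)) \<le> snd (l (a, b)) \<and>
        {fst (l (a, b))<..<snd (l (a, b))} \<subseteq> {a<..<b} \<and> {fst (l (a, b))..snd (l (a, b))} \<subseteq> {c..d}"
      by (auto simp: l_def min_def split: if_splits)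
  qed
  have R: "nonoverlapping {d..e} {p \<in> r ` J. fst p < snd p} \<and>
      var_sum f {p \<in> r ` J. fst p < snd p} = (\<Sum>(a, b)\<in>J. norm (f (snd (r (a, b))) - f (fst (r (a, b)))))"
  proof (rule image)
    fix a b assume "(a, b) \<in> J"
    from ab[OF this] d show "fst (r (a, b)) \<le> snd (r (a, b)) \<and>
        {fst (r (a, b))<..<snd (r (a, b))} \<subseteq> {a<..<b} \<and> {fst (r (a, b))..snd (r (a, b))} \<subseteq> {d..e}"
      by (auto simp: r_def max_def split: if_splits)
  qed
  have "var_sum f J \<le> (\<Sum>(a, b)\<in>J. norm (f (snd (l (a, b))) - f (fst (l (a, b))))
      + norm (f (snd (r (a, b))) - f (fst (r (a, b)))))"
    unfolding var_sum_def
  proof (rule sum_mono, clarify)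
    fix a b assume "(a, b) \<in> J"
    then have "a < b" using ab by blast
    then consider "b \<le> d" | "d \<le> a" | "a < d" "d < b" by linarith
    then show "norm (f b - f a) \<le> norm (f (snd (l (a, b))) - f (fst (l (a, b))))
      + norm (f (snd (r (a, b))) - f (fst (r (a, b))))"
    proof cases
      case 3
      then show ?thesis
        using norm_triangle_ineq[of "f d - f a" "f b - f d"] by (simp add: l_def r_def max_def min_def)
    qed (use \<open>a < b\<close> in \<open>auto simp: l_def r_def max_def min_def\<close>)
  qed
  then have "var_sum f J \<le> var_sum f {p \<in> l ` J. fst p < snd p} + var_sum f {p \<in> r ` J. fst p < snd p}"
    using L R by (simp add: sum.distrib case_prod_unfold)
  then show thesis by (rule that[OF conjunct1[OF L] conjunct1[OF R]])
qed

text \<open>The variation over an interval shorter than \<open>\<delta>\<close> is less than \<open>1\<close>, and \<open>{A..B}\<close> is cut into finitely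
  many of these.\<close>

lemma small_variation_bounded:
  fixes f :: "real \<Rightarrow> 'a::real_normed_vector"
  assumes f: "small_variation_on {A..B} f" and AB: "A \<le> B"
  obtains C where "\<And>J. nonoverlapping {A..B} J \<Longrightarrow> var_sum f J \<le> C"
proof -
  obtain \<delta> where \<delta>: "\<delta> > 0" "\<And>J. nonoverlapping {A..B} J \<Longrightarrow> total_length J < \<delta> \<Longrightarrow> var_sum f J < 1"
    using f[unfolded small_variation_on_def, rule_format, of 1] by auto
  have "var_sum f J \<le> real n" if "nonoverlapping {A..d} J" "A \<le> d" "d \<le> B" "d - A \<le> real n * (\<delta> / 2)" for n d J
    using that
  proof (induction n arbitrary: d J)
    case 0
    have "J = {}"
    proof (rule ccontr)
      assume "J \<noteq> {}"
      then obtain a b where "(a, b) \<in> J" by auto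
      then have "a < b" "{a..b} \<subseteq> {A..d}" using 0(1) unfolding nonoverlapping_def by auto
      then show False using 0(4) by auto
    qed
    then show ?case by simp
  next
    case (Suc n)
    define c where "c = max A (d - \<delta> / 2)"
    have c: "A \<le> c" "c \<le> d" "d - c < \<delta>" using Suc.prems \<delta> by (auto simp: c_def)
    obtain L R where LR: "nonoverlapping {A..c} L" "nonoverlapping {c..d} R" "var_sum f J \<le> var_sum f L + var_sum f R"
      using nonoverlapping_cut[OF Suc.prems(1) c(1,2)] by blast
    have "var_sum f L \<le> real n"
    proof (rule Suc.IH[OF LR(1)])
      have "d - A \<le> real n * (\<delta> / 2) + \<delta> / 2" using Suc.prems(4) by (simp add: algebra_simps)
      moreover have "0 \<le> real n * (\<delta> / 2)" using \<delta>(1) by simp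
      ultimately show "c - A \<le> real n * (\<delta> / 2)" unfolding c_def by linarith
    qed (use c Suc.prems in auto)
    moreover have "var_sum f R < 1"
      by (rule \<delta>(2)) (use nonoverlapping_mono[OF LR(2)] total_length_le[OF LR(2)] c Suc.prems in auto)
    ultimately show ?case using LR(3) by simp
  qed
  moreover obtain n :: nat where "(B - A) / (\<delta> / 2) \<le> real n" using real_arch_simple by blast
  ultimately show thesis using that[of "real n"] AB \<delta>(1) by (simp add: field_simps)
qed

text \<open>The function \<open>v x\<close> is the total variation over \<open>{A..x}\<close>. Its increment over a member of a family is
  approximated by the variation over a subdivision of that member.\<close>

lemma variation_function_exists:
  fixes f :: "real \<Rightarrow> 'a::real_normed_vector"
  assumes f: "small_variation_on {A..B} f" and AB: "A \<le> B"
  obtains v :: "real \<Rightarrow> real" where "small_variation_on {A..B} v"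
    "\<And>x y. \<lbrakk>A \<le> x; x \<le> y; y \<le> B\<rbrakk> \<Longrightarrow> norm (f y - f x) \<le> v y - v x"
proof -
  obtain C where C: "\<And>J. nonoverlapping {A..B} J \<Longrightarrow> var_sum f J \<le> C"
    using small_variation_bounded[OF f AB] by blast
  define V where "V c d = (SUP J\<in>{J. nonoverlapping {c..d} J}. var_sum f J)" for c d
  have bdd: "bdd_above (var_sum f ` {J. nonoverlapping {c..d} J})" if "A \<le> c" "d \<le> B" for c d
    by (rule bdd_aboveI[of _ C]) (use that C nonoverlapping_mono[of "{c..d}" _ "{A..B}"] in auto)
  have ne: "{J. nonoverlapping {c..d} J} \<noteq> {}" for c d
    using nonoverlapping_empty by blast
  have V_upper: "var_sum f J \<le> V c d" if "A \<le> c" "d \<le> B" "nonoverlapping {c..d} J" for J c d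
    unfolding V_def by (rule cSUP_upper[OF _ bdd]) (use that in auto)
  have V_add: "V A y \<le> V A x + V x y" if xy: "A \<le> x" "x \<le> y" "y \<le> B" for x y
    unfolding V_def[of A y]
  proof (rule cSUP_least[OF ne], clarify)
    fix J assume "nonoverlapping {A..y} J"
    then obtain L R where "nonoverlapping {A..x} L" "nonoverlapping {x..y} R" "var_sum f J \<le> var_sum f L + var_sum f R"
      using nonoverlapping_cut[OF _ xy(1,2)] by blast
    then show "var_sum f J \<le> V A x + V x y"
      using V_upper[of A x L] V_upper[of x y R] xy by simp
  qed
  have V_mono: "norm (f y - f x) \<le> V A y - V A x" if xy: "A \<le> x" "x \<le> y" "y \<le> B" for x y
  proof (cases "x = y")
    case False
    then have "x < y" using xy by simp
    have "V A x \<le> V A y - norm (f y - f x)"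
      unfolding V_def[of A x]
    proof (rule cSUP_least[OF ne], clarify)
      fix J assume "nonoverlapping {A..x} J"
      note J = nonoverlapping_append[OF this xy(1) \<open>x < y\<close>]
      show "var_sum f J \<le> V A y - norm (f y - f x)"
        using V_upper[OF order_refl xy(3) J(1)] J(2)[of f] by simp
    qed
    then show ?thesis by simp
  qed auto
  have "small_variation_on {A..B} (V A)"
    unfolding small_variation_on_def
  proof (intro allI impI)
    fix \<epsilon> :: real assume \<epsilon>: "\<epsilon> > 0"
    then obtain \<delta> where \<delta>: "\<delta> > 0" "\<And>J. nonoverlapping {A..B} J \<Longrightarrow> total_length J < \<delta> \<Longrightarrow> var_sum f J < \<epsilon> / 2"
      using f unfolding small_variation_on_def by (metis half_gt_zero)
    have "var_sum (V A) K < \<epsilon>" if K: "nonoverlapping {A..B} K" "total_length K < \<delta>" for K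
    proof -
      \<comment> \<open>The defect \<open>\<eta>\<close> in each of the \<open>card K\<close> suprema adds up to at most \<open>\<epsilon> / 2\<close>.\<close>
      define \<eta> where "\<eta> = \<epsilon> / (2 * (real (card K) + 1))"
      have \<eta>: "\<eta> > 0" using \<epsilon> by (simp add: \<eta>_def)
      have K': "A \<le> fst k" "fst k < snd k" "snd k \<le> B" if "k \<in> K" for k
        using K that by (force simp: nonoverlapping_def)+
      have "\<exists>J. nonoverlapping {fst k..snd k} J \<and> V (fst k) (snd k) - \<eta> < var_sum f J" if "k \<in> K" for k
      proof -
        have "V (fst k) (snd k) - \<eta> < V (fst k) (snd k)" using \<eta> by simp
        then show ?thesis
          unfolding V_def by (subst (asm) less_cSUP_iff[OF ne bdd]) (use K'[OF that] in auto)
      qed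
      then obtain J where J: "\<And>k. k \<in> K \<Longrightarrow> nonoverlapping {fst k..snd k} (J k)"
        "\<And>k. k \<in> K \<Longrightarrow> V (fst k) (snd k) - \<eta> < var_sum f (J k)"
        by metis
      have fin: "finite K" using K by (simp add: nonoverlapping_def)
      have refine: "nonoverlapping {A..B} (\<Union>k\<in>K. J k)"
        "total_length (\<Union>k\<in>K. J k) = (\<Sum>k\<in>K. total_length (J k))"
        "var_sum f (\<Union>k\<in>K. J k) = (\<Sum>k\<in>K. var_sum f (J k))"
        by (rule nonoverlapping_refine[OF K(1) J(1)]; assumption)+
      have "total_length (\<Union>k\<in>K. J k) \<le> total_length K"
        unfolding refine(2) unfolding total_length_def[of K]
        by (rule sum_mono) (use total_length_le[OF J(1)] K' in \<open>auto simp: case_prod_unfold less_imp_le\<close>)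
      then have less: "(\<Sum>k\<in>K. var_sum f (J k)) < \<epsilon> / 2"
        using \<delta>(2)[OF refine(1)] K(2) refine(3) by simp
      have "var_sum (V A) K \<le> (\<Sum>k\<in>K. var_sum f (J k) + \<eta>)"
        unfolding var_sum_def[of "V A"]
      proof (rule sum_mono, clarify)
        fix a b assume k: "(a, b) \<in> K"
        have "norm (V A b - V A a) = V A b - V A a"
          using order_trans[OF norm_ge_zero V_mono[of a b]] K'[OF k] by simp
        also have "\<dots> \<le> V a b" using V_add[of a b] K'[OF k] by simp
        also have "\<dots> \<le> var_sum f (J (a, b)) + \<eta>" using J(2)[OF k] by simp
        finally show "norm (V A b - V A a) \<le> var_sum f (J (a, b)) + \<eta>" .
      qed
      also have "\<dots> = (\<Sum>k\<in>K. var_sum f (J k)) + real (card K) * \<eta>" by (simp add: sum.distrib)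
      also have "real (card K) * \<eta> \<le> \<epsilon> / 2" using \<epsilon> by (simp add: \<eta>_def field_simps)
      finally show ?thesis using less by simp
    qed
    then show "\<exists>\<delta>>0. \<forall>J. nonoverlapping {A..B} J \<and> total_length J < \<delta> \<longrightarrow> var_sum (V A) J < \<epsilon>"
      using \<delta>(1) by blast
  qed
  then show thesis using that V_mono by blast
qed

lemma small_variation_onE:
  assumes "small_variation_on S f" "\<epsilon> > 0"
  obtains \<delta> where "\<delta> > 0" "\<And>J. nonoverlapping S J \<Longrightarrow> total_length J < \<delta> \<Longrightarrow> var_sum f J < \<epsilon>"
  using assms unfolding small_variation_on_def by auto

text \<open>Applies to sums with \<open>L = 1\<close>, and to products of functions bounded by \<open>L\<close>.\<close>

lemma small_variation_combine:
  assumes f: "small_variation_on S f" and g: "small_variation_on S g" and L: "L > 0"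
    and h: "\<And>x y. \<lbrakk>x \<in> S; y \<in> S\<rbrakk> \<Longrightarrow> norm (h y - h x) \<le> L * (norm (f y - f x) + norm (g y - g x))"
  shows "small_variation_on S h"
  unfolding small_variation_on_def
proof (intro allI impI)
  fix \<epsilon> :: real assume "\<epsilon> > 0"
  then have e: "\<epsilon> / (2 * L) > 0" using L by simp
  obtain \<delta>1 where \<delta>1: "\<delta>1 > 0" "\<And>J. nonoverlapping S J \<Longrightarrow> total_length J < \<delta>1 \<Longrightarrow> var_sum f J < \<epsilon> / (2 * L)"
    using small_variation_onE[OF f e] by metis
  obtain \<delta>2 where \<delta>2: "\<delta>2 > 0" "\<And>J. nonoverlapping S J \<Longrightarrow> total_length J < \<delta>2 \<Longrightarrow> var_sum g J < \<epsilon> / (2 * L)"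
    using small_variation_onE[OF g e] by metis
  have "var_sum h J < \<epsilon>" if J: "nonoverlapping S J" "total_length J < min \<delta>1 \<delta>2" for J
  proof -
    have "var_sum h J \<le> L * (var_sum f J + var_sum g J)"
      unfolding var_sum_def sum.distrib[symmetric] sum_distrib_left case_prod_unfold
    proof (rule sum_mono)
      fix p assume "p \<in> J"
      then have "fst p < snd p" "{fst p..snd p} \<subseteq> S" using J(1) by (simp_all add: nonoverlapping_def case_prod_unfold)
      then have "fst p \<in> S" "snd p \<in> S" by auto
      then show "norm (h (snd p) - h (fst p)) \<le> L * (norm (f (snd p) - f (fst p)) + norm (g (snd p) - g (fst p)))"
        by (rule h)
    qed
    also have "\<dots> < L * (\<epsilon> / (2 * L) + \<epsilon> / (2 * L))"
      using \<delta>1(2)[OF J(1)] \<delta>2(2)[OF J(1)] J(2) L by (intro mult_strict_left_mono add_strict_mono) auto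
    finally show ?thesis using L by (simp add: field_simps)
  qed
  moreover have "min \<delta>1 \<delta>2 > 0" using \<delta>1(1) \<delta>2(1) by simp
  ultimately show "\<exists>\<delta>>0. \<forall>J. nonoverlapping S J \<and> total_length J < \<delta> \<longrightarrow> var_sum h J < \<epsilon>"
    by blast
qed

lemma small_variation_continuous:
  assumes f: "small_variation_on S f" and S: "is_interval S"
  shows "uniformly_continuous_on S f"
  unfolding uniformly_continuous_on_def
proof (intro allI impI)
  fix \<epsilon> :: real assume "\<epsilon> > 0"
  then obtain \<delta> where \<delta>: "\<delta> > 0" "\<And>J. nonoverlapping S J \<Longrightarrow> total_length J < \<delta> \<Longrightarrow> var_sum f J < \<epsilon>"
    using small_variation_onE[OF f] by metis
  have *: "dist (f y) (f x) < \<epsilon>" if "x \<in> S" "y \<in> S" "x < y" "y - x < \<delta>" for x y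
  proof -
    have "{x..y} \<subseteq> S" using mem_is_interval_1_I[OF S that(1,2)] by auto
    then show ?thesis
      using \<delta>(2)[OF nonoverlapping_single[of x y S]] that by (simp add: total_length_def var_sum_def dist_norm)
  qed
  show "\<exists>d>0. \<forall>x\<in>S. \<forall>x'\<in>S. dist x' x < d \<longrightarrow> dist (f x') (f x) < \<epsilon>"
  proof (intro exI conjI ballI impI)
    fix x y assume xy: "x \<in> S" "y \<in> S" "dist y x < \<delta>"
    consider "x < y" | "x = y" | "y < x" by linarith
    then show "dist (f y) (f x) < \<epsilon>"
    proof cases
      case 1
      then show ?thesis using *[OF xy(1,2)] xy(3) by (simp add: dist_real_def)
    next
      case 2
      then show ?thesis using \<open>\<epsilon> > 0\<close> by simp
    next
      case 3
      then show ?thesis using *[OF xy(2,1)] xy(3) dist_commute[of "f x" "f y"] by (simp add: dist_real_def)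
    qed
  qed (rule \<delta>(1))
qed

lemma countable_union_emeasure_le:
  assumes D: "countable D" "\<And>K. K \<in> D \<Longrightarrow> K \<in> sets M"
    and fin: "\<And>E. finite E \<Longrightarrow> E \<subseteq> D \<Longrightarrow> (\<Sum>K\<in>E. emeasure M K) \<le> c"
  shows "emeasure M (\<Union>D) \<le> c"
proof (cases "D = {}")
  case False
  define E where "E n = from_nat_into D ` {..n}" for n :: nat
  have E: "finite (E n)" "E n \<subseteq> D" for n
    using from_nat_into[OF False] by (auto simp: E_def)
  have U: "\<Union>D = (\<Union>n. \<Union>(E n))"
  proof
    show "\<Union>D \<subseteq> (\<Union>n. \<Union>(E n))"
    proof
      fix x assume "x \<in> \<Union>D"
      then obtain K where K: "K \<in> D" "x \<in> K" by auto
      then obtain n where "from_nat_into D n = K" using from_nat_into_surj[OF D(1)] by blast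
      then show "x \<in> (\<Union>n. \<Union>(E n))" using K by (auto simp: E_def intro!: exI[of _ n])
    qed
  qed (use E in blast)
  have meas: "\<Union>(E n) \<in> sets M" for n
    using E D(2) by (intro sets.finite_Union) auto
  have inc: "incseq (\<lambda>n. \<Union>(E n))"
    unfolding incseq_def
  proof (intro allI impI Union_mono)
    fix m n :: nat assume "m \<le> n" then show "E m \<subseteq> E n" by (auto simp: E_def)
  qed
  have "emeasure M (\<Union>n. \<Union>(E n)) = (SUP n. emeasure M (\<Union>(E n)))"
    by (rule SUP_emeasure_incseq[symmetric]) (use meas inc in auto)
  also have "\<dots> \<le> c"
  proof (rule SUP_least)
    fix n
    have "emeasure M (\<Union>(E n)) \<le> (\<Sum>K\<in>E n. emeasure M K)"
      using emeasure_subadditive_finite[of "E n" "\<lambda>K. K" M] E D(2) by auto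
    also have "\<dots> \<le> c" by (rule fin) (use E in auto)
    finally show "emeasure M (\<Union>(E n)) \<le> c" .
  qed
  finally show ?thesis using U by simp
qed simp

text \<open>A Lebesgue null set is covered by dyadic intervals of small total length, over which \<open>F\<close> increases by
  little. So the Lebesgue-Stieltjes measure of \<open>F\<close> is absolutely continuous with respect to Lebesgue
  measure, and the Radon-Nikodym theorem provides the density. That \<open>F\<close> is monotone on the whole line
  and constant outside \<open>{A..B}\<close> makes the Lebesgue-Stieltjes measure available.\<close>

lemma monotone_density:
  fixes F :: "real \<Rightarrow> real"
  assumes AB: "A < B" and mono: "\<And>x y. x \<le> y \<Longrightarrow> F x \<le> F y"
    and left: "\<And>x. x \<le> A \<Longrightarrow> F x = F A" and right: "\<And>x. B \<le> x \<Longrightarrow> F x = F B"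
    and cont: "continuous_on UNIV F" and var: "small_variation_on {A..B} F"
  obtains g where "g absolutely_integrable_on {A..B}"
    "\<And>x. x \<in> {A..B} \<Longrightarrow> F x - F A = integral {A..x} g"
proof -
  define \<nu> where "\<nu> = interval_measure F"
  have Icc: "emeasure \<nu> {a..b} = ennreal (F b - F a)" if "a \<le> b" for a b
    unfolding \<nu>_def using emeasure_interval_measure_Icc[OF that mono cont] by simp
  have sets: "sets \<nu> = sets borel" by (simp add: \<nu>_def)
  have outside: "{..A} \<union> {B..} \<in> null_sets \<nu>"
  proof -
    have "{A - real n..A} \<in> null_sets \<nu>" "{B..B + real n} \<in> null_sets \<nu>" for n
      using Icc[of "A - real n" A] Icc[of B "B + real n"] left[of "A - real n"] right[of "B + real n"]
      by (auto simp: null_sets_def sets)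
    then have "(\<Union>n. {A - real n..A}) \<union> (\<Union>n. {B..B + real n}) \<in> null_sets \<nu>"
      by (intro null_sets.Un null_sets_UN) auto
    moreover have "(\<Union>n. {A - real n..A}) = {..A}"
    proof (intro equalityI subsetI)
      fix x assume "x \<in> {..A}"
      moreover obtain n where "A - x \<le> real n" using real_arch_simple by blast
      ultimately show "x \<in> (\<Union>n. {A - real n..A})" by (auto intro!: exI[of _ n])
    qed auto
    moreover have "(\<Union>n. {B..B + real n}) = {B..}"
    proof (intro equalityI subsetI)
      fix x assume "x \<in> {B..}"
      moreover obtain n where "x - B \<le> real n" using real_arch_simple by blast
      ultimately show "x \<in> (\<Union>n. {B..B + real n})" by (auto intro!: exI[of _ n])
    qed auto
    ultimately show ?thesis by simp
  qed
  have ac: "absolutely_continuous lborel \<nu>"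
    unfolding absolutely_continuous_def
  proof
    fix N assume N: "N \<in> null_sets (lborel :: real measure)"
    define S where "S = N \<inter> {A..B}"
    have S: "S \<in> null_sets lborel" unfolding S_def using N by (intro null_set_Int2) auto
    have S': "S \<in> sets \<nu>" using S by (auto simp: sets)
    have small: "emeasure \<nu> S \<le> 0 + ennreal e" if e: "e > 0" for e
    proof -
      obtain \<delta> where \<delta>: "\<delta> > 0" "\<And>J. nonoverlapping {A..B} J \<Longrightarrow> total_length J < \<delta> \<Longrightarrow> var_sum F J < e"
        using small_variation_onE[OF var e] by metis
      have S0: "S \<in> lmeasurable" "measure lebesgue S = 0"
        using S by (auto simp: null_sets_def fmeasurable_def measure_def)
      have S_sub: "S \<subseteq> cbox A B" by (auto simp: S_def)
      have half: "\<delta> / 2 > 0" using \<delta>(1) by simp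
      obtain D where D: "countable D" "\<And>K. K \<in> D \<Longrightarrow> K \<subseteq> cbox A B \<and> K \<noteq> {} \<and> (\<exists>c d. K = cbox c d)"
        "pairwise (\<lambda>A B. interior A \<inter> interior B = {}) D"
        "\<And>u v. cbox u v \<in> D \<Longrightarrow> \<exists>n. \<forall>i \<in> Basis. v \<bullet> i - u \<bullet> i = (B \<bullet> i - A \<bullet> i)/2^n"
        "\<And>K. \<lbrakk>K \<in> D; box A B \<noteq> {}\<rbrakk> \<Longrightarrow> interior K \<noteq> {}"
        "S \<subseteq> \<Union>D" "\<Union>D \<in> lmeasurable" "measure lebesgue (\<Union>D) \<le> measure lebesgue S + \<delta> / 2"
        by (rule measurable_outer_intervals_bounded[OF S0(1) S_sub half]) (rule that)
      have D_sets: "K \<in> sets \<nu>" if "K \<in> D" for K using D(2)[OF that] by (auto simp: sets)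
      have "emeasure \<nu> S \<le> emeasure \<nu> (\<Union>D)"
      proof (rule emeasure_mono[OF D(6)])
        show "\<Union>D \<in> sets \<nu>" using D_sets by (intro sets.countable_Union[OF D(1)] subsetI)
      qed
      also have "\<dots> \<le> ennreal e"
      proof (rule countable_union_emeasure_le[OF D(1)])
        show "K \<in> sets \<nu>" if "K \<in> D" for K by (rule D_sets[OF that])
        fix E assume E: "finite E" "E \<subseteq> D"
        have K: "\<exists>c d. c < d \<and> A \<le> c \<and> d \<le> B \<and> K = {c..d}" if "K \<in> E" for K
        proof -
          have KD: "K \<in> D" using that E by auto
          obtain c d where cd: "K = {c..d}" using D(2)[OF KD] by auto
          have "c < d" using D(5)[OF KD] AB unfolding cd by (simp add: interior_atLeastAtMost_real)
          moreover have "{c..d} \<subseteq> {A..B}" using D(2)[OF KD] unfolding cd by simp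
          ultimately show ?thesis using cd by auto
        qed
        define J where "J = (\<lambda>K. (Inf K, Sup K)) ` E"
        have inj: "inj_on (\<lambda>K. (Inf K, Sup K)) E"
        proof (rule inj_onI)
          fix K L assume KL: "K \<in> E" "L \<in> E" "(Inf K, Sup K) = (Inf L, Sup L)"
          obtain c d c' d' where "c < d" "K = {c..d}" "c' < d'" "L = {c'..d'}" using K[OF KL(1)] K[OF KL(2)] by blast
          then show "K = L" using KL(3) by simp
        qed
        have J: "nonoverlapping {A..B} J"
          unfolding nonoverlapping_def
        proof (intro conjI)
          show "finite J" using E by (simp add: J_def)
          show "\<forall>(a, b)\<in>J. a < b \<and> {a..b} \<subseteq> {A..B}"
          proof clarify
            fix a b assume "(a, b) \<in> J"
            then obtain L where L: "L \<in> E" "a = Inf L" "b = Sup L" by (auto simp: J_def)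
            then show "a < b \<and> {a..b} \<subseteq> {A..B}" using K[OF L(1)] by auto
          qed
          show "disjoint_family_on (\<lambda>(a, b). {a<..<b}) J"
            unfolding disjoint_family_on_def
          proof (intro ballI impI)
            fix p q assume "p \<in> J" "q \<in> J" and pq: "p \<noteq> q"
            then obtain L M where LM: "L \<in> E" "M \<in> E" "p = (Inf L, Sup L)" "q = (Inf M, Sup M)" by (auto simp: J_def)
            then have "L \<in> D" "M \<in> D" "L \<noteq> M" using E pq by auto
            then have "interior L \<inter> interior M = {}" using pairwiseD[OF D(3)] by simp
            moreover have "interior L = {Inf L<..<Sup L}" "interior M = {Inf M<..<Sup M}"
              using K[OF LM(1)] K[OF LM(2)] by (auto simp: interior_atLeastAtMost_real)
            ultimately show "(case p of (a, b) \<Rightarrow> {a<..<b}) \<inter> (case q of (a, b) \<Rightarrow> {a<..<b}) = {}"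
              using LM by simp
          qed
        qed
        have "total_length J \<le> measure lebesgue (\<Union>D)"
        proof -
          have op: "open (\<Union>(a, b)\<in>J. {a<..<b})" by (intro open_UN) auto
          have "total_length J = measure lebesgue (\<Union>(a, b)\<in>J. {a<..<b})"
            unfolding total_length_measure[OF J] using op by simp
          also have "\<dots> \<le> measure lebesgue (\<Union>D)"
          proof (rule measure_mono_fmeasurable[OF _ _ D(7)])
            show "(\<Union>(a, b)\<in>J. {a<..<b}) \<subseteq> \<Union>D"
            proof clarify
              fix x a b assume "(a, b) \<in> J" "x \<in> {a<..<b}"
              then obtain L where "L \<in> E" "a = Inf L" "b = Sup L" by (auto simp: J_def)
              then show "x \<in> \<Union>D" using K[of L] E \<open>x \<in> {a<..<b}\<close> by (intro UnionI[of L]) auto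
            qed
          qed (use op in auto)
          finally show ?thesis .
        qed
        then have len: "total_length J < \<delta>" using D(8) S0 \<delta>(1) by simp
        have "(\<Sum>K\<in>E. emeasure \<nu> K) = (\<Sum>K\<in>E. ennreal (F (Sup K) - F (Inf K)))"
        proof (rule sum.cong[OF refl])
          fix L assume "L \<in> E"
          then show "emeasure \<nu> L = ennreal (F (Sup L) - F (Inf L))" using K[of L] Icc by force
        qed
        also have "\<dots> = ennreal (\<Sum>K\<in>E. F (Sup K) - F (Inf K))"
        proof (rule sum_ennreal)
          fix L assume "L \<in> E"
          then show "0 \<le> F (Sup L) - F (Inf L)" using K[of L] mono by force
        qed
        also have "(\<Sum>K\<in>E. F (Sup K) - F (Inf K)) \<le> var_sum F J"
          unfolding J_def var_sum_def sum.reindex[OF inj] by (auto intro!: sum_mono)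
        also have "var_sum F J \<le> e" using \<delta>(2)[OF J len] by simp
        finally show "(\<Sum>K\<in>E. emeasure \<nu> K) \<le> ennreal e" by (simp add: ennreal_leI)
      qed
      finally show ?thesis by simp
    qed
    have "emeasure \<nu> S \<le> 0" by (rule ennreal_le_epsilon) (rule small)
    then have "S \<in> null_sets \<nu>" using S' by (auto simp: null_sets_def)
    then have "S \<union> ({..A} \<union> {B..}) \<in> null_sets \<nu>" using outside by blast
    then show "N \<in> null_sets \<nu>"
    proof (rule null_sets_subset)
      show "N \<in> sets \<nu>" using N by (auto simp: sets)
      show "N \<subseteq> S \<union> ({..A} \<union> {B..})" by (auto simp: S_def)
    qed
  qed
  obtain G where G: "G \<in> borel_measurable lborel" "density lborel G = \<nu>"
    using sigma_finite_measure.Radon_Nikodym[OF sigma_finite_lborel ac] sets by auto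
  define g where "g = (\<lambda>x. enn2real (G x))"
  have g_meas [measurable]: "g \<in> borel_measurable borel" using G(1) by (simp add: g_def)
  have G_Icc: "(\<integral>\<^sup>+t. G t * indicator {A..x} t \<partial>lborel) = ennreal (F x - F A)" if "A \<le> x" for x
    using Icc[OF that] emeasure_density[OF G(1), of "{A..x}"] G(2) by simp
  have fin: "AE t in lborel. t \<in> {A..B} \<longrightarrow> G t \<noteq> \<infinity>"
  proof -
    have "AE t in lborel. G t * indicator {A..B} t \<noteq> \<infinity>"
      by (rule nn_integral_PInf_AE) (use G(1) G_Icc[of B] AB in auto)
    then show ?thesis by eventually_elim (auto simp: indicator_def split: if_splits)
  qed
  have has: "(g has_integral (F x - F A)) {A..x}" if x: "x \<in> {A..B}" for x
  proof -
    have "(\<integral>\<^sup>+t. ennreal (g t * indicator {A..x} t) \<partial>lborel) = (\<integral>\<^sup>+t. G t * indicator {A..x} t \<partial>lborel)"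
    proof (rule nn_integral_cong_AE)
      show "AE t in lborel. ennreal (g t * indicator {A..x} t) = G t * indicator {A..x} t"
        using fin by eventually_elim (use x in \<open>auto simp: g_def indicator_def less_top\<close>)
    qed
    then have "has_bochner_integral lborel (\<lambda>t. g t * indicator {A..x} t) (F x - F A)"
      using G_Icc[of x] x mono[of A x] by (intro has_bochner_integral_nn_integral) (auto simp: g_def intro!: g_meas[unfolded g_def] borel_measurable_times)
    then have "((\<lambda>t. g t * indicator {A..x} t) has_integral (F x - F A)) UNIV"
      using has_integral_integral_lborel[of "\<lambda>t. g t * indicator {A..x} t"] by (simp add: has_bochner_integral_iff)
    moreover have "(\<lambda>t. g t * indicator {A..x} t) = (\<lambda>t. if t \<in> {A..x} then g t else 0)" by auto
    ultimately show ?thesis using has_integral_restrict_UNIV[of "{A..x}" g] by simp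
  qed
  show thesis
  proof
    show "g absolutely_integrable_on {A..B}"
      using has[of B] AB by (intro nonnegative_absolutely_integrable_1) (auto simp: g_def has_integral_iff)
    show "F x - F A = integral {A..x} g" if "x \<in> {A..B}" for x
      using has[OF that] by (simp add: integral_unique)
  qed
qed

text \<open>The real and imaginary parts of \<open>f\<close> are differences of the monotone functions \<open>v\<close> and \<open>v - Re f\<close>,
  respectively \<open>v - Im f\<close>, where \<open>v\<close> is the variation function of \<open>f\<close>.\<close>

lemma absolutely_continuous_density:
  fixes f :: "real \<Rightarrow> complex"
  assumes AB: "A < B" and f: "small_variation_on {A..B} f"
  obtains g where "g absolutely_integrable_on {A..B}"
    "\<And>x. x \<in> {A..B} \<Longrightarrow> f x - f A = integral {A..x} g"
proof -
  obtain v :: "real \<Rightarrow> real" where v: "small_variation_on {A..B} v"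
    "\<And>x y. \<lbrakk>A \<le> x; x \<le> y; y \<le> B\<rbrakk> \<Longrightarrow> norm (f y - f x) \<le> v y - v x"
    using variation_function_exists[OF f] AB by (metis less_imp_le)
  have density: "\<exists>g. g absolutely_integrable_on {A..B} \<and> (\<forall>x\<in>{A..B}. F x - F A = integral {A..x} g)"
    if var: "small_variation_on {A..B} F" and mono: "\<And>x y. \<lbrakk>A \<le> x; x \<le> y; y \<le> B\<rbrakk> \<Longrightarrow> F x \<le> F y"
    for F :: "real \<Rightarrow> real"
  proof -
    define F' where "F' x = F (min B (max A x))" for x
    have eq: "F' x = F x" if "x \<in> {A..B}" for x using that by (simp add: F'_def)
    have "continuous_on {A..B} F"
      by (intro uniformly_continuous_imp_continuous small_variation_continuous[OF var] is_interval_cc)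
    then have "continuous_on UNIV F'" unfolding F'_def
      by (rule continuous_on_compose2) (use AB in \<open>auto intro!: continuous_intros\<close>)
    moreover have "small_variation_on {A..B} F'"
      unfolding small_variation_on_def
    proof (intro allI impI)
      fix \<epsilon> :: real assume \<epsilon>: "\<epsilon> > 0"
      have "var_sum F' J = var_sum F J" if "nonoverlapping {A..B} J" for J
        unfolding var_sum_def
      proof (rule sum.cong[OF refl], clarify)
        fix a b assume "(a, b) \<in> J"
        then have "a < b" "{a..b} \<subseteq> {A..B}" using that by (auto simp: nonoverlapping_def)
        then show "norm (F' b - F' a) = norm (F b - F a)" using eq[of a] eq[of b] by auto
      qed
      then show "\<exists>\<delta>>0. \<forall>J. nonoverlapping {A..B} J \<and> total_length J < \<delta> \<longrightarrow> var_sum F' J < \<epsilon>"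
        using small_variation_onE[OF var \<epsilon>] by metis
    qed
    ultimately obtain g where "g absolutely_integrable_on {A..B}" "\<And>x. x \<in> {A..B} \<Longrightarrow> F' x - F' A = integral {A..x} g"
      using monotone_density[of A B F'] AB mono by (auto simp: F'_def)
    then show ?thesis using eq AB by (intro exI[of _ g]) auto
  qed
  obtain g0 where g0: "g0 absolutely_integrable_on {A..B}" "\<And>x. x \<in> {A..B} \<Longrightarrow> v x - v A = integral {A..x} g0"
  proof -
    have "v x \<le> v y" if "A \<le> x" "x \<le> y" "y \<le> B" for x y
      using v(2)[OF that] norm_ge_zero[of "f y - f x"] by linarith
    then show thesis using that density[OF v(1)] by blast
  qed
  have part: "\<exists>g. g absolutely_integrable_on {A..B} \<and> (\<forall>x\<in>{A..B}. P (f x) - P (f A) = integral {A..x} g)"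
    if P: "\<And>z w. P (z - w) = P z - P w" "\<And>z. \<bar>P z\<bar> \<le> norm z" for P :: "complex \<Rightarrow> real"
  proof -
    have "small_variation_on {A..B} (\<lambda>x. v x - P (f x))"
    proof (rule small_variation_combine[OF v(1) f zero_less_one])
      fix x y
      show "norm (v y - P (f y) - (v x - P (f x))) \<le> 1 * (norm (v y - v x) + norm (f y - f x))"
        using P(2)[of "f y - f x"] P(1)[of "f y" "f x"] by (simp add: real_norm_def)
    qed
    moreover have "v x - P (f x) \<le> v y - P (f y)" if "A \<le> x" "x \<le> y" "y \<le> B" for x y
      using v(2)[OF that] P(2)[of "f y - f x"] P(1)[of "f y" "f x"] by simp
    ultimately obtain g where g: "g absolutely_integrable_on {A..B}"
      "\<And>x. x \<in> {A..B} \<Longrightarrow> (v x - P (f x)) - (v A - P (f A)) = integral {A..x} g"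
      using density[of "\<lambda>x. v x - P (f x)"] by blast
    have "P (f x) - P (f A) = integral {A..x} (\<lambda>t. g0 t - g t)" if x: "x \<in> {A..B}" for x
    proof -
      have "g0 integrable_on {A..x}" "g integrable_on {A..x}"
        using x by (auto intro: integrable_on_subinterval[OF set_lebesgue_integral_eq_integral(1)[OF g0(1)]]
            integrable_on_subinterval[OF set_lebesgue_integral_eq_integral(1)[OF g(1)]])
      then show ?thesis using g0(2)[OF x] g(2)[OF x] by (simp add: integral_diff)
    qed
    then show ?thesis using set_integral_diff(1)[OF g0(1) g(1)] by blast
  qed
  obtain g1 where g1: "g1 absolutely_integrable_on {A..B}" "\<And>x. x \<in> {A..B} \<Longrightarrow> Re (f x) - Re (f A) = integral {A..x} g1"
    using part[of Re] abs_Re_le_cmod by auto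
  obtain g2 where g2: "g2 absolutely_integrable_on {A..B}" "\<And>x. x \<in> {A..B} \<Longrightarrow> Im (f x) - Im (f A) = integral {A..x} g2"
    using part[of Im] abs_Im_le_cmod by auto
  have re: "bounded_linear complex_of_real" by (rule bounded_linear_of_real)
  have lin: "bounded_linear (\<lambda>x. \<i> * complex_of_real x)"
    by (intro bounded_linear_const_mult bounded_linear_of_real)
  show thesis
  proof
    show "(\<lambda>x. complex_of_real (g1 x) + \<i> * complex_of_real (g2 x)) absolutely_integrable_on {A..B}"
    proof (rule set_integral_add(1))
      show "(\<lambda>x. complex_of_real (g1 x)) absolutely_integrable_on {A..B}"
        using absolutely_integrable_linear[OF g1(1) re] by (simp add: o_def)
      show "(\<lambda>x. \<i> * complex_of_real (g2 x)) absolutely_integrable_on {A..B}"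
        using absolutely_integrable_linear[OF g2(1) lin] by (simp add: o_def)
    qed
    fix x assume x: "x \<in> {A..B}"
    have "g1 integrable_on {A..x}" "g2 integrable_on {A..x}"
        using x by (auto intro: integrable_on_subinterval[OF set_lebesgue_integral_eq_integral(1)[OF g1(1)]]
            integrable_on_subinterval[OF set_lebesgue_integral_eq_integral(1)[OF g2(1)]])
    then have "(g1 has_integral (Re (f x) - Re (f A))) {A..x}" "(g2 has_integral (Im (f x) - Im (f A))) {A..x}"
      using g1(2)[OF x] g2(2)[OF x] by (auto simp: has_integral_iff)
    then have "((\<lambda>x. complex_of_real (g1 x) + \<i> * complex_of_real (g2 x)) has_integral
      (complex_of_real (Re (f x) - Re (f A)) + \<i> * complex_of_real (Im (f x) - Im (f A)))) {A..x}"
      using has_integral_add[OF has_integral_linear[OF _ re] has_integral_linear[OF _ lin]] unfolding o_def by blast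
    moreover have "complex_of_real (Re (f x) - Re (f A)) + \<i> * complex_of_real (Im (f x) - Im (f A)) = f x - f A"
      by (simp add: complex_eq_iff)
    ultimately show "f x - f A = integral {A..x} (\<lambda>x. complex_of_real (g1 x) + \<i> * complex_of_real (g2 x))"
      by (simp add: integral_unique)
  qed
qed

lemma abs_int_subinterval:
  fixes g :: "real \<Rightarrow> 'a::euclidean_space"
  assumes "g absolutely_integrable_on {a..b}" "a \<le> x" "y \<le> b"
  shows "g absolutely_integrable_on {x..y}" "g integrable_on {x..y}" "(\<lambda>t. norm (g t)) integrable_on {x..y}"
  using absolutely_integrable_on_subinterval[OF assms(1), of x y] assms(2,3)
  by (auto simp: absolutely_integrable_on_def)

lemma integral_split:
  fixes g :: "real \<Rightarrow> 'a::euclidean_space"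
  assumes "g integrable_on {a..b}" "a \<le> x" "x \<le> y" "y \<le> b"
  shows "integral {a..y} g - integral {a..x} g = integral {x..y} g"
  using Henstock_Kurzweil_Integration.integral_combine[of a x y g] integrable_on_subinterval[OF assms(1), of a y] assms
  by (simp add: algebra_simps)

lemma abs_cont_on_iff_small_variation: "abs_cont_on S f \<longleftrightarrow> small_variation_on S f"
proof
  assume f: "small_variation_on S f"
  show "abs_cont_on S f"
    unfolding abs_cont_on_def
  proof (intro allI impI)
    fix \<epsilon> :: real assume \<epsilon>: "\<epsilon> > 0"
    obtain \<delta> where \<delta>: "\<delta> > 0" "\<And>J. nonoverlapping S J \<Longrightarrow> total_length J < \<delta> \<Longrightarrow> var_sum f J < \<epsilon>"
      using small_variation_onE[OF f \<epsilon>] by metis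
    have "(\<Sum>(a, b)\<in>J. norm (f b - f a)) < \<epsilon>"
      if J: "finite J" "\<forall>(a, b)\<in>J. a \<le> b \<and> {a..b} \<subseteq> S" "disjoint_family_on (\<lambda>(a, b). {a<..<b}) J"
        "(\<Sum>(a, b)\<in>J. b - a) < \<delta>" for J
    proof -
      define J' where "J' = {p \<in> J. fst p < snd p}"
      have "nonoverlapping S J'"
        using J unfolding nonoverlapping_def J'_def disjoint_family_on_def by auto
      moreover have "total_length J' = (\<Sum>(a, b)\<in>J. b - a)"
        unfolding total_length_def by (rule sum.mono_neutral_left) (use J in \<open>auto simp: J'_def\<close>)
      moreover have "var_sum f J' = (\<Sum>(a, b)\<in>J. norm (f b - f a))"
        unfolding var_sum_def by (rule sum.mono_neutral_left) (use J in \<open>force simp: J'_def\<close>)+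
      ultimately show ?thesis using \<delta>(2)[of J'] J(4) by simp
    qed
    then show "\<exists>\<delta>>0. \<forall>J. finite J \<and> (\<forall>(a, b)\<in>J. a \<le> b \<and> {a..b} \<subseteq> S) \<and>
        disjoint_family_on (\<lambda>(a, b). {a<..<b}) J \<and> (\<Sum>(a, b)\<in>J. b - a) < \<delta> \<longrightarrow>
        (\<Sum>(a, b)\<in>J. norm (f b - f a)) < \<epsilon>"
      using \<delta>(1) by (intro exI[of _ \<delta>]) simp
  qed
qed (rule abs_cont_on_small_variation)

lemma small_variation_on_subset: "small_variation_on T f \<Longrightarrow> S \<subseteq> T \<Longrightarrow> small_variation_on S f"
  unfolding small_variation_on_def using nonoverlapping_mono[of S _ T] by metis

lemma sum_integrals_nonoverlapping_le:
  fixes h :: "real \<Rightarrow> real"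
  assumes J: "nonoverlapping {c..d} J" and h: "h integrable_on {c..d}" "\<And>x. x \<in> {c..d} \<Longrightarrow> 0 \<le> h x"
  shows "(\<Sum>(a, b)\<in>J. integral {a..b} h) \<le> integral {c..d} h"
proof -
  define E where "E = (\<lambda>(a, b). {a..b}) ` J"
  have J': "a < b" "{a..b} \<subseteq> {c..d}" if "(a, b) \<in> J" for a b
    using J that by (auto simp: nonoverlapping_def)
  have fin: "finite J" using J by (simp add: nonoverlapping_def)
  have inj: "inj_on (\<lambda>(a, b). {a..b}) J"
  proof (rule inj_onI, clarify)
    fix a b a' b' assume "(a, b) \<in> J" "(a', b') \<in> J" "{a..b} = {a'..b'}"
    then show "a = a' \<and> b = b'" using J'[of a b] by (simp add: Icc_eq_Icc)
  qed
  have sub: "K \<subseteq> {c..d}" if "K \<in> E" for K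
  proof -
    obtain a b where "(a, b) \<in> J" "K = {a..b}" using \<open>K \<in> E\<close> by (auto simp: E_def)
    then show ?thesis using J'(2) by metis
  qed
  have div: "E division_of \<Union>E"
  proof (rule division_ofI)
    show "finite E" using fin by (simp add: E_def)
    show "K \<noteq> {}" "\<exists>a b. K = cbox a b" if K: "K \<in> E" for K
    proof -
      obtain a b where ab: "(a, b) \<in> J" "K = {a..b}" using K by (auto simp: E_def)
      show "K \<noteq> {}" using J'(1)[OF ab(1)] ab(2) by simp
      show "\<exists>a b. K = cbox a b" using ab(2) by (metis box_real(2))
    qed
    fix K L assume KL: "K \<in> E" "L \<in> E" "K \<noteq> L"
    obtain p where p: "p \<in> J" "K = {fst p..snd p}" using KL(1) unfolding E_def case_prod_unfold by blast
    obtain q where q: "q \<in> J" "L = {fst q..snd q}" using KL(2) unfolding E_def case_prod_unfold by blast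
    have "p \<noteq> q" using p q KL by auto
    then have "{fst p<..<snd p} \<inter> {fst q<..<snd q} = {}"
      using J p(1) q(1) unfolding nonoverlapping_def disjoint_family_on_def case_prod_unfold by blast
    then show "interior K \<inter> interior L = {}"
      unfolding p(2) q(2) interior_atLeastAtMost_real .
  qed auto
  have int: "h integrable_on K" if K: "K \<in> E" for K
  proof -
    obtain a b where "(a, b) \<in> J" "K = {a..b}" using K by (auto simp: E_def)
    then show ?thesis using integrable_on_subinterval[OF h(1)] sub[OF K] by simp
  qed
  have "(\<Sum>(a, b)\<in>J. integral {a..b} h) = (\<Sum>K\<in>E. integral K h)"
    unfolding E_def sum.reindex[OF inj] by (rule sum.cong) auto
  also have "\<dots> = integral (\<Union>E) h"
    by (rule integral_combine_division_bottomup[OF div int, symmetric])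
  also have "\<dots> \<le> integral {c..d} h"
  proof (rule integral_subset_le)
    show "h integrable_on \<Union>E" by (rule integrable_combine_division[OF div int])
  qed (use sub h in auto)
  finally show ?thesis .
qed

text \<open>Up to a remainder \<open>h n\<close> of small integral the integrand is bounded by \<open>n\<close>, so the variation over a
  family is at most \<open>n\<close> times its total length plus the integral of \<open>h n\<close>.\<close>

lemma indefinite_integral_small_variation:
  fixes g :: "real \<Rightarrow> complex"
  assumes g: "g absolutely_integrable_on {c..d}"
    and F: "\<And>x y. \<lbrakk>c \<le> x; x \<le> y; y \<le> d\<rbrakk> \<Longrightarrow> F y - F x = integral {x..y} g"
  shows "small_variation_on {c..d} F"
  unfolding small_variation_on_def
proof (intro allI impI)
  fix \<epsilon> :: real assume \<epsilon>: "\<epsilon> > 0"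
  define h where "h n x = norm (g x) - min (norm (g x)) (real n)" for n x
  have ng: "(\<lambda>x. norm (g x)) absolutely_integrable_on {c..d}" by (rule absolutely_integrable_norm[OF g, unfolded o_def])
  have cst: "(\<lambda>x::real. real n) absolutely_integrable_on {c..d}" for n
    by (rule absolutely_integrable_continuous_real) simp
  have h_int: "h n integrable_on {c..d}" for n
    unfolding h_def using absolutely_integrable_min_1[OF ng cst, of n] ng
    by (intro integrable_diff set_lebesgue_integral_eq_integral(1))
  have h0: "0 \<le> h n x" for n x by (simp add: h_def)
  have "(\<lambda>n. integral {c..d} (h n)) \<longlonglongrightarrow> integral {c..d} (\<lambda>x. 0)"
  proof (rule dominated_convergence(2)[OF h_int])
    show "(\<lambda>x. norm (g x)) integrable_on {c..d}" using ng by (rule set_lebesgue_integral_eq_integral(1))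
    show "norm (h n x) \<le> norm (g x)" for n x by (simp add: h_def)
    show "(\<lambda>n. h n x) \<longlonglongrightarrow> 0" for x
    proof -
      obtain N :: nat where "norm (g x) \<le> real N" using real_arch_simple by blast
      then have "\<forall>\<^sub>F n in sequentially. h n x = 0"
        by (intro eventually_sequentiallyI[of N]) (simp add: h_def)
      then show ?thesis by (rule tendsto_eventually)
    qed
  qed
  then have "(\<lambda>n. integral {c..d} (h n)) \<longlonglongrightarrow> 0" by simp
  then have "\<forall>\<^sub>F n in sequentially. integral {c..d} (h n) < \<epsilon> / 2"
    using \<epsilon> by (intro order_tendstoD(2)) auto
  then obtain n where n: "integral {c..d} (h n) < \<epsilon> / 2" by (auto simp: eventually_sequentially)
  define \<delta> where "\<delta> = \<epsilon> / (2 * (real n + 1))"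
  have \<delta>: "\<delta> > 0" using \<epsilon> by (simp add: \<delta>_def)
  have "var_sum F J < \<epsilon>" if J: "nonoverlapping {c..d} J" "total_length J < \<delta>" for J
  proof -
    have "var_sum F J \<le> (\<Sum>(a, b)\<in>J. integral {a..b} (h n) + real n * (b - a))"
      unfolding var_sum_def
    proof (rule sum_mono, clarify)
      fix a b assume "(a, b) \<in> J"
      then have ab: "a < b" "c \<le> a" "b \<le> d" using J(1) by (force simp: nonoverlapping_def)+
      have hab: "h n integrable_on {a..b}" using integrable_on_subinterval[OF h_int] ab by auto
      have "norm (F b - F a) = norm (integral {a..b} g)" using F[of a b] ab by simp
      also have "\<dots> \<le> integral {a..b} (\<lambda>x. h n x + real n)"
        by (rule Henstock_Kurzweil_Integration.integral_norm_bound_integral)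
          (use abs_int_subinterval[OF g ab(2,3)] in \<open>auto simp: h_def intro!: integrable_add hab[unfolded h_def]\<close>)
      also have "\<dots> = integral {a..b} (h n) + real n * (b - a)"
        using hab ab by (subst integral_add) (auto simp: mult.commute)
      finally show "norm (F b - F a) \<le> integral {a..b} (h n) + real n * (b - a)" .
    qed
    also have "\<dots> = (\<Sum>(a, b)\<in>J. integral {a..b} (h n)) + real n * total_length J"
      by (simp add: case_prod_unfold sum.distrib total_length_def sum_distrib_left)
    also have "(\<Sum>(a, b)\<in>J. integral {a..b} (h n)) \<le> integral {c..d} (h n)"
      by (rule sum_integrals_nonoverlapping_le[OF J(1) h_int h0])
    also have "real n * total_length J \<le> real n * \<delta>" using J(2) by (intro mult_left_mono) auto
    also have "real n * \<delta> \<le> \<epsilon> / 2" using \<epsilon> by (simp add: \<delta>_def field_simps)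
    finally show ?thesis using n by simp
  qed
  then show "\<exists>\<delta>>0. \<forall>J. nonoverlapping {c..d} J \<and> total_length J < \<delta> \<longrightarrow> var_sum F J < \<epsilon>"
    using \<delta> by blast
qed

text \<open>Lebesgue's differentiation theorem. Its one-sided form for integrals over \<open>{x..x + h}\<close> is applied to
  the integrand and to its reflection, which gives the right and the left derivative.\<close>

lemma indefinite_integral_has_vector_derivative_AE:
  fixes g :: "real \<Rightarrow> complex"
  assumes g: "g absolutely_integrable_on {a..b}"
    and F: "\<And>x y. \<lbrakk>a < x; x \<le> y; y < b\<rbrakk> \<Longrightarrow> F y - F x = integral {x..y} g"
  obtains N where "negligible N" "\<And>x. \<lbrakk>x \<in> {a<..<b}; x \<notin> N\<rbrakk> \<Longrightarrow> (F has_vector_derivative g x) (at x)"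
proof -
  define g0 where "g0 x = (if x \<in> {a..b} then g x else 0)" for x
  have g0: "g0 integrable_on cbox c d" "(\<lambda>x. g0 (- x)) integrable_on cbox c d" for c d
  proof -
    have "g0 absolutely_integrable_on UNIV" unfolding g0_def using g absolutely_integrable_restrict_UNIV by blast
    then have "g0 absolutely_integrable_on {c..d}" for c d by (rule absolutely_integrable_on_subinterval) simp
    then have *: "g0 integrable_on {c..d}" for c d by (rule set_lebesgue_integral_eq_integral(1))
    show "g0 integrable_on cbox c d" using * by simp
    show "(\<lambda>x. g0 (- x)) integrable_on cbox c d" using *[of "- d" "- c"] Henstock_Kurzweil_Integration.integrable_reflect_real[where f = g0 and a = "- d" and b = "- c"] by simp
  qed
  obtain N1 where N1: "negligible N1" "\<And>x e. \<lbrakk>x \<notin> N1; 0 < e\<rbrakk> \<Longrightarrow>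
      \<exists>d>0. \<forall>h. 0 < h \<and> h < d \<longrightarrow> norm (integral (cbox x (x + h *\<^sub>R One)) g0 /\<^sub>R h ^ DIM(real) - g0 x) < e"
    using integrable_ccontinuous_explicit[OF g0(1)] by metis
  obtain N2 where N2: "negligible N2" "\<And>x e. \<lbrakk>x \<notin> N2; 0 < e\<rbrakk> \<Longrightarrow>
      \<exists>d>0. \<forall>h. 0 < h \<and> h < d \<longrightarrow> norm (integral (cbox x (x + h *\<^sub>R One)) (\<lambda>x. g0 (- x)) /\<^sub>R h ^ DIM(real) - g0 (- x)) < e"
    using integrable_ccontinuous_explicit[OF g0(2)] by metis
  show thesis
  proof
    show "negligible (N1 \<union> uminus ` N2)"
      using N1(1) negligible_differentiable_image_negligible[OF _ N2(1), of uminus]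
      by (simp add: differentiable_on_def)
    fix x assume x: "x \<in> {a<..<b}" "x \<notin> N1 \<union> uminus ` N2"
    have x1: "x \<notin> N1" and x2: "- x \<notin> N2" using x(2) by (auto intro: image_eqI[of x uminus "- x"])
    have gx: "g0 x = g x" using x(1) by (simp add: g0_def)
    have scaled: "norm (c - h *\<^sub>R z) \<le> e * h" if "norm (c /\<^sub>R h - z) < e" "h > 0" for c z :: complex and h e :: real
    proof -
      have "norm (c - h *\<^sub>R z) = h * norm (c /\<^sub>R h - z)"
        using that(2) norm_scaleR[of h "c /\<^sub>R h - z"] by (simp add: scaleR_diff_right)
      then show ?thesis using that by (simp add: mult.commute)
    qed
    show "(F has_vector_derivative g x) (at x)"
      unfolding has_vector_derivative_def has_derivative_at_alt
    proof (intro conjI allI impI)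
      show "bounded_linear (\<lambda>h. h *\<^sub>R g x)" by (rule bounded_linear_scaleR_left)
      fix e :: real assume e: "e > 0"
      obtain d1 where d1: "d1 > 0" "\<And>h. 0 < h \<Longrightarrow> h < d1 \<Longrightarrow> norm (integral {x..x + h} g0 /\<^sub>R h - g x) < e"
        using N1(2)[OF x1 e] gx by auto
      obtain d2 where d2: "d2 > 0" "\<And>h. 0 < h \<Longrightarrow> h < d2 \<Longrightarrow> norm (integral {- x..- x + h} (\<lambda>x. g0 (- x)) /\<^sub>R h - g x) < e"
        using N2(2)[OF x2 e] gx by auto
      define d where "d = min (min d1 d2) (min (x - a) (b - x))"
      have g_eq: "integral {u..w} g0 = integral {u..w} g" if "a \<le> u" "w \<le> b" for u w
        by (rule Henstock_Kurzweil_Integration.integral_cong) (use that in \<open>auto simp: g0_def\<close>)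
      have "norm (F y - F x - (y - x) *\<^sub>R g x) \<le> e * norm (y - x)" if y: "norm (y - x) < d" for y
      proof -
        consider "y = x" | "x < y" | "y < x" by linarith
        then show ?thesis
        proof cases
          case 2
          define h where "h = y - x"
          have h: "h > 0" "h < d1" "y = x + h" "y < b" using y 2 by (auto simp: h_def d_def)
          have "F y - F x = integral {x..x + h} g0" using F[of x y] x(1) h g_eq[of x y] by simp
          then show ?thesis using scaled[OF d1(2)[OF h(1,2)] h(1)] h by simp
        next
          case 3
          define h where "h = x - y"
          have h: "h > 0" "h < d2" "y = x - h" "a < y" using y 3 by (auto simp: h_def d_def)
          have "integral {- x..- x + h} (\<lambda>x. g0 (- x)) = integral {y..x} g0"
            using Henstock_Kurzweil_Integration.integral_reflect_real[of x y g0] h(3) by simp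
          also have "\<dots> = F x - F y" using F[of y x] x(1) h g_eq[of y x] by simp
          finally have "norm (F x - F y - h *\<^sub>R g x) \<le> e * h" using scaled[OF d2(2)[OF h(1,2)] h(1)] by simp
          moreover have "F y - F x - (y - x) *\<^sub>R g x = - (F x - F y - h *\<^sub>R g x)"
            by (simp add: h_def algebra_simps)
          ultimately show ?thesis using h(1,3) by (simp only: norm_minus_cancel) simp
        qed simp
      qed
      moreover have "d > 0" using d1(1) d2(1) x(1) by (simp add: d_def)
      ultimately show "\<exists>d>0. \<forall>y. norm (y - x) < d \<longrightarrow> norm (F y - F x - (y - x) *\<^sub>R g x) \<le> e * norm (y - x)"
        by blast
    qed
  qed
qed

text \<open>Lebesgue's fundamental theorem of calculus: the Radon-Nikodym density of an absolutely continuous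
  function is its derivative almost everywhere.\<close>

lemma absolutely_continuous_FTC:
  fixes f :: "real \<Rightarrow> complex"
  assumes AB: "A < B" and f: "small_variation_on {A..B} f"
  obtains g N where "g absolutely_integrable_on {A..B}" "negligible N"
    "\<And>x. \<lbrakk>x \<in> {A<..<B}; x \<notin> N\<rbrakk> \<Longrightarrow> (f has_vector_derivative g x) (at x)"
    "\<And>x y. \<lbrakk>A \<le> x; x \<le> y; y \<le> B\<rbrakk> \<Longrightarrow> f y - f x = integral {x..y} g"
proof -
  obtain g where g: "g absolutely_integrable_on {A..B}" "\<And>x. x \<in> {A..B} \<Longrightarrow> f x - f A = integral {A..x} g"
    using absolutely_continuous_density[OF AB f] by metis
  have int: "f y - f x = integral {x..y} g" if "A \<le> x" "x \<le> y" "y \<le> B" for x y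
    using integral_split[OF abs_int_subinterval(2)[OF g(1) order_refl order_refl] that] g(2)[of x] g(2)[of y] that
    by (simp add: algebra_simps)
  obtain N where "negligible N" "\<And>x. \<lbrakk>x \<in> {A<..<B}; x \<notin> N\<rbrakk> \<Longrightarrow> (f has_vector_derivative g x) (at x)"
    using indefinite_integral_has_vector_derivative_AE[OF g(1), of f] int by (metis less_imp_le)
  then show thesis using that[OF g(1)] int by blast
qed

section \<open>Functions with integrable second derivative\<close>

lemma abs_int_mult_continuous:
  fixes g :: "real \<Rightarrow> complex"
  assumes "g absolutely_integrable_on {a..b}" "continuous_on {a..b} u"
  shows "(\<lambda>x. g x * u x) absolutely_integrable_on {a..b}"
proof -
  have "(\<lambda>x. u x * g x) absolutely_integrable_on {a..b}"
  proof (rule absolutely_integrable_bounded_measurable_product[of "(*)"])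
    show "bilinear ((*) :: complex \<Rightarrow> complex \<Rightarrow> complex)" by (rule bilinear_times)
    show "u \<in> borel_measurable (lebesgue_on {a..b})"
      by (rule continuous_imp_measurable_on_sets_lebesgue[OF assms(2)]) simp
    show "bounded (u ` {a..b})"
      by (intro compact_imp_bounded compact_continuous_image assms) simp
  qed (use assms in auto)
  then show ?thesis by (simp add: mult.commute)
qed

text \<open>The Sobolev functions with integrable second derivative \<open>g\<close>. The function \<open>U\<close> and its derivative \<open>V\<close>
  are given as indefinite integrals on the closed interval, so that their values at the end points are
  the boundary values.\<close>

definition W21 :: "real \<Rightarrow> real \<Rightarrow> (real \<Rightarrow> complex) \<Rightarrow> (real \<Rightarrow> complex) \<Rightarrow> (real \<Rightarrow> complex) \<Rightarrow> bool" where
  "W21 a b U V g \<longleftrightarrow> g absolutely_integrable_on {a..b} \<and>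
     (\<forall>x\<in>{a..b}. V x = V a + integral {a..x} g \<and> U x = U a + integral {a..x} V)"

lemma W21_D:
  assumes "W21 a b U V g"
  shows "g absolutely_integrable_on {a..b}"
    and "x \<in> {a..b} \<Longrightarrow> V a + integral {a..x} g = V x"
    and "x \<in> {a..b} \<Longrightarrow> U a + integral {a..x} V = U x"
  using assms unfolding W21_def by metis+

lemma W21_continuous:
  assumes "W21 a b U V g"
  shows "continuous_on {a..b} U" "continuous_on {a..b} V"
proof -
  have "g integrable_on {a..b}" by (rule set_lebesgue_integral_eq_integral(1)[OF W21_D(1)[OF assms]])
  then have "continuous_on {a..b} (\<lambda>x. V a + integral {a..x} g)"
    by (intro continuous_intros indefinite_integral_continuous_1)
  then show V: "continuous_on {a..b} V"
    by (rule continuous_on_eq) (rule W21_D(2)[OF assms])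
  have "continuous_on {a..b} (\<lambda>x. U a + integral {a..x} V)"
    by (intro continuous_intros indefinite_integral_continuous_1 integrable_continuous_real V)
  then show "continuous_on {a..b} U"
    by (rule continuous_on_eq) (rule W21_D(3)[OF assms])
qed

lemma W21_deriv:
  assumes "W21 a b U V g" "x \<in> {a..b}"
  shows "(U has_vector_derivative V x) (at x within {a..b})"
proof -
  have "((\<lambda>x. U a + integral {a..x} V) has_vector_derivative 0 + V x) (at x within {a..b})"
    by (intro has_vector_derivative_add has_vector_derivative_const integral_has_vector_derivative W21_continuous[OF assms(1)] assms(2))
  then have "((\<lambda>x. U a + integral {a..x} V) has_vector_derivative V x) (at x within {a..b})" by simp
  then show ?thesis
    by (rule has_vector_derivative_transform[OF assms(2), rotated]) (rule W21_D(3)[OF assms(1), symmetric])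
qed

lemma W21_deriv_at:
  assumes "W21 a b U V g" "x \<in> {a<..<b}"
  shows "(U has_vector_derivative V x) (at x)"
  using W21_deriv[OF assms(1), of x] assms(2) at_within_interior[of x "{a..b}"]
  by (simp add: interior_atLeastAtMost_real)

lemma W21_increment:
  assumes "W21 a b U V g" "a \<le> x" "x \<le> y" "y \<le> b"
  shows "V y - V x = integral {x..y} g" "U y - U x = integral {x..y} V"
proof -
  have g: "g integrable_on {a..b}" by (rule set_lebesgue_integral_eq_integral(1)[OF W21_D(1)[OF assms(1)]])
  have V: "V integrable_on {a..b}" by (intro integrable_continuous_real W21_continuous[OF assms(1)])
  have eqs: "V a + integral {a..x} g = V x" "V a + integral {a..y} g = V y"
    "U a + integral {a..x} V = U x" "U a + integral {a..y} V = U y"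
    using assms(2-4) by (auto intro: W21_D(2,3)[OF assms(1)])
  show "V y - V x = integral {x..y} g" "U y - U x = integral {x..y} V"
    unfolding eqs[symmetric] integral_split[OF g assms(2-4), symmetric] integral_split[OF V assms(2-4), symmetric]
    by simp_all
qed

lemma W21_add:
  assumes 1: "W21 a b U1 V1 g1" and 2: "W21 a b U2 V2 g2"
  shows "W21 a b (\<lambda>x. U1 x + U2 x) (\<lambda>x. V1 x + V2 x) (\<lambda>x. g1 x + g2 x)"
  unfolding W21_def
proof (intro conjI ballI)
  note g = W21_D(1)[OF 1] W21_D(1)[OF 2]
  show "(\<lambda>x. g1 x + g2 x) absolutely_integrable_on {a..b}" by (intro set_integral_add(1) g)
  fix x assume x: "x \<in> {a..b}"
  have "g1 integrable_on {a..x}" "g2 integrable_on {a..x}"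
    using abs_int_subinterval(2)[OF g(1)] abs_int_subinterval(2)[OF g(2)] x by auto
  moreover have "V1 integrable_on {a..x}" "V2 integrable_on {a..x}"
    using x by (auto intro!: integrable_continuous_real continuous_on_subset[OF W21_continuous(2)[OF 1]] continuous_on_subset[OF W21_continuous(2)[OF 2]])
  ultimately show "V1 x + V2 x = V1 a + V2 a + integral {a..x} (\<lambda>x. g1 x + g2 x)"
    "U1 x + U2 x = U1 a + U2 a + integral {a..x} (\<lambda>x. V1 x + V2 x)"
    using W21_increment[OF 1, of a x] W21_increment[OF 2, of a x] x by (simp_all add: integral_add algebra_simps)
qed

lemma W21_scale:
  assumes "W21 a b U V g"
  shows "W21 a b (\<lambda>x. c * U x) (\<lambda>x. c * V x) (\<lambda>x. c * g x)"
  unfolding W21_def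
proof (intro conjI ballI)
  show "(\<lambda>x. c * g x) absolutely_integrable_on {a..b}" by (rule set_integrable_mult_right) (rule W21_D(1)[OF assms])
  fix x assume x: "x \<in> {a..b}"
  show "c * V x = c * V a + integral {a..x} (\<lambda>x. c * g x)" "c * U x = c * U a + integral {a..x} (\<lambda>x. c * V x)"
    unfolding W21_D(2)[OF assms x, symmetric] W21_D(3)[OF assms x, symmetric] by (simp_all add: distrib_left)
qed

lemma W21_cnj:
  assumes "W21 a b U V g"
  shows "W21 a b (\<lambda>x. cnj (U x)) (\<lambda>x. cnj (V x)) (\<lambda>x. cnj (g x))"
  unfolding W21_def
proof (intro conjI ballI)
  note g = W21_D(1)[OF assms]
  show "(\<lambda>x. cnj (g x)) absolutely_integrable_on {a..b}"
    using absolutely_integrable_linear[OF g bounded_linear_cnj] by (simp add: o_def)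
  fix x assume x: "x \<in> {a..b}"
  have *: "integral {a..x} (\<lambda>x. cnj (f x)) = cnj (integral {a..x} f)" for f :: "real \<Rightarrow> complex"
    by (rule integral_cnj[symmetric])
  show "cnj (V x) = cnj (V a) + integral {a..x} (\<lambda>x. cnj (g x))" "cnj (U x) = cnj (U a) + integral {a..x} (\<lambda>x. cnj (V x))"
    unfolding * W21_D(2)[OF assms x, symmetric] W21_D(3)[OF assms x, symmetric] by simp_all
qed

text \<open>Both factors are absolutely continuous and bounded, hence so is their product; by the
  fundamental theorem it is the integral of its derivative, which the product rule gives almost
  everywhere.\<close>

lemma integration_by_parts_abs_int:
  fixes U V W g :: "real \<Rightarrow> complex"
  assumes ab: "a < b" and g: "g absolutely_integrable_on {a..b}" and W: "W absolutely_integrable_on {a..b}"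
    and V: "\<And>x y. \<lbrakk>a \<le> x; x \<le> y; y \<le> b\<rbrakk> \<Longrightarrow> V y - V x = integral {x..y} g"
    and U: "\<And>x y. \<lbrakk>a \<le> x; x \<le> y; y \<le> b\<rbrakk> \<Longrightarrow> U y - U x = integral {x..y} W"
  shows "integral {a..b} (\<lambda>x. g x * U x) + integral {a..b} (\<lambda>x. V x * W x) = V b * U b - V a * U a"
proof -
  have sv: "small_variation_on {a..b} V" "small_variation_on {a..b} U"
    using indefinite_integral_small_variation[OF g V] indefinite_integral_small_variation[OF W U] by auto
  then have cont: "continuous_on {a..b} V" "continuous_on {a..b} U"
    by (auto intro!: uniformly_continuous_imp_continuous small_variation_continuous is_interval_cc)
  have "bounded (V ` {a..b} \<union> U ` {a..b})"
    by (intro compact_imp_bounded compact_Un compact_continuous_image cont) simp_all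
  then obtain L where L: "L > 0" "\<And>x. x \<in> {a..b} \<Longrightarrow> norm (V x) \<le> L \<and> norm (U x) \<le> L"
    unfolding bounded_pos by blast
  have "small_variation_on {a..b} (\<lambda>x. V x * U x)"
  proof (rule small_variation_combine[OF sv L(1)])
    fix x y assume xy: "x \<in> {a..b}" "y \<in> {a..b}"
    have "V y * U y - V x * U x = (V y - V x) * U y + V x * (U y - U x)" by (simp add: algebra_simps)
    then have "norm (V y * U y - V x * U x) \<le> norm (V y - V x) * norm (U y) + norm (V x) * norm (U y - U x)"
      by (metis norm_triangle_ineq norm_mult)
    also have "\<dots> \<le> norm (V y - V x) * L + L * norm (U y - U x)"
      using L(2)[OF xy(1)] L(2)[OF xy(2)] by (intro add_mono mult_left_mono mult_right_mono) auto
    finally show "norm (V y * U y - V x * U x) \<le> L * (norm (V y - V x) + norm (U y - U x))"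
      by (simp add: algebra_simps)
  qed
  from absolutely_continuous_FTC[OF ab this] obtain h N where N: "negligible N"
    "\<And>x. \<lbrakk>x \<in> {a<..<b}; x \<notin> N\<rbrakk> \<Longrightarrow> ((\<lambda>x. V x * U x) has_vector_derivative h x) (at x)"
    "V b * U b - V a * U a = integral {a..b} h"
    using ab by (metis less_imp_le order_refl)
  obtain N1 where N1: "negligible N1" "\<And>x. \<lbrakk>x \<in> {a<..<b}; x \<notin> N1\<rbrakk> \<Longrightarrow> (V has_vector_derivative g x) (at x)"
    using indefinite_integral_has_vector_derivative_AE[OF g, of V] V by (metis less_imp_le)
  obtain N2 where N2: "negligible N2" "\<And>x. \<lbrakk>x \<in> {a<..<b}; x \<notin> N2\<rbrakk> \<Longrightarrow> (U has_vector_derivative W x) (at x)"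
    using indefinite_integral_has_vector_derivative_AE[OF W, of U] U by (metis less_imp_le)
  have "integral {a..b} h = integral {a..b} (\<lambda>x. g x * U x + V x * W x)"
  proof (rule integral_spike)
    show "negligible (N \<union> N1 \<union> N2 \<union> {a, b})" using N(1) N1(1) N2(1) by simp
    fix x assume "x \<in> {a..b} - (N \<union> N1 \<union> N2 \<union> {a, b})"
    then have x: "x \<in> {a<..<b}" "x \<notin> N" "x \<notin> N1" "x \<notin> N2" by auto
    show "g x * U x + V x * W x = h x"
      using vector_derivative_unique_at[OF N(2)[OF x(1,2)] has_vector_derivative_mult[OF N1(2)[OF x(1,3)] N2(2)[OF x(1,4)]]]
      by (simp add: add.commute)
  qed
  moreover have "(\<lambda>x. g x * U x) integrable_on {a..b}"
    using abs_int_subinterval(2)[OF abs_int_mult_continuous[OF g cont(2)]] by simp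
  moreover have "(\<lambda>x. V x * W x) integrable_on {a..b}"
    using abs_int_subinterval(2)[OF abs_int_mult_continuous[OF W cont(1)]] by (simp add: mult.commute)
  ultimately show ?thesis using N(3) by (simp add: integral_add)
qed

text \<open>Both integrals are integrated by parts; the integrals of \<open>V1 * V2\<close> cancel.\<close>

lemma Lagrange_identity:
  assumes ab: "a < b" and 1: "W21 a b U1 V1 g1" and 2: "W21 a b U2 V2 g2"
  shows "integral {a..b} (\<lambda>x. g1 x * U2 x) - integral {a..b} (\<lambda>x. g2 x * U1 x)
    = (V1 b * U2 b - U1 b * V2 b) - (V1 a * U2 a - U1 a * V2 a)"
proof -
  note g = W21_D(1)[OF 1] W21_D(1)[OF 2]
  have "integral {a..b} (\<lambda>x. g1 x * U2 x) + integral {a..b} (\<lambda>x. V1 x * V2 x) = V1 b * U2 b - V1 a * U2 a"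
    by (rule integration_by_parts_abs_int[OF ab g(1) absolutely_integrable_continuous_real[OF W21_continuous(2)[OF 2]] W21_increment(1)[OF 1] W21_increment(2)[OF 2]])
  moreover have "integral {a..b} (\<lambda>x. g2 x * U1 x) + integral {a..b} (\<lambda>x. V2 x * V1 x) = V2 b * U1 b - V2 a * U1 a"
    by (rule integration_by_parts_abs_int[OF ab g(2) absolutely_integrable_continuous_real[OF W21_continuous(2)[OF 1]] W21_increment(1)[OF 2] W21_increment(2)[OF 1]])
  moreover have "integral {a..b} (\<lambda>x. V2 x * V1 x) = integral {a..b} (\<lambda>x. V1 x * V2 x)"
    by (simp add: mult.commute)
  ultimately show ?thesis by (simp add: algebra_simps) algebra
qed

section \<open>The initial value problem\<close>

text \<open>The initial value problem is a fixed point problem for \<open>U\<close> alone. For the weighted function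
  \<open>w x = exp (- \<kappa> * (x - a)) * U x\<close> the double integral is a contraction with factor \<open>1/2\<close> in the
  supremum norm once \<open>\<kappa>\<close> is at least twice the \<open>L\<^sup>1\<close> norm of the potential \<open>k\<close>. The fixed point is
  then at most twice as large as the image of \<open>0\<close>, which bounds it by the data; that the constant does
  not depend on the data is what makes the resolvent compact.\<close>

lemma initial_value_problem:
  fixes k :: "real \<Rightarrow> complex"
  assumes ab: "a < b" and k: "k absolutely_integrable_on {a..b}"
  obtains C where "C \<ge> 0" "\<And>f u0 v0. f absolutely_integrable_on {a..b} \<Longrightarrow>
    \<exists>U V. U a = u0 \<and> V a = v0 \<and> W21 a b U V (\<lambda>x. k x * U x + f x) \<and>
      (\<forall>x\<in>{a..b}. norm (U x) \<le> C * (norm u0 + norm v0 + integral {a..b} (\<lambda>x. norm (f x))) \<and>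
                  norm (V x) \<le> C * (norm u0 + norm v0 + integral {a..b} (\<lambda>x. norm (f x))))"
proof -
  define K where "K = integral {a..b} (\<lambda>x. norm (k x))"
  have nkI: "(\<lambda>x. norm (k x)) integrable_on {a..b}" using abs_int_subinterval(3)[OF k] by simp
  have K0: "K \<ge> 0" unfolding K_def by (rule Henstock_Kurzweil_Integration.integral_nonneg[OF nkI]) auto
  define \<kappa> where "\<kappa> = 2 * K + 1"
  have \<kappa>: "\<kappa> > 0" "2 * K \<le> \<kappa>" using K0 by (auto simp: \<kappa>_def)
  define e where "e x = exp (\<kappa> * (x - a))" for x
  have e_pos: "e x > 0" for x by (simp add: e_def)
  have e_ge: "e x \<ge> 1" if "x \<ge> a" for x using that \<kappa> by (simp add: e_def)
  have e_mono: "e x \<le> e y" if "x \<le> y" for x y using that \<kappa> by (simp add: e_def)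
  have e_cont: "continuous_on S e" for S unfolding e_def by (intro continuous_intros)
  have e_int: "integral {a..x} e \<le> e x / \<kappa>" if "x \<ge> a" for x
  proof -
    have "(e has_integral (e x / \<kappa> - e a / \<kappa>)) {a..x}"
      by (rule fundamental_theorem_of_calculus[OF that])
        (use \<kappa> in \<open>auto simp: e_def[abs_def] has_real_derivative_iff_has_vector_derivative[symmetric] intro!: derivative_eq_intros\<close>)
    then show ?thesis using e_pos[of a] \<kappa> by (simp add: integral_unique)
  qed
  define C0 where "C0 = 2 * e b * (1 + (b - a))"
  define C where "C = C0 + 1 + K * C0"
  have C0: "C0 \<ge> 0" using e_pos[of b] ab by (simp add: C0_def)
  have C: "C0 \<le> C" "1 + K * C0 \<le> C" "C \<ge> 0" using C0 K0 by (auto simp: C_def)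
  have main: "\<exists>U V. U a = u0 \<and> V a = v0 \<and> W21 a b U V (\<lambda>x. k x * U x + f x) \<and>
      (\<forall>x\<in>{a..b}. norm (U x) \<le> C * (norm u0 + norm v0 + integral {a..b} (\<lambda>x. norm (f x))) \<and>
                  norm (V x) \<le> C * (norm u0 + norm v0 + integral {a..b} (\<lambda>x. norm (f x))))"
    if f: "f absolutely_integrable_on {a..b}" for f :: "real \<Rightarrow> complex" and u0 v0
  proof -
    define Nf where "Nf = integral {a..b} (\<lambda>x. norm (f x))"
    have nfI: "(\<lambda>x. norm (f x)) integrable_on {a..b}" using abs_int_subinterval(3)[OF f] by simp
    have Nf0: "Nf \<ge> 0" unfolding Nf_def by (rule Henstock_Kurzweil_Integration.integral_nonneg[OF nfI]) auto
    define N where "N = norm u0 + norm v0 + Nf"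
    define G where "G w x = k x * (of_real (e x) * w x) + f x" for w :: "real \<Rightarrow> complex" and x
    define J where "J w s = v0 + integral {a..s} (G w)" for w :: "real \<Rightarrow> complex" and s
    define T where "T w x = of_real (1 / e x) * (u0 + integral {a..x} (J w))" for w :: "real \<Rightarrow> complex" and x
    have G_abs: "G w absolutely_integrable_on {a..b}" if "continuous_on {a..b} w" for w
      unfolding G_def by (intro set_integral_add(1) abs_int_mult_continuous[OF k] continuous_intros that e_cont f)
    have J_cont: "continuous_on {a..b} (J w)" if "continuous_on {a..b} w" for w
      unfolding J_def by (intro continuous_intros indefinite_integral_continuous_1 abs_int_subinterval(2)[OF G_abs[OF that]]) auto
    have T_cont: "continuous_on {a..b} (T w)" if "continuous_on {a..b} w" for w
      unfolding T_def using e_pos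
      by (intro continuous_intros indefinite_integral_continuous_1 integrable_continuous_real J_cont[OF that] e_cont)
        (auto simp: less_imp_neq[symmetric])
    have "\<forall>W :: real \<Rightarrow>\<^sub>C complex. \<exists>Z :: real \<Rightarrow>\<^sub>C complex. \<forall>x. Z x = T W (clamp a b x)"
    proof
      fix W :: "real \<Rightarrow>\<^sub>C complex"
      have "continuous_on (cbox a b) (T W)" using T_cont[of W] by simp
      then show "\<exists>Z :: real \<Rightarrow>\<^sub>C complex. \<forall>x. Z x = T W (clamp a b x)"
        using continuous_on_cbox_bcontfunE by metis
    qed
    then obtain \<Phi> :: "(real \<Rightarrow>\<^sub>C complex) \<Rightarrow> (real \<Rightarrow>\<^sub>C complex)" where \<Phi>: "\<And>W x. \<Phi> W x = T W (clamp a b x)"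
      by metis
    have clamp_in: "clamp a b x \<in> {a..b}" for x :: real
      using clamp_in_interval[of a b x] ab by simp
    have J_diff: "norm (J w s - J z s) \<le> K * (e s * d)"
      if s: "s \<in> {a..b}" and w: "continuous_on {a..b} w" and z: "continuous_on {a..b} z"
        and d: "\<And>x. norm (w x - z x) \<le> d" for w z s d
    proof -
      have d0: "d \<ge> 0" using order_trans[OF norm_ge_zero d] .
      have Gw: "G w integrable_on {a..s}" "G z integrable_on {a..s}"
        using abs_int_subinterval(2)[OF G_abs[OF w]] abs_int_subinterval(2)[OF G_abs[OF z]] s by auto
      have nk: "(\<lambda>x. norm (k x)) integrable_on {a..s}" using abs_int_subinterval(3)[OF k] s by auto
      have "J w s - J z s = integral {a..s} (\<lambda>x. G w x - G z x)"
        unfolding J_def using Gw by (simp add: integral_diff)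
      then have "norm (J w s - J z s) = norm (integral {a..s} (\<lambda>x. G w x - G z x))" by simp
      also have "\<dots> \<le> integral {a..s} (\<lambda>x. norm (k x) * (e s * d))"
      proof (rule Henstock_Kurzweil_Integration.integral_norm_bound_integral)
        show "(\<lambda>x. G w x - G z x) integrable_on {a..s}" by (intro integrable_diff Gw)
        show "(\<lambda>x. norm (k x) * (e s * d)) integrable_on {a..s}" using nk by (rule integrable_on_mult_left)
        fix x assume x: "x \<in> {a..s}"
        have "G w x - G z x = k x * (of_real (e x) * (w x - z x))" by (simp add: G_def algebra_simps)
        then have "norm (G w x - G z x) = norm (k x) * (e x * norm (w x - z x))"
          using e_pos[of x] by (simp add: norm_mult)
        also have "\<dots> \<le> norm (k x) * (e s * d)"
          using e_mono[of x s] x d e_pos[of s] by (intro mult_left_mono mult_mono) auto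
        finally show "norm (G w x - G z x) \<le> norm (k x) * (e s * d)" .
      qed
      also have "\<dots> = integral {a..s} (\<lambda>x. norm (k x)) * (e s * d)" by simp
      also have "\<dots> \<le> K * (e s * d)"
      proof (rule mult_right_mono)
        show "integral {a..s} (\<lambda>x. norm (k x)) \<le> K" unfolding K_def
          by (rule integral_subset_le) (use s nk nkI in auto)
      qed (use e_pos[of s] d0 in simp)
      finally show ?thesis .
    qed
    have T_diff: "norm (T w x - T z x) \<le> d / 2"
      if x: "x \<in> {a..b}" and w: "continuous_on {a..b} w" and z: "continuous_on {a..b} z"
        and d: "\<And>x. norm (w x - z x) \<le> d" for w z x d
    proof -
      have d0: "d \<ge> 0" using order_trans[OF norm_ge_zero d] .
      have JI: "J w integrable_on {a..x}" "J z integrable_on {a..x}"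
        using x by (auto intro!: integrable_continuous_real continuous_on_subset[OF J_cont[OF w]] continuous_on_subset[OF J_cont[OF z]])
      have eI: "e integrable_on {a..x}" by (intro integrable_continuous_real e_cont)
      have "norm (integral {a..x} (\<lambda>s. J w s - J z s)) \<le> integral {a..x} (\<lambda>s. K * d * e s)"
      proof (rule Henstock_Kurzweil_Integration.integral_norm_bound_integral)
        show "(\<lambda>s. J w s - J z s) integrable_on {a..x}" by (intro integrable_diff JI)
        show "(\<lambda>s. K * d * e s) integrable_on {a..x}" using eI by (rule integrable_on_mult_right)
        show "norm (J w s - J z s) \<le> K * d * e s" if "s \<in> {a..x}" for s
          using J_diff[OF _ w z d, of s] that x by (simp add: mult_ac)
      qed
      also have "\<dots> = K * d * integral {a..x} e" by simp
      also have "\<dots> \<le> K * d * (e x / \<kappa>)" using e_int[of x] x K0 d0 by (intro mult_left_mono) auto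
      also have "\<dots> = (K / \<kappa>) * (d * e x)" by simp
      also have "\<dots> \<le> (1 / 2) * (d * e x)"
        using \<kappa> d0 e_pos[of x] by (intro mult_right_mono) (auto simp: field_simps)
      finally have le: "norm (integral {a..x} (\<lambda>s. J w s - J z s)) \<le> (1 / 2) * (d * e x)" .
      have "T w x - T z x = of_real (1 / e x) * integral {a..x} (\<lambda>s. J w s - J z s)"
        unfolding T_def using JI by (simp add: integral_diff algebra_simps)
      then have "norm (T w x - T z x) = norm (integral {a..x} (\<lambda>s. J w s - J z s)) / e x"
        using e_pos[of x] by (simp add: norm_mult norm_divide)
      also have "\<dots> \<le> d / 2" using le e_pos[of x] by (simp add: field_simps)
      finally show ?thesis .
    qed
    have contr: "dist (\<Phi> W) (\<Phi> Z) \<le> 1 / 2 * dist W Z" for W Z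
    proof (rule dist_bound)
      fix x
      have "norm (W y - Z y) \<le> dist W Z" for y using dist_bounded[of W y Z] by (simp add: dist_norm)
      then have "norm (T W (clamp a b x) - T Z (clamp a b x)) \<le> dist W Z / 2"
        by (intro T_diff clamp_in continuous_on_apply_bcontfun)
      then show "dist (\<Phi> W x) (\<Phi> Z x) \<le> 1 / 2 * dist W Z" by (simp add: \<Phi> dist_norm)
    qed
    then obtain W where W: "\<Phi> W = W"
      using banach_fix_type[of "1/2" \<Phi>] by auto
    define M where "M = (1 + (b - a)) * N"
    have N0: "N \<ge> 0" using Nf0 by (simp add: N_def)
    have T0: "norm (T (\<lambda>_. 0) x) \<le> M" if x: "x \<in> {a..b}" for x
    proof -
      have fI: "f integrable_on {a..s}" "(\<lambda>x. norm (f x)) integrable_on {a..s}" if "s \<in> {a..b}" for s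
        using abs_int_subinterval(2,3)[OF f] that by auto
      have J0: "norm (J (\<lambda>_. 0) s) \<le> N" if s: "s \<in> {a..b}" for s
      proof -
        have "norm (integral {a..s} f) \<le> integral {a..s} (\<lambda>x. norm (f x))"
          by (rule Henstock_Kurzweil_Integration.integral_norm_bound_integral) (use fI[OF s] in auto)
        also have "\<dots> \<le> Nf" unfolding Nf_def by (rule integral_subset_le) (use s fI[OF s] nfI in auto)
        finally have "norm (v0 + integral {a..s} f) \<le> norm v0 + Nf" using norm_triangle_ineq[of v0 "integral {a..s} f"] by linarith
        moreover have "G (\<lambda>_. 0) = f" by (simp add: G_def fun_eq_iff)
        ultimately have "norm (J (\<lambda>_. 0) s) \<le> norm v0 + Nf" by (simp add: J_def)
        also have "\<dots> \<le> N" by (simp add: N_def)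
        finally show ?thesis .
      qed
      have "norm (integral {a..x} (J (\<lambda>_. 0))) \<le> integral {a..x} (\<lambda>_. N)"
        by (rule Henstock_Kurzweil_Integration.integral_norm_bound_integral)
          (use x J0 in \<open>auto intro!: integrable_continuous_real continuous_on_subset[OF J_cont]\<close>)
      also have "\<dots> = (x - a) * N" using x by (simp add: mult.commute)
      also have "\<dots> \<le> (b - a) * N" using x N0 by (intro mult_right_mono) auto
      finally have le: "norm (u0 + integral {a..x} (J (\<lambda>_. 0))) \<le> norm u0 + (b - a) * N"
        using norm_triangle_ineq[of u0 "integral {a..x} (J (\<lambda>_. 0))"] by linarith
      also have "\<dots> \<le> M" using Nf0 by (simp add: M_def N_def algebra_simps)
      finally have le: "norm (u0 + integral {a..x} (J (\<lambda>_. 0))) \<le> M" .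
      have "norm (T (\<lambda>_. 0) x) = norm (u0 + integral {a..x} (J (\<lambda>_. 0))) / e x"
        using e_pos[of x] unfolding T_def by (simp add: norm_mult norm_divide)
      also have "\<dots> \<le> norm (u0 + integral {a..x} (J (\<lambda>_. 0)))"
        using e_ge[of x] x by (intro divide_le_eq[THEN iffD2]) (auto simp: mult_le_cancel_left1)
      finally show ?thesis using le by simp
    qed
    have W_bound: "norm (W x) \<le> 2 * M" for x
    proof -
      define Z where "Z = (const_bcontfun 0 :: real \<Rightarrow>\<^sub>C complex)"
      have Z: "apply_bcontfun Z = (\<lambda>_. 0)" by (simp add: Z_def const_bcontfun.rep_eq fun_eq_iff)
      have "dist (\<Phi> Z) Z \<le> M"
        by (rule dist_bound) (use T0[OF clamp_in] in \<open>simp add: \<Phi> Z\<close>)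
      then have "dist W Z \<le> 1 / 2 * dist W Z + M"
        using contr[of W Z] dist_triangle[of W Z "\<Phi> Z"] W by simp
      then have "dist W Z \<le> 2 * M" by simp
      then show ?thesis using dist_bounded[of W x Z] by (simp add: Z)
    qed
    have fix_x: "W x = T W x" if "x \<in> {a..b}" for x
      using \<Phi>[of W x] W clamp_cancel_cbox[of x a b] that by simp
    define U where "U x = of_real (e x) * W x" for x
    define V where "V = J W"
    have U_eq: "U x = u0 + integral {a..x} V" if "x \<in> {a..b}" for x
      using fix_x[OF that] e_pos[of x] by (simp add: U_def T_def V_def)
    have GU: "G W = (\<lambda>x. k x * U x + f x)" by (simp add: G_def U_def fun_eq_iff)
    have Wc: "continuous_on {a..b} W" by simp
    have Ua: "U a = u0" using U_eq[of a] ab by simp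
    have Va: "V a = v0" by (simp add: V_def J_def)
    have U_bound: "norm (U x) \<le> C0 * N" if x: "x \<in> {a..b}" for x
    proof -
      have "norm (U x) = e x * norm (W x)" using e_pos[of x] by (simp add: U_def norm_mult)
      also have "\<dots> \<le> e b * (2 * M)" using e_mono[of x b] W_bound[of x] x e_pos[of b] by (intro mult_mono) auto
      finally show ?thesis by (simp add: C0_def M_def mult_ac)
    qed
    have V_bound: "norm (V x) \<le> C * N" if x: "x \<in> {a..b}" for x
    proof -
      have nkx: "(\<lambda>x. norm (k x)) integrable_on {a..x}" "(\<lambda>x. norm (f x)) integrable_on {a..x}"
        using abs_int_subinterval(3)[OF k] abs_int_subinterval(3)[OF f] x by auto
      have "norm (integral {a..x} (G W)) \<le> integral {a..x} (\<lambda>x. norm (k x) * (C0 * N) + norm (f x))"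
      proof (rule Henstock_Kurzweil_Integration.integral_norm_bound_integral)
        show "G W integrable_on {a..x}" using abs_int_subinterval(2)[OF G_abs[OF Wc]] x by auto
        show "(\<lambda>x. norm (k x) * (C0 * N) + norm (f x)) integrable_on {a..x}"
          by (intro integrable_add integrable_on_mult_left nkx)
        fix t assume t: "t \<in> {a..x}"
        have "norm (G W t) \<le> norm (k t) * norm (U t) + norm (f t)"
          unfolding GU by (metis norm_triangle_ineq norm_mult)
        also have "\<dots> \<le> norm (k t) * (C0 * N) + norm (f t)"
          using U_bound[of t] t x by (intro add_right_mono mult_left_mono) auto
        finally show "norm (G W t) \<le> norm (k t) * (C0 * N) + norm (f t)" .
      qed
      also have "\<dots> = integral {a..x} (\<lambda>x. norm (k x)) * (C0 * N) + integral {a..x} (\<lambda>x. norm (f x))"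
        using nkx by (subst integral_add) (auto intro: integrable_on_mult_left)
      also have "\<dots> \<le> K * (C0 * N) + Nf"
      proof (intro add_mono mult_right_mono)
        show "integral {a..x} (\<lambda>x. norm (k x)) \<le> K" unfolding K_def by (rule integral_subset_le) (use x nkx nkI in auto)
        show "integral {a..x} (\<lambda>x. norm (f x)) \<le> Nf" unfolding Nf_def by (rule integral_subset_le) (use x nkx nfI in auto)
      qed (use C0 N0 in simp)
      finally have "norm (V x) \<le> norm v0 + (K * (C0 * N) + Nf)"
        unfolding V_def J_def using norm_triangle_ineq[of v0 "integral {a..x} (G W)"] by linarith
      also have "\<dots> \<le> (1 + K * C0) * N" by (simp add: N_def algebra_simps)
      also have "\<dots> \<le> C * N" using C(2) N0 by (rule mult_right_mono)
      finally show ?thesis .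
    qed
    show ?thesis
    proof (rule exI[of _ U], rule exI[of _ V], intro conjI ballI)
      show "W21 a b U V (\<lambda>x. k x * U x + f x)"
        unfolding W21_def GU[symmetric]
      proof (intro conjI ballI)
        show "G W absolutely_integrable_on {a..b}" by (rule G_abs[OF Wc])
        show "V x = V a + integral {a..x} (G W)" for x unfolding Va by (simp add: V_def J_def)
        show "U x = U a + integral {a..x} V" if "x \<in> {a..b}" for x unfolding Ua by (rule U_eq[OF that])
      qed
      fix x assume x: "x \<in> {a..b}"
      show "norm (U x) \<le> C * (norm u0 + norm v0 + integral {a..b} (\<lambda>x. norm (f x)))"
        using order_trans[OF U_bound[OF x] mult_right_mono[OF C(1) N0]] by (simp add: N_def Nf_def)
      show "norm (V x) \<le> C * (norm u0 + norm v0 + integral {a..b} (\<lambda>x. norm (f x)))"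
        using V_bound[OF x] by (simp add: N_def Nf_def)
    qed (rule Ua Va)+
  qed
  show thesis by (rule that[OF C(3)]) (rule main)
qed

section \<open>Completeness of the space of square integrable functions\<close>

definition square_integrable :: "'a measure \<Rightarrow> ('a \<Rightarrow> complex) \<Rightarrow> bool" where
  "square_integrable M f \<longleftrightarrow> f \<in> borel_measurable M \<and> integrable M (\<lambda>x. (norm (f x))\<^sup>2)"

lemma square_integrable_mult:
  assumes f: "square_integrable M f" and g: "square_integrable M g"
  shows "integrable M (\<lambda>x. f x * cnj (g x))"
proof (rule Bochner_Integration.integrable_bound)
  show "integrable M (\<lambda>x. (norm (f x))\<^sup>2 + (norm (g x))\<^sup>2)"
    using assms by (auto simp: square_integrable_def)
  have [measurable]: "f \<in> borel_measurable M" "g \<in> borel_measurable M"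
    using assms by (auto simp: square_integrable_def)
  have "(\<lambda>x. cnj (g x)) \<in> borel_measurable M"
    by (rule borel_measurable_continuous_on[OF continuous_on_cnj]) (auto intro: continuous_on_id)
  then show "(\<lambda>x. f x * cnj (g x)) \<in> borel_measurable M" by measurable
  show "AE x in M. norm (f x * cnj (g x)) \<le> norm ((norm (f x))\<^sup>2 + (norm (g x))\<^sup>2)"
  proof (rule AE_I2)
    fix x
    have "2 * (norm (f x) * norm (g x)) \<le> (norm (f x))\<^sup>2 + (norm (g x))\<^sup>2"
      using sum_squares_bound[of "norm (f x)" "norm (g x)"] by (simp add: mult.assoc)
    moreover have "0 \<le> norm (f x) * norm (g x)" by simp
    ultimately have "norm (f x) * norm (g x) \<le> (norm (f x))\<^sup>2 + (norm (g x))\<^sup>2" by linarith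
    then show "norm (f x * cnj (g x)) \<le> norm ((norm (f x))\<^sup>2 + (norm (g x))\<^sup>2)"
      by (simp add: norm_mult)
  qed
qed

lemma square_integrable_scale:
  assumes "square_integrable M f" shows "square_integrable M (\<lambda>x. c * f x)"
  using assms by (auto simp: square_integrable_def norm_mult power_mult_distrib)

lemma square_integrable_add:
  assumes f: "square_integrable M f" and g: "square_integrable M g"
  shows "square_integrable M (\<lambda>x. f x + g x)"
  unfolding square_integrable_def
proof
  have [measurable]: "f \<in> borel_measurable M" "g \<in> borel_measurable M"
    using assms by (auto simp: square_integrable_def)
  show "(\<lambda>x. f x + g x) \<in> borel_measurable M" by measurable
  show "integrable M (\<lambda>x. (norm (f x + g x))\<^sup>2)"
  proof (rule Bochner_Integration.integrable_bound)
    show "integrable M (\<lambda>x. 2 * (norm (f x))\<^sup>2 + 2 * (norm (g x))\<^sup>2)"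
      using assms by (auto simp: square_integrable_def)
    show "AE x in M. norm ((norm (f x + g x))\<^sup>2) \<le> norm (2 * (norm (f x))\<^sup>2 + 2 * (norm (g x))\<^sup>2)"
    proof (rule AE_I2)
      fix x
      have "(norm (f x + g x))\<^sup>2 \<le> (norm (f x) + norm (g x))\<^sup>2"
        by (intro power_mono norm_triangle_ineq) simp
      also have "\<dots> \<le> 2 * (norm (f x))\<^sup>2 + 2 * (norm (g x))\<^sup>2"
        using sum_squares_bound[of "norm (f x)" "norm (g x)"] by (simp add: power2_sum)
      finally show "norm ((norm (f x + g x))\<^sup>2) \<le> norm (2 * (norm (f x))\<^sup>2 + 2 * (norm (g x))\<^sup>2)" by simp
    qed
  qed measurable
qed

lemma square_integrable_diff:
  assumes "square_integrable M f" "square_integrable M g"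
  shows "square_integrable M (\<lambda>x. f x - g x)"
  using square_integrable_add[OF assms(1) square_integrable_scale[OF assms(2), of "-1"]] by simp

lemma (in finite_measure) square_integrable_integrable:
  assumes "square_integrable M f" shows "integrable M f"
proof -
  have "square_integrable M (\<lambda>_. 1)" by (simp add: square_integrable_def)
  from square_integrable_mult[OF assms this] show ?thesis by simp
qed

text \<open>Over a finite measure a Cauchy sequence is Cauchy in \<open>L\<^sup>1\<close> too, hence a subsequence converges almost
  everywhere. Fatou's lemma shows that its pointwise limit is the limit in \<open>L\<^sup>2\<close>.\<close>

lemma (in finite_measure) square_integrable_complete:
  fixes f :: "nat \<Rightarrow> 'a \<Rightarrow> complex"
  assumes f: "\<And>n. square_integrable M (f n)"
    and cauchy: "\<And>e. e > 0 \<Longrightarrow> \<exists>N. \<forall>m\<ge>N. \<forall>n\<ge>N. (\<integral>x. (norm (f m x - f n x))\<^sup>2 \<partial>M) < e"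
  obtains g where "square_integrable M g" "(\<lambda>n. \<integral>x. (norm (f n x - g x))\<^sup>2 \<partial>M) \<longlonglongrightarrow> 0"
proof -
  have [measurable]: "f n \<in> borel_measurable M" for n using f by (auto simp: square_integrable_def)
  have sq: "integrable M (\<lambda>x. (norm (f m x - f n x))\<^sup>2)" for m n
    using square_integrable_diff[OF f f] by (auto simp: square_integrable_def)
  obtain r :: "nat \<Rightarrow> nat" where r: "strict_mono r" and ae: "AE x in M. Cauchy (\<lambda>i. f (r i) x)"
  proof (rule cauchy_L1_AE_cauchy_subseq[of M f])
    show "integrable M (f n)" for n by (rule square_integrable_integrable[OF f])
    fix e :: real assume e: "e > 0"
    define \<eta> where "\<eta> = e / (measure M (space M) + 1)"
    have \<eta>: "\<eta> > 0" using e measure_nonneg[of M "space M"] by (simp add: \<eta>_def add_nonneg_pos)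
    obtain N where N: "\<And>m n. m \<ge> N \<Longrightarrow> n \<ge> N \<Longrightarrow> (\<integral>x. (norm (f m x - f n x))\<^sup>2 \<partial>M) < \<eta>\<^sup>2"
      using cauchy[of "\<eta>\<^sup>2"] \<eta> by auto
    have "(\<integral>x. norm (f m x - f n x) \<partial>M) < e" if "m \<ge> N" "n \<ge> N" for m n
    proof -
      \<comment> \<open>The inequality between arithmetic and geometric mean; its right-hand side integrates to less than \<open>e\<close>.\<close>
      have pt: "norm (f m x - f n x) \<le> (1 / (2 * \<eta>)) * (norm (f m x - f n x))\<^sup>2 + \<eta> / 2" for x
      proof -
        have "2 * norm (f m x - f n x) * \<eta> \<le> (norm (f m x - f n x))\<^sup>2 + \<eta>\<^sup>2"
          by (rule sum_squares_bound)
        then show ?thesis using \<eta> by (simp add: field_simps power2_eq_square)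
      qed
      have "(\<integral>x. norm (f m x - f n x) \<partial>M) \<le> (\<integral>x. (1 / (2 * \<eta>)) * (norm (f m x - f n x))\<^sup>2 + \<eta> / 2 \<partial>M)"
        by (rule integral_mono) (use sq pt square_integrable_integrable[OF f] in \<open>auto intro!: integrable_norm Bochner_Integration.integrable_diff\<close>)
      also have "\<dots> = (1 / (2 * \<eta>)) * (\<integral>x. (norm (f m x - f n x))\<^sup>2 \<partial>M) + (\<eta> / 2) * measure M (space M)"
        using sq by (simp add: mult.commute)
      also have "(1 / (2 * \<eta>)) * (\<integral>x. (norm (f m x - f n x))\<^sup>2 \<partial>M) < (1 / (2 * \<eta>)) * \<eta>\<^sup>2"
        using N[OF that] \<eta> by (intro mult_strict_left_mono) auto
      also have "(1 / (2 * \<eta>)) * \<eta>\<^sup>2 + (\<eta> / 2) * measure M (space M) = \<eta> * (measure M (space M) + 1) / 2"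
        using \<eta> by (simp add: field_simps power2_eq_square)
      also have "\<dots> = e / 2"
      proof -
        have "measure M (space M) + 1 \<noteq> 0" using measure_nonneg[of M "space M"] by linarith
        then show ?thesis by (simp add: \<eta>_def)
      qed
      finally show ?thesis using e by simp
    qed
    then show "\<exists>N. \<forall>m\<ge>N. \<forall>n\<ge>N. (\<integral>x. norm (f m x - f n x) \<partial>M) < e" by blast
  qed
  define g where "g x = lim (\<lambda>i. f (r i) x)" for x
  have g_meas [measurable]: "g \<in> borel_measurable M" unfolding g_def by measurable
  have lim: "AE x in M. (\<lambda>i. f (r i) x) \<longlonglongrightarrow> g x"
    using ae by eventually_elim (simp add: g_def Cauchy_convergent_iff convergent_LIMSEQ_iff)
  have nn: "(\<integral>\<^sup>+x. ennreal ((norm (f m x - f n x))\<^sup>2) \<partial>M) = ennreal (\<integral>x. (norm (f m x - f n x))\<^sup>2 \<partial>M)" for m n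
    by (rule nn_integral_eq_integral[OF sq]) simp
  have fatou: "(\<integral>\<^sup>+x. ennreal ((norm (f m x - g x))\<^sup>2) \<partial>M) \<le> ennreal e"
    if N: "\<And>m n. m \<ge> N \<Longrightarrow> n \<ge> N \<Longrightarrow> (\<integral>x. (norm (f m x - f n x))\<^sup>2 \<partial>M) < e" and m: "m \<ge> N" for N m e
  proof -
    have "(\<integral>\<^sup>+x. ennreal ((norm (f m x - g x))\<^sup>2) \<partial>M) = (\<integral>\<^sup>+x. liminf (\<lambda>i. ennreal ((norm (f m x - f (r i) x))\<^sup>2)) \<partial>M)"
    proof (rule nn_integral_cong_AE)
      show "AE x in M. ennreal ((norm (f m x - g x))\<^sup>2) = liminf (\<lambda>i. ennreal ((norm (f m x - f (r i) x))\<^sup>2))"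
        using lim
      proof eventually_elim
        case (elim x)
        have "(\<lambda>i. ennreal ((norm (f m x - f (r i) x))\<^sup>2)) \<longlonglongrightarrow> ennreal ((norm (f m x - g x))\<^sup>2)"
          by (intro tendsto_ennrealI tendsto_power tendsto_norm tendsto_diff tendsto_const elim)
        then show ?case by (intro lim_imp_Liminf[symmetric]) auto
      qed
    qed
    also have "\<dots> \<le> liminf (\<lambda>i. \<integral>\<^sup>+x. ennreal ((norm (f m x - f (r i) x))\<^sup>2) \<partial>M)"
      by (rule nn_integral_liminf) measurable
    also have "\<dots> \<le> ennreal e"
    proof (rule Liminf_le)
      show "\<forall>\<^sub>F i in sequentially. (\<integral>\<^sup>+x. ennreal ((norm (f m x - f (r i) x))\<^sup>2) \<partial>M) \<le> ennreal e"
      proof (rule eventually_sequentiallyI[of N])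
        fix i assume "i \<ge> N"
        then have "r i \<ge> N" using strict_mono_imp_increasing[OF r, of i] by simp
        then show "(\<integral>\<^sup>+x. ennreal ((norm (f m x - f (r i) x))\<^sup>2) \<partial>M) \<le> ennreal e"
          unfolding nn using N[OF m] by (intro ennreal_leI) (auto intro: less_imp_le)
      qed
    qed simp
    finally show ?thesis .
  qed
  have diff: "square_integrable M (\<lambda>x. f m x - g x)"
    if N: "\<And>m n. m \<ge> N \<Longrightarrow> n \<ge> N \<Longrightarrow> (\<integral>x. (norm (f m x - f n x))\<^sup>2 \<partial>M) < e" and m: "m \<ge> N" for N m e
    unfolding square_integrable_def
  proof
    show "integrable M (\<lambda>x. (norm (f m x - g x))\<^sup>2)"
    proof (rule integrableI_bounded)
      have "(\<integral>\<^sup>+ x. ennreal (norm ((norm (f m x - g x))\<^sup>2)) \<partial>M) \<le> ennreal e" using fatou[OF that] by simp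
      then show "(\<integral>\<^sup>+ x. ennreal (norm ((norm (f m x - g x))\<^sup>2)) \<partial>M) < \<infinity>"
        using le_less_trans ennreal_less_top by fastforce
    qed measurable
  qed measurable
  obtain N1 where N1: "\<And>m n. m \<ge> N1 \<Longrightarrow> n \<ge> N1 \<Longrightarrow> (\<integral>x. (norm (f m x - f n x))\<^sup>2 \<partial>M) < 1"
    using cauchy[of 1] by auto
  have g: "square_integrable M g"
    using square_integrable_diff[OF f[of N1] diff[where N = N1 and e = 1 and m = N1, OF N1 order_refl]] by simp
  have "(\<lambda>n. \<integral>x. (norm (f n x - g x))\<^sup>2 \<partial>M) \<longlonglongrightarrow> 0"
    unfolding LIMSEQ_def
  proof (intro allI impI)
    fix e :: real assume e: "e > 0"
    obtain N where N: "\<And>m n. m \<ge> N \<Longrightarrow> n \<ge> N \<Longrightarrow> (\<integral>x. (norm (f m x - f n x))\<^sup>2 \<partial>M) < e / 2"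
      using cauchy[of "e / 2"] e by auto
    have "dist (\<integral>x. (norm (f n x - g x))\<^sup>2 \<partial>M) 0 < e" if n: "n \<ge> N" for n
    proof -
      have "ennreal (\<integral>x. (norm (f n x - g x))\<^sup>2 \<partial>M) = (\<integral>\<^sup>+x. ennreal ((norm (f n x - g x))\<^sup>2) \<partial>M)"
        using diff[OF N n] by (intro nn_integral_eq_integral[symmetric]) (auto simp: square_integrable_def)
      also have "\<dots> \<le> ennreal (e / 2)" by (rule fatou[OF N n])
      finally have "(\<integral>x. (norm (f n x - g x))\<^sup>2 \<partial>M) \<le> e / 2"
        using e by (simp add: ennreal_le_iff)
      then show ?thesis using e by (simp add: dist_real_def)
    qed
    then show "\<exists>no. \<forall>n\<ge>no. dist (\<integral>x. (norm (f n x - g x))\<^sup>2 \<partial>M) 0 < e" by blast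
  qed
  then show thesis using that g by blast
qed

section \<open>The Hilbert space of the problem\<close>

lemma sum_lessThan_4: "(\<Sum>i<4. f i) = f 0 + f 1 + f 2 + f (3::nat)" for f :: "nat \<Rightarrow> 'a::comm_monoid_add"
  by (simp add: eval_nat_numeral add.assoc)

lemma sum_fun_apply: "(\<Sum>i\<in>A. f i) x = (\<Sum>i\<in>A. f i x)" for f :: "'i \<Rightarrow> 'a \<Rightarrow> 'b::comm_monoid_add"
  by (induction A rule: infinite_finite_induct) auto

lemma less_4_cases: "i < (4::nat) \<Longrightarrow> i = 0 \<or> i = 1 \<or> i = 2 \<or> i = 3"
  by auto

text \<open>Indexed data turn the four integrals of the inner product and the three transmission conditions into
  families: piece \<open>i\<close> lies between the knots \<open>i\<close> and \<open>Suc i\<close>.\<close>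

definition knot :: "sl_data \<Rightarrow> nat \<Rightarrow> real" where
  "knot D i = [-1, sl_h1 D, sl_h2 D, sl_h3 D, 1] ! i"

definition leading :: "sl_data \<Rightarrow> nat \<Rightarrow> real" where
  "leading D i = [(sl_p1 D)\<^sup>2, (sl_p2 D)\<^sup>2, (sl_p3 D)\<^sup>2, (sl_p4 D)\<^sup>2] ! i"

text \<open>The product of the determinants of the transmission matrices at the knots up to the \<open>i\<close>-th.\<close>

definition det_prod :: "sl_data \<Rightarrow> nat \<Rightarrow> real" where
  "det_prod D i = [1, sl_theta D, sl_theta D * sl_gamma D, sl_theta D * sl_gamma D * sl_xi D] ! i"

definition weight :: "sl_data \<Rightarrow> nat \<Rightarrow> real" where
  "weight D i = 1 / (leading D i * det_prod D i)"

definition piece :: "sl_data \<Rightarrow> nat \<Rightarrow> real set" where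
  "piece D i = {knot D i<..<knot D (Suc i)}"

definition end_weight :: "sl_data \<Rightarrow> real" where
  "end_weight D = 1 / (sl_rho D * sl_theta D * sl_gamma D * sl_xi D)"

locale sl_problem =
  fixes D :: sl_data
  assumes valid: "sl_valid D"
begin

lemma knots_ordered: "-1 < sl_h1 D" "sl_h1 D < sl_h2 D" "sl_h2 D < sl_h3 D" "sl_h3 D < 1"
  using valid by (auto simp: sl_valid_def)

lemma knot_less: "i < 4 \<Longrightarrow> knot D i < knot D (Suc i)"
  using knots_ordered by (drule_tac less_4_cases, elim disjE) (simp_all add: knot_def eval_nat_numeral)

lemma knot_bounds: "i < 4 \<Longrightarrow> -1 \<le> knot D i \<and> knot D (Suc i) \<le> 1"
  using knots_ordered by (drule_tac less_4_cases, elim disjE) (simp_all add: knot_def eval_nat_numeral)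

lemma leading_pos: "i < 4 \<Longrightarrow> leading D i > 0"
proof -
  have "(sl_p1 D)\<^sup>2 > 0" "(sl_p2 D)\<^sup>2 > 0" "(sl_p3 D)\<^sup>2 > 0" "(sl_p4 D)\<^sup>2 > 0"
    using valid by (simp_all add: sl_valid_def)
  then show "i < 4 \<Longrightarrow> leading D i > 0"
    by (drule_tac less_4_cases, elim disjE) (simp_all add: leading_def eval_nat_numeral)
qed

lemma det_prod_pos: "i < 4 \<Longrightarrow> det_prod D i > 0"
  using valid by (drule_tac less_4_cases, elim disjE) (simp_all add: det_prod_def sl_valid_def eval_nat_numeral)

lemma weight_pos: "i < 4 \<Longrightarrow> weight D i > 0"
  using leading_pos det_prod_pos by (simp add: weight_def)

lemma end_weight_pos: "end_weight D > 0"
  using valid by (simp add: end_weight_def sl_valid_def)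

lemma piece_lebesgue [simp]: "piece D i \<in> sets lebesgue"
  by (simp add: piece_def)

lemma sl_I_lebesgue [simp]: "sl_I D \<in> sets lebesgue"
  by (simp add: sl_I_def)

lemma piece_simps: "piece D 0 = {-1<..<sl_h1 D}" "piece D 1 = {sl_h1 D<..<sl_h2 D}"
  "piece D 2 = {sl_h2 D<..<sl_h3 D}" "piece D 3 = {sl_h3 D<..<1}"
  by (simp_all add: piece_def knot_def eval_nat_numeral)

lemma piece_disjoint: "\<lbrakk>x \<in> piece D i; x \<in> piece D j; i < 4; j < 4\<rbrakk> \<Longrightarrow> i = j"
  using knots_ordered
  by (drule_tac less_4_cases, drule_tac less_4_cases, elim disjE) (simp_all add: piece_def knot_def eval_nat_numeral)

lemma piece_sl_I: "i < 4 \<Longrightarrow> piece D i \<subseteq> sl_I D"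
  using knots_ordered
  by (drule_tac less_4_cases, elim disjE) (simp_all add: piece_def knot_def sl_I_def eval_nat_numeral, auto)

lemma not_in_piece: "i < 4 \<Longrightarrow> -1 \<notin> piece D i \<and> 1 \<notin> piece D i"
  using knot_bounds[of i] by (auto simp: piece_def)

lemma sl_I_cases:
  assumes "x \<in> sl_I D" "x \<noteq> -1" "x \<noteq> 1"
  obtains i where "i < 4" "x \<in> piece D i"
proof -
  have "x \<in> piece D 0 \<or> x \<in> piece D 1 \<or> x \<in> piece D 2 \<or> x \<in> piece D 3"
    unfolding piece_simps using assms by (auto simp: sl_I_def)
  then show thesis using that[of 0] that[of 1] that[of 2] that[of 3] by auto
qed

text \<open>The pieces miss the points \<open>-1\<close> and \<open>1\<close> of \<open>sl_I D\<close>, hence the last summand.\<close>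

lemma sl_I_indicator:
  "indicator (sl_I D) x *\<^sub>R f x = (\<Sum>i<4. indicator (piece D i) x *\<^sub>R f x) + indicator {-1, 1} x *\<^sub>R f x"
  for f :: "real \<Rightarrow> 'b::real_vector"
proof (cases "x = -1 \<or> x = 1")
  case True
  then have "x \<in> sl_I D" using knots_ordered by (auto simp: sl_I_def)
  moreover have "(\<Sum>i<4. indicator (piece D i) x *\<^sub>R f x) = 0"
    by (intro sum.neutral ballI) (use True not_in_piece in \<open>auto simp: indicator_def\<close>)
  ultimately show ?thesis using True by (simp add: indicator_def)
next
  case ends: False
  show ?thesis
  proof (cases "x \<in> sl_I D")
    case True
    then obtain i where i: "i < 4" "x \<in> piece D i" using sl_I_cases ends by blast
    have "indicator (piece D j) x *\<^sub>R f x = (if j = i then f x else 0)" if "j < 4" for j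
      using piece_disjoint[OF i(2) _ i(1) that] i(2) by (cases "x \<in> piece D j") auto
    then have "(\<Sum>j<4. indicator (piece D j) x *\<^sub>R f x) = (\<Sum>j<4. if j = i then f x else 0)"
      by (intro sum.cong refl) simp
    then show ?thesis using i True ends by (simp add: indicator_def)
  next
    case False
    then have "x \<notin> piece D i" if "i < 4" for i using piece_sl_I[OF that] by blast
    then have "(\<Sum>i<4. indicator (piece D i) x *\<^sub>R f x) = 0"
      by (intro sum.neutral ballI) simp
    then show ?thesis using False ends by (simp add: indicator_def)
  qed
qed

lemma AE_not_end: "AE x::real in lebesgue. x \<noteq> -1 \<and> x \<noteq> 1"
proof (rule AE_I')
  show "{-1, 1::real} \<in> null_sets lebesgue" by (simp flip: negligible_iff_null_sets)
qed auto

lemma AE_sl_I_iff: "(AE x in lebesgue_on (sl_I D). Q x) \<longleftrightarrow> (\<forall>i<4. AE x in lebesgue_on (piece D i). Q x)"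
proof
  assume "AE x in lebesgue_on (sl_I D). Q x"
  then have ae: "AE x in lebesgue. x \<in> sl_I D \<longrightarrow> Q x" by (simp add: AE_restrict_space_iff)
  show "\<forall>i<4. AE x in lebesgue_on (piece D i). Q x"
  proof (intro allI impI)
    fix i :: nat assume i: "i < 4"
    have "AE x in lebesgue. x \<in> piece D i \<longrightarrow> Q x" using ae by eventually_elim (use piece_sl_I[OF i] in auto)
    then show "AE x in lebesgue_on (piece D i). Q x" by (simp add: AE_restrict_space_iff)
  qed
next
  assume "\<forall>i<4. AE x in lebesgue_on (piece D i). Q x"
  then have "\<forall>i\<in>{..<4}. AE x in lebesgue. x \<in> piece D i \<longrightarrow> Q x" by (simp add: AE_restrict_space_iff)
  then have "AE x in lebesgue. \<forall>i\<in>{..<4}. x \<in> piece D i \<longrightarrow> Q x" by (subst AE_finite_all) auto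
  then have "AE x in lebesgue. x \<in> sl_I D \<longrightarrow> Q x"
    using AE_not_end
  proof eventually_elim
    case (elim x)
    then show ?case using sl_I_cases[of x] by (metis lessThan_iff)
  qed
  then show "AE x in lebesgue_on (sl_I D). Q x" by (simp add: AE_restrict_space_iff)
qed

lemma has_bochner_integral_ends:
  fixes f :: "real \<Rightarrow> 'b::euclidean_space"
  shows "has_bochner_integral lebesgue (\<lambda>x. indicator {-1, 1} x *\<^sub>R f x) 0"
proof -
  have "AE x::real in lebesgue. (0::'b) = indicator {-1, 1} x *\<^sub>R f x"
    using AE_not_end by eventually_elim (auto simp: indicator_def)
  moreover have "(\<lambda>x. indicator {-1, 1} x *\<^sub>R f x) \<in> borel_measurable lebesgue"
  proof -
    have "(\<lambda>x. indicator {-1, 1} x *\<^sub>R f x) = (\<lambda>x. indicator {-1} x *\<^sub>R f (-1) + indicator {1::real} x *\<^sub>R f 1)"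
      by (auto simp: indicator_def fun_eq_iff)
    moreover have "(\<lambda>x. indicator {-1} x *\<^sub>R f (-1) + indicator {1::real} x *\<^sub>R f 1) \<in> borel_measurable lebesgue"
      by (intro borel_measurable_add borel_measurable_scaleR borel_measurable_indicator) auto
    ultimately show ?thesis by simp
  qed
  ultimately show ?thesis
    using has_bochner_integral_cong_AE[of "\<lambda>x. 0" lebesgue "\<lambda>x. indicator {-1, 1} x *\<^sub>R f x" 0]
    by (simp add: has_bochner_integral_zero)
qed

lemma borel_measurable_sl_I_iff:
  fixes f :: "real \<Rightarrow> 'b::euclidean_space"
  shows "f \<in> borel_measurable (lebesgue_on (sl_I D)) \<longleftrightarrow> (\<forall>i<4. f \<in> borel_measurable (lebesgue_on (piece D i)))"
proof
  assume "f \<in> borel_measurable (lebesgue_on (sl_I D))"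
  then show "\<forall>i<4. f \<in> borel_measurable (lebesgue_on (piece D i))"
    using piece_sl_I by (auto intro: measurable_restrict_mono)
next
  assume "\<forall>i<4. f \<in> borel_measurable (lebesgue_on (piece D i))"
  then have m: "(\<lambda>x. indicator (piece D i) x *\<^sub>R f x) \<in> borel_measurable lebesgue" if "i < 4" for i
    using that by (simp add: borel_measurable_restrict_space_iff)
  have "(\<lambda>x. indicator {-1, 1} x *\<^sub>R f x) \<in> borel_measurable lebesgue"
    using has_bochner_integral_ends[of f] by (simp add: has_bochner_integral_iff borel_measurable_integrable)
  then have "(\<lambda>x. (\<Sum>i<4. indicator (piece D i) x *\<^sub>R f x) + indicator {-1, 1} x *\<^sub>R f x) \<in> borel_measurable lebesgue"
    by (intro borel_measurable_add borel_measurable_sum) (auto intro: m)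
  then show "f \<in> borel_measurable (lebesgue_on (sl_I D))"
    unfolding sl_I_indicator[symmetric] by (simp add: borel_measurable_restrict_space_iff)
qed

lemma integrable_sl_I_iff:
  fixes f :: "real \<Rightarrow> 'b::euclidean_space"
  shows "integrable (lebesgue_on (sl_I D)) f \<longleftrightarrow> (\<forall>i<4. integrable (lebesgue_on (piece D i)) f)"
proof
  assume f: "integrable (lebesgue_on (sl_I D)) f"
  then have "set_integrable lebesgue (sl_I D) f" by (simp add: integrable_restrict_space set_integrable_def)
  then have "set_integrable lebesgue (piece D i) f" if "i < 4" for i
    by (rule set_integrable_subset) (use piece_sl_I that in auto)
  then show "\<forall>i<4. integrable (lebesgue_on (piece D i)) f" by (simp add: integrable_restrict_space set_integrable_def)
next
  assume "\<forall>i<4. integrable (lebesgue_on (piece D i)) f"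
  then have "integrable lebesgue (\<lambda>x. (\<Sum>i<4. indicator (piece D i) x *\<^sub>R f x) + indicator {-1, 1} x *\<^sub>R f x)"
    using has_bochner_integral_ends[of f]
    by (intro Bochner_Integration.integrable_add Bochner_Integration.integrable_sum)
      (auto simp: integrable_restrict_space has_bochner_integral_iff)
  then show "integrable (lebesgue_on (sl_I D)) f"
    unfolding sl_I_indicator[symmetric] by (simp add: integrable_restrict_space)
qed

lemma sl_H1_iff_I: "f \<in> sl_H1 D \<longleftrightarrow> square_integrable (lebesgue_on (sl_I D)) f"
  by (simp add: sl_H1_def square_integrable_def)

lemma sl_H1_iff: "f \<in> sl_H1 D \<longleftrightarrow> (\<forall>i<4. square_integrable (lebesgue_on (piece D i)) f)"
  unfolding sl_H1_iff_I square_integrable_def borel_measurable_sl_I_iff integrable_sl_I_iff by auto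

lemma sl_inner_expand:
  "sl_inner D F G = (\<Sum>i<4. of_real (weight D i) * (LINT x|lebesgue_on (piece D i). fst F x * cnj (fst G x)))
    + of_real (end_weight D) * (snd F * cnj (snd G))"
  unfolding sl_inner_def sl_inner1_def sum_lessThan_4 piece_simps end_weight_def weight_def leading_def det_prod_def
  by (simp add: eval_nat_numeral mult.assoc)

lemma sl_inner_self:
  "sl_inner D F F = of_real ((\<Sum>i<4. weight D i * (LINT x|lebesgue_on (piece D i). (norm (fst F x))\<^sup>2))
    + end_weight D * (norm (snd F))\<^sup>2)"
proof -
  have "(LINT x|lebesgue_on (piece D i). fst F x * cnj (fst F x)) = of_real (LINT x|lebesgue_on (piece D i). (norm (fst F x))\<^sup>2)" for i
    unfolding complex_norm_square[symmetric] by (rule integral_complex_of_real)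
  then show ?thesis
    unfolding sl_inner_expand by (simp add: complex_norm_square[symmetric] del: of_real_power)
qed

lemma sl_H_subspace:
  shows "0 \<in> sl_H D" and "F \<in> sl_H D \<Longrightarrow> G \<in> sl_H D \<Longrightarrow> F + G \<in> sl_H D" and "F \<in> sl_H D \<Longrightarrow> sl_Hscale c F \<in> sl_H D"
proof -
  show "0 \<in> sl_H D" by (auto simp: sl_H_def sl_H1_def zero_prod_def zero_fun_def)
  show "F + G \<in> sl_H D" if "F \<in> sl_H D" "G \<in> sl_H D"
    using that square_integrable_add[of "lebesgue_on (sl_I D)" "fst F" "fst G"]
    by (auto simp: sl_H_def sl_H1_iff_I plus_prod_def plus_fun_def mem_Times_iff)
  show "sl_Hscale c F \<in> sl_H D" if "F \<in> sl_H D"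
    using that square_integrable_scale[of "lebesgue_on (sl_I D)" "fst F" c]
    by (auto simp: sl_H_def sl_H1_iff_I sl_Hscale_def mem_Times_iff)
qed

lemma sl_H_piece: "F \<in> sl_H D \<Longrightarrow> i < 4 \<Longrightarrow> square_integrable (lebesgue_on (piece D i)) (fst F)"
  using sl_H1_iff by (auto simp: sl_H_def)

lemma finite_piece: "finite_measure (lebesgue_on (piece D i))"
  by (rule finite_measure_lebesgue_on) (simp add: piece_def)

sublocale vector_space sl_Hscale
  by unfold_locales (auto simp: sl_Hscale_def prod_eq_iff fun_eq_iff algebra_simps)

text \<open>Off the pieces the description is undefined and the value arbitrary; these points form a null set.\<close>

definition glue :: "(nat \<Rightarrow> real \<Rightarrow> complex) \<Rightarrow> real \<Rightarrow> complex" where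
  "glue U x = U (THE i. i < 4 \<and> x \<in> piece D i) x"

lemma glue: "i < 4 \<Longrightarrow> x \<in> piece D i \<Longrightarrow> glue U x = U i x"
proof -
  assume i: "i < 4" "x \<in> piece D i"
  have "(THE i. i < 4 \<and> x \<in> piece D i) = i" by (rule the_equality) (use i piece_disjoint in auto)
  then show ?thesis by (simp add: glue_def)
qed

text \<open>Up to weights the inner product is that of the direct sum of the \<open>L\<^sup>2\<close> spaces of the pieces and \<open>\<complex>\<close>,
  each of which is complete.\<close>

lemma sl_H_complete:
  assumes X: "\<And>n. X n \<in> sl_H D"
    and cauchy: "\<And>e. e > 0 \<Longrightarrow> \<exists>N. \<forall>m\<ge>N. \<forall>n\<ge>N. sqrt (Re (sl_inner D (X m - X n) (X m - X n))) < e"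
  shows "\<exists>Y\<in>sl_H D. (\<lambda>n. sqrt (Re (sl_inner D (X n - Y) (X n - Y)))) \<longlonglongrightarrow> 0"
proof -
  have terms: "weight D i * (LINT x|lebesgue_on (piece D i). (norm (fst (X m) x - fst (X n) x))\<^sup>2)
        \<le> Re (sl_inner D (X m - X n) (X m - X n))" "end_weight D * (norm (snd (X m) - snd (X n)))\<^sup>2 \<le> Re (sl_inner D (X m - X n) (X m - X n))"
    if "i < 4" for i m n
  proof -
    have nonneg: "0 \<le> weight D j * (LINT x|lebesgue_on (piece D j). (norm (fst (X m) x - fst (X n) x))\<^sup>2)" if "j < 4" for j
      using weight_pos[OF that] by (intro mult_nonneg_nonneg integral_nonneg) auto
    have e: "0 \<le> end_weight D * (norm (snd (X m) - snd (X n)))\<^sup>2" using end_weight_pos by simp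
    have R: "Re (sl_inner D (X m - X n) (X m - X n)) = (\<Sum>i<4. weight D i * (LINT x|lebesgue_on (piece D i). (norm (fst (X m) x - fst (X n) x))\<^sup>2))
      + end_weight D * (norm (snd (X m) - snd (X n)))\<^sup>2"
      unfolding sl_inner_self by simp
    show "weight D i * (LINT x|lebesgue_on (piece D i). (norm (fst (X m) x - fst (X n) x))\<^sup>2)
        \<le> Re (sl_inner D (X m - X n) (X m - X n))"
      unfolding R using member_le_sum[of i "{..<4}" "\<lambda>i. weight D i * (LINT x|lebesgue_on (piece D i). (norm (fst (X m) x - fst (X n) x))\<^sup>2)"] nonneg that e
      by fastforce
    show "end_weight D * (norm (snd (X m) - snd (X n)))\<^sup>2 \<le> Re (sl_inner D (X m - X n) (X m - X n))"
      unfolding R using sum_nonneg[of "{..<4}" "\<lambda>i. weight D i * (LINT x|lebesgue_on (piece D i). (norm (fst (X m) x - fst (X n) x))\<^sup>2)"] nonneg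
      by fastforce
  qed
  have cauchy2: "\<exists>N. \<forall>m\<ge>N. \<forall>n\<ge>N. Re (sl_inner D (X m - X n) (X m - X n)) < e" if e: "e > 0" for e
  proof -
    obtain N where N: "\<And>m n. m \<ge> N \<Longrightarrow> n \<ge> N \<Longrightarrow> sqrt (Re (sl_inner D (X m - X n) (X m - X n))) < sqrt e"
      using cauchy[of "sqrt e"] e by auto
    then show ?thesis by (metis real_sqrt_less_iff)
  qed
  have "\<exists>y. square_integrable (lebesgue_on (piece D i)) y \<and>
      (\<lambda>n. LINT x|lebesgue_on (piece D i). (norm (fst (X n) x - y x))\<^sup>2) \<longlonglongrightarrow> 0" if i: "i < 4" for i
  proof -
    have c: "\<exists>N. \<forall>m\<ge>N. \<forall>n\<ge>N. (LINT x|lebesgue_on (piece D i). (norm (fst (X m) x - fst (X n) x))\<^sup>2) < e" if e: "e > 0" for e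
    proof -
      obtain N where N: "\<And>m n. m \<ge> N \<Longrightarrow> n \<ge> N \<Longrightarrow> Re (sl_inner D (X m - X n) (X m - X n)) < weight D i * e"
        using cauchy2[of "weight D i * e"] e weight_pos[OF i] by auto
      have "(LINT x|lebesgue_on (piece D i). (norm (fst (X m) x - fst (X n) x))\<^sup>2) < e" if "m \<ge> N" "n \<ge> N" for m n
        using le_less_trans[OF terms(1)[OF i] N[OF that]] weight_pos[OF i] by simp
      then show ?thesis by blast
    qed
    then show ?thesis
      using finite_measure.square_integrable_complete[OF finite_piece sl_H_piece[OF X i] c] by blast
  qed
  then have "\<forall>i. \<exists>y. i < 4 \<longrightarrow> square_integrable (lebesgue_on (piece D i)) y \<and>
      (\<lambda>n. LINT x|lebesgue_on (piece D i). (norm (fst (X n) x - y x))\<^sup>2) \<longlonglongrightarrow> 0" by blast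
  from choice[OF this]
  obtain y where y: "\<And>i. i < 4 \<Longrightarrow> square_integrable (lebesgue_on (piece D i)) (y i)"
    "\<And>i. i < 4 \<Longrightarrow> (\<lambda>n. LINT x|lebesgue_on (piece D i). (norm (fst (X n) x - y i x))\<^sup>2) \<longlonglongrightarrow> 0"
    by blast
  have "Cauchy (\<lambda>n. snd (X n))"
    unfolding Cauchy_def dist_norm
  proof (intro allI impI)
    fix e :: real assume e: "e > 0"
    obtain N where N: "\<And>m n. m \<ge> N \<Longrightarrow> n \<ge> N \<Longrightarrow> Re (sl_inner D (X m - X n) (X m - X n)) < end_weight D * e\<^sup>2"
      using cauchy2[of "end_weight D * e\<^sup>2"] e end_weight_pos by auto
    have "norm (snd (X m) - snd (X n)) < e" if "m \<ge> N" "n \<ge> N" for m n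
    proof -
      have "(norm (snd (X m) - snd (X n)))\<^sup>2 < e\<^sup>2"
        using le_less_trans[OF terms(2)[of 0] N[OF that]] end_weight_pos by simp
      then show ?thesis using e by (simp add: power_less_imp_less_base)
    qed
    then show "\<exists>M. \<forall>m\<ge>M. \<forall>n\<ge>M. norm (snd (X m) - snd (X n)) < e" by blast
  qed
  then obtain h where h: "(\<lambda>n. snd (X n)) \<longlonglongrightarrow> h" using Cauchy_convergent_iff convergent_def by blast
  define z where "z = glue y"
  have z: "z x = y i x" if "i < 4" "x \<in> piece D i" for i x
    unfolding z_def by (rule glue[OF that])
  have zi: "square_integrable (lebesgue_on (piece D i)) z" if "i < 4" for i
  proof -
    have "z \<in> borel_measurable (lebesgue_on (piece D i)) \<longleftrightarrow> y i \<in> borel_measurable (lebesgue_on (piece D i))"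
      by (rule measurable_cong) (use z[OF that] in simp)
    moreover have "integrable (lebesgue_on (piece D i)) (\<lambda>x. (norm (z x))\<^sup>2) \<longleftrightarrow> integrable (lebesgue_on (piece D i)) (\<lambda>x. (norm (y i x))\<^sup>2)"
      by (rule Bochner_Integration.integrable_cong) (use z[OF that] in auto)
    ultimately show ?thesis using y(1)[OF that] by (simp add: square_integrable_def)
  qed
  have zlim: "(\<lambda>n. LINT x|lebesgue_on (piece D i). (norm (fst (X n) x - z x))\<^sup>2) \<longlonglongrightarrow> 0" if "i < 4" for i
  proof -
    have "(LINT x|lebesgue_on (piece D i). (norm (fst (X n) x - z x))\<^sup>2) = (LINT x|lebesgue_on (piece D i). (norm (fst (X n) x - y i x))\<^sup>2)" for n
      by (rule Bochner_Integration.integral_cong) (use z[OF that] in auto)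
    then show ?thesis using y(2)[OF that] by simp
  qed
  show ?thesis
  proof
    show "(z, h) \<in> sl_H D" using zi sl_H1_iff by (auto simp: sl_H_def)
    have R: "Re (sl_inner D (X n - (z, h)) (X n - (z, h))) = (\<Sum>i<4. weight D i * (LINT x|lebesgue_on (piece D i). (norm (fst (X n) x - z x))\<^sup>2))
      + end_weight D * (norm (snd (X n) - h))\<^sup>2" for n
      unfolding sl_inner_self by simp
    have "(\<lambda>n. sqrt ((\<Sum>i<4. weight D i * (LINT x|lebesgue_on (piece D i). (norm (fst (X n) x - z x))\<^sup>2))
      + end_weight D * (norm (snd (X n) - h))\<^sup>2)) \<longlonglongrightarrow> sqrt ((\<Sum>i<4::nat. weight D i * 0) + end_weight D * (norm (h - h))\<^sup>2)"
      by (intro tendsto_intros zlim h) auto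
    then show "(\<lambda>n. sqrt (Re (sl_inner D (X n - (z, h)) (X n - (z, h))))) \<longlonglongrightarrow> 0" unfolding R by simp
  qed
qed

sublocale semi_hilbert sl_Hscale "sl_H D" "sl_inner D"
proof unfold_locales
  show "subspace (sl_H D)" unfolding subspace_def using sl_H_subspace by blast
  fix x y z c
  show "sl_inner D (x + y) z = sl_inner D x z + sl_inner D y z" if xyz: "x \<in> sl_H D" "y \<in> sl_H D" "z \<in> sl_H D"
  proof -
    have "(LINT t|lebesgue_on (piece D i). fst (x + y) t * cnj (fst z t)) =
        (LINT t|lebesgue_on (piece D i). fst x t * cnj (fst z t)) + (LINT t|lebesgue_on (piece D i). fst y t * cnj (fst z t))" if "i < 4" for i
      using square_integrable_mult[OF sl_H_piece[OF xyz(1) that] sl_H_piece[OF xyz(3) that]]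
        square_integrable_mult[OF sl_H_piece[OF xyz(2) that] sl_H_piece[OF xyz(3) that]]
      by (simp add: distrib_right)
    then show ?thesis unfolding sl_inner_expand by (simp add: sum.distrib[symmetric] algebra_simps)
  qed
  show "sl_inner D (sl_Hscale c x) z = c * sl_inner D x z" if "x \<in> sl_H D" "z \<in> sl_H D"
    unfolding sl_inner_expand by (simp add: sl_Hscale_def mult.assoc sum_distrib_left algebra_simps)
  show "sl_inner D y x = cnj (sl_inner D x y)"
  proof -
    have "(LINT t|lebesgue_on (piece D i). fst y t * cnj (fst x t)) = cnj (LINT t|lebesgue_on (piece D i). fst x t * cnj (fst y t))" for i
      unfolding Bochner_Integration.integral_cnj[symmetric] by (simp add: mult.commute)
    then show ?thesis unfolding sl_inner_expand by (simp add: mult.commute)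
  qed
  show "0 \<le> Re (sl_inner D x x)"
    unfolding sl_inner_self using weight_pos end_weight_pos
    by (auto intro!: add_nonneg_nonneg sum_nonneg mult_nonneg_nonneg integral_nonneg simp: less_imp_le)
qed (rule sl_H_complete)

lemma sn_eq_Hnorm: "sn F = sl_Hnorm D F"
  by (simp add: sn_def sl_Hnorm_def)

lemma sn_expand: "(sn F)\<^sup>2 = (\<Sum>i<4. weight D i * (LINT x|lebesgue_on (piece D i). (norm (fst F x))\<^sup>2)) + end_weight D * (norm (snd F))\<^sup>2"
  if "F \<in> sl_H D"
  using sn_squared[OF that] unfolding sl_inner_self by simp

lemma sn_zero_iff:
  assumes F: "F \<in> sl_H D"
  shows "sn F = 0 \<longleftrightarrow> (\<forall>i<4. AE x in lebesgue_on (piece D i). fst F x = 0) \<and> snd F = 0"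
proof -
  have nonneg: "0 \<le> weight D i * (LINT x|lebesgue_on (piece D i). (norm (fst F x))\<^sup>2)" if "i \<in> {..<4}" for i
    using weight_pos that by (auto intro!: mult_nonneg_nonneg integral_nonneg simp: less_imp_le)
  have "sn F = 0 \<longleftrightarrow> (sn F)\<^sup>2 = 0" by simp
  also have "\<dots> \<longleftrightarrow> (\<Sum>i<4. weight D i * (LINT x|lebesgue_on (piece D i). (norm (fst F x))\<^sup>2)) = 0 \<and> end_weight D * (norm (snd F))\<^sup>2 = 0"
    unfolding sn_expand[OF F] using end_weight_pos by (intro add_nonneg_eq_0_iff sum_nonneg nonneg) auto
  also have "\<dots> \<longleftrightarrow> (\<forall>i<4. (LINT x|lebesgue_on (piece D i). (norm (fst F x))\<^sup>2) = 0) \<and> snd F = 0"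
    using end_weight_pos weight_pos by (subst sum_nonneg_eq_0_iff) (use nonneg in \<open>auto simp: less_le\<close>)
  also have "\<dots> \<longleftrightarrow> (\<forall>i<4. AE x in lebesgue_on (piece D i). fst F x = 0) \<and> snd F = 0"
  proof -
    have "(LINT x|lebesgue_on (piece D i). (norm (fst F x))\<^sup>2) = 0 \<longleftrightarrow> (AE x in lebesgue_on (piece D i). fst F x = 0)" if "i < 4" for i
      using integral_nonneg_eq_0_iff_AE[of "lebesgue_on (piece D i)" "\<lambda>x. (norm (fst F x))\<^sup>2"] sl_H_piece[OF F that]
      by (auto simp: square_integrable_def)
    then show ?thesis by auto
  qed
  finally show ?thesis .
qed

end

section \<open>The operator and its symmetry\<close>

lemma abs_int_lebesgue_on_open:
  fixes h :: "real \<Rightarrow> complex"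
  assumes "h absolutely_integrable_on {a..b}"
  shows "integrable (lebesgue_on {a<..<b}) h" "(LINT x|lebesgue_on {a<..<b}. h x) = integral {a..b} h"
proof -
  show 1: "integrable (lebesgue_on {a<..<b}) h"
    using assms[THEN absolutely_integrable_on_Icc_iff_Ioo[THEN iffD1]]
    by (simp add: set_integrable_def integrable_restrict_space)
  have "(LINT x|lebesgue_on {a<..<b}. h x) = integral {a<..<b} h"
    by (rule lebesgue_integral_eq_integral[OF 1]) simp
  then show "(LINT x|lebesgue_on {a<..<b}. h x) = integral {a..b} h"
    by (simp add: integral_open_interval_real)
qed

lemma continuous_square_integrable:
  fixes U :: "real \<Rightarrow> complex"
  assumes U: "continuous_on {a..b} U" and u: "\<And>x. x \<in> {a<..<b} \<Longrightarrow> u x = U x"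
  shows "square_integrable (lebesgue_on {a<..<b}) u"
proof -
  interpret finite_measure "lebesgue_on {a<..<b}" by (rule finite_measure_lebesgue_on) simp
  have "U \<in> borel_measurable (lebesgue_on {a<..<b})"
    by (rule continuous_imp_measurable_on_sets_lebesgue[OF continuous_on_subset[OF U]]) auto
  moreover have "u \<in> borel_measurable (lebesgue_on {a<..<b}) \<longleftrightarrow> U \<in> borel_measurable (lebesgue_on {a<..<b})"
    by (rule measurable_cong) (use u in simp)
  ultimately have m: "u \<in> borel_measurable (lebesgue_on {a<..<b})" by simp
  have "bounded (U ` {a..b})" by (intro compact_imp_bounded compact_continuous_image U) simp
  then obtain B where "\<forall>z\<in>U ` {a..b}. norm z \<le> B" unfolding bounded_iff by blast
  then have B: "\<And>x. x \<in> {a..b} \<Longrightarrow> norm (U x) \<le> B" by blast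
  have "integrable (lebesgue_on {a<..<b}) (\<lambda>x. (norm (u x))\<^sup>2)"
  proof (rule integrable_const_bound[of _ "B\<^sup>2"])
    show "AE x in lebesgue_on {a<..<b}. norm ((norm (u x))\<^sup>2) \<le> B\<^sup>2"
      using u B by (intro AE_I2) (auto intro!: power_mono)
    show "(\<lambda>x. (norm (u x))\<^sup>2) \<in> borel_measurable (lebesgue_on {a<..<b})"
      using m by measurable
  qed
  then show ?thesis using m by (simp add: square_integrable_def)
qed

lemma continuous_AE_zero:
  fixes U :: "real \<Rightarrow> complex"
  assumes ab: "a < b" and U: "continuous_on {a..b} U" and ae: "AE x in lebesgue_on {a<..<b}. U x = 0"
    and x: "x \<in> {a..b}"
  shows "U x = 0"
proof -
  have "AE x in lebesgue. x \<in> {a<..<b} \<longrightarrow> U x = 0" using ae by (simp add: AE_restrict_space_iff)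
  then obtain N where N: "N \<in> null_sets lebesgue" "{x. \<not> (x \<in> {a<..<b} \<longrightarrow> U x = 0)} \<subseteq> N"
    by (auto simp: eventually_ae_filter)
  define S where "S = {x \<in> {a<..<b}. U x \<in> - {0}}"
  have "negligible S" using N by (auto simp: S_def negligible_iff_null_sets intro: negligible_subset[unfolded negligible_iff_null_sets])
  moreover have "open S" unfolding S_def
    using continuous_openin_preimage_gen[OF continuous_on_subset[OF U, of "{a<..<b}"], of "- {0}"]
    by (auto simp: openin_open_eq vimage_def Int_def greaterThanLessThan_subseteq_atLeastAtMost_iff)
  ultimately have "S = {}" using open_not_negligible by blast
  then have zero: "\<And>y. y \<in> {a<..<b} \<Longrightarrow> U y = 0" by (auto simp: S_def)
  have "x \<in> closure {a<..<b}" using x ab by simp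
  moreover have "continuous_on (closure {a<..<b}) U" using U ab by simp
  ultimately show ?thesis using continuous_constant_on_closure[of "{a<..<b}" U 0 x] zero by blast
qed

context sl_problem
begin

text \<open>The functions \<open>U i\<close> and \<open>V i\<close> extend \<open>u\<close> and its derivative to the closure of piece \<open>i\<close>, so their
  values at the knots are the one-sided limits of \<open>u\<close> and its derivative.\<close>

definition piecewise_W21 :: "(real \<Rightarrow> complex) \<Rightarrow> (nat \<Rightarrow> real \<Rightarrow> complex) \<Rightarrow> (nat \<Rightarrow> real \<Rightarrow> complex) \<Rightarrow>
    (nat \<Rightarrow> real \<Rightarrow> complex) \<Rightarrow> bool" where
  "piecewise_W21 u U V g \<longleftrightarrow>
     (\<forall>i<4. W21 (knot D i) (knot D (Suc i)) (U i) (V i) (g i) \<and> (\<forall>x\<in>piece D i. u x = U i x))"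

definition matching :: "(nat \<Rightarrow> real \<Rightarrow> complex) \<Rightarrow> (nat \<Rightarrow> real \<Rightarrow> complex) \<Rightarrow> bool" where
  "matching U V \<longleftrightarrow>
     of_real (sl_alpha D 1) * U 0 (knot D 0) + of_real (sl_alpha D 2) * V 0 (knot D 0) = 0 \<and>
     (\<forall>i<3. U (Suc i) (knot D (Suc i)) = of_real (sl_alpha D (2 * i + 3)) * U i (knot D (Suc i))
                + of_real (sl_beta D (2 * i + 3)) * V i (knot D (Suc i)) \<and>
            V (Suc i) (knot D (Suc i)) = of_real (sl_alpha D (2 * i + 4)) * U i (knot D (Suc i))
                + of_real (sl_beta D (2 * i + 4)) * V i (knot D (Suc i)))"

definition end_N :: "(nat \<Rightarrow> real \<Rightarrow> complex) \<Rightarrow> (nat \<Rightarrow> real \<Rightarrow> complex) \<Rightarrow> complex" where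
  "end_N U V = of_real (sl_beta D 1) * U 3 1 - of_real (sl_beta D 2) * V 3 1"

definition end_N' :: "(nat \<Rightarrow> real \<Rightarrow> complex) \<Rightarrow> (nat \<Rightarrow> real \<Rightarrow> complex) \<Rightarrow> complex" where
  "end_N' U V = of_real (sl_beta1' D) * U 3 1 - of_real (sl_beta2' D) * V 3 1"

text \<open>The graph of \<open>A\<close> up to null sets: on each piece the leading coefficient is constant, and the second
  component is \<open>q * u - p * u''\<close>. Here \<open>u''\<close> is an integrable function whose integral is \<open>u'\<close>; no
  pointwise derivative is involved.\<close>

definition graph :: "(sl_pair \<times> sl_pair) set" where
  "graph = {(F, G). \<exists>U V g. piecewise_W21 (fst F) U V g \<and> matching U V \<and>
      snd F = end_N' U V \<and> snd G = - end_N U V \<and> fst G \<in> sl_H1 D \<and>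
      (\<forall>i<4. AE x in lebesgue_on (piece D i).
         fst G x = of_real (sl_q D x) * U i x - of_real (leading D i) * g i x)}"

lemma graphE:
  assumes "(F, G) \<in> graph"
  obtains U V g where "\<And>i. i < 4 \<Longrightarrow> W21 (knot D i) (knot D (Suc i)) (U i) (V i) (g i)"
    "\<And>i x. i < 4 \<Longrightarrow> x \<in> piece D i \<Longrightarrow> fst F x = U i x" "matching U V"
    "snd F = end_N' U V" "snd G = - end_N U V" "fst G \<in> sl_H1 D"
    "\<And>i. i < 4 \<Longrightarrow> AE x in lebesgue_on (piece D i).
         fst G x = of_real (sl_q D x) * U i x - of_real (leading D i) * g i x"
proof -
  obtain U V g where r: "piecewise_W21 (fst F) U V g" "matching U V"
      "snd F = end_N' U V" "snd G = - end_N U V" "fst G \<in> sl_H1 D"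
      "\<forall>i<4. AE x in lebesgue_on (piece D i).
         fst G x = of_real (sl_q D x) * U i x - of_real (leading D i) * g i x"
    using assms unfolding graph_def by blast
  show thesis
    by (rule that[OF _ _ r(2-5)]) (use r(1,6) in \<open>unfold piecewise_W21_def, blast\<close>)+
qed

lemma piecewise_W21_H1:
  assumes "piecewise_W21 u U V g" shows "u \<in> sl_H1 D"
  unfolding sl_H1_iff piece_def
proof (intro allI impI)
  fix i :: nat assume i: "i < 4"
  show "square_integrable (lebesgue_on {knot D i<..<knot D (Suc i)}) u"
    by (rule continuous_square_integrable[OF W21_continuous(1), of _ _ "U i" "V i" "g i"])
      (use assms i in \<open>auto simp: piecewise_W21_def piece_def\<close>)
qed

lemma graph_H: "(F, G) \<in> graph \<Longrightarrow> F \<in> sl_H D \<and> G \<in> sl_H D"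
  using piecewise_W21_H1 by (auto simp: graph_def sl_H_def mem_Times_iff)

lemma matching_add:
  assumes "matching U1 V1" "matching U2 V2"
  shows "matching (\<lambda>i x. U1 i x + U2 i x) (\<lambda>i x. V1 i x + V2 i x)"
  unfolding matching_def
proof (intro conjI allI impI)
  let ?a = "complex_of_real (sl_alpha D 1)" and ?b = "complex_of_real (sl_alpha D 2)"
  have "?a * (U1 0 (knot D 0) + U2 0 (knot D 0)) + ?b * (V1 0 (knot D 0) + V2 0 (knot D 0))
    = (?a * U1 0 (knot D 0) + ?b * V1 0 (knot D 0)) + (?a * U2 0 (knot D 0) + ?b * V2 0 (knot D 0))"
    by (simp only: distrib_left ac_simps)
  then show "?a * (U1 0 (knot D 0) + U2 0 (knot D 0)) + ?b * (V1 0 (knot D 0) + V2 0 (knot D 0)) = 0"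
    using assms unfolding matching_def by (metis add_0)
qed (use assms in \<open>simp_all add: matching_def distrib_left\<close>)

lemma matching_scale:
  assumes "matching U V"
  shows "matching (\<lambda>i x. c * U i x) (\<lambda>i x. c * V i x)"
  unfolding matching_def
proof (intro conjI allI impI)
  let ?a = "complex_of_real (sl_alpha D 1)" and ?b = "complex_of_real (sl_alpha D 2)"
  have "?a * (c * U 0 (knot D 0)) + ?b * (c * V 0 (knot D 0)) = c * (?a * U 0 (knot D 0) + ?b * V 0 (knot D 0))"
    by (simp only: distrib_left ac_simps)
  then show "?a * (c * U 0 (knot D 0)) + ?b * (c * V 0 (knot D 0)) = 0"
    using assms unfolding matching_def by (metis mult_zero_right)
qed (use assms in \<open>simp_all add: matching_def algebra_simps\<close>)

lemma graph_add:
  assumes 1: "(F1, G1) \<in> graph" and 2: "(F2, G2) \<in> graph"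
  shows "(F1 + F2, G1 + G2) \<in> graph"
proof -
  obtain U1 V1 g1 where r1: "\<And>i. i < 4 \<Longrightarrow> W21 (knot D i) (knot D (Suc i)) (U1 i) (V1 i) (g1 i)"
    "\<And>i x. i < 4 \<Longrightarrow> x \<in> piece D i \<Longrightarrow> fst F1 x = U1 i x" "matching U1 V1"
    "snd F1 = end_N' U1 V1" "snd G1 = - end_N U1 V1" "fst G1 \<in> sl_H1 D"
    "\<And>i. i < 4 \<Longrightarrow> AE x in lebesgue_on (piece D i).
         fst G1 x = of_real (sl_q D x) * U1 i x - of_real (leading D i) * g1 i x"
    by (rule graphE[OF 1]) (rule that)
  obtain U2 V2 g2 where r2: "\<And>i. i < 4 \<Longrightarrow> W21 (knot D i) (knot D (Suc i)) (U2 i) (V2 i) (g2 i)"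
    "\<And>i x. i < 4 \<Longrightarrow> x \<in> piece D i \<Longrightarrow> fst F2 x = U2 i x" "matching U2 V2"
    "snd F2 = end_N' U2 V2" "snd G2 = - end_N U2 V2" "fst G2 \<in> sl_H1 D"
    "\<And>i. i < 4 \<Longrightarrow> AE x in lebesgue_on (piece D i).
         fst G2 x = of_real (sl_q D x) * U2 i x - of_real (leading D i) * g2 i x"
    by (rule graphE[OF 2]) (rule that)
  let ?U = "\<lambda>i x. U1 i x + U2 i x" and ?V = "\<lambda>i x. V1 i x + V2 i x" and ?g = "\<lambda>i x. g1 i x + g2 i x"
  have "piecewise_W21 (fst (F1 + F2)) ?U ?V ?g"
    unfolding piecewise_W21_def
  proof (intro allI impI conjI ballI)
    fix i :: nat assume i: "i < 4"
    show "W21 (knot D i) (knot D (Suc i)) (?U i) (?V i) (?g i)" by (rule W21_add[OF r1(1)[OF i] r2(1)[OF i]])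
    show "fst (F1 + F2) x = ?U i x" if "x \<in> piece D i" for x using r1(2)[OF i that] r2(2)[OF i that] by simp
  qed
  moreover have "matching ?U ?V" by (rule matching_add[OF r1(3) r2(3)])
  moreover have "snd (F1 + F2) = end_N' ?U ?V" "snd (G1 + G2) = - end_N ?U ?V"
    unfolding snd_add r1(4,5) r2(4,5) end_N_def end_N'_def by (simp_all add: algebra_simps)
  moreover have "fst (G1 + G2) \<in> sl_H1 D"
    using H_add[of G1 G2] r1(6) r2(6) by (auto simp: sl_H_def mem_Times_iff)
  moreover have "AE x in lebesgue_on (piece D i). fst (G1 + G2) x = of_real (sl_q D x) * ?U i x - of_real (leading D i) * ?g i x"
    if "i < 4" for i
    using r1(7)[OF that] r2(7)[OF that]
  proof eventually_elim
    case (elim x)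
    show ?case unfolding fst_add plus_fun_apply elim by (simp add: algebra_simps)
  qed
  ultimately show ?thesis unfolding graph_def by blast
qed

lemma graph_scale:
  assumes 1: "(F, G) \<in> graph" shows "(sl_Hscale c F, sl_Hscale c G) \<in> graph"
proof -
  obtain U V g where r: "\<And>i. i < 4 \<Longrightarrow> W21 (knot D i) (knot D (Suc i)) (U i) (V i) (g i)"
    "\<And>i x. i < 4 \<Longrightarrow> x \<in> piece D i \<Longrightarrow> fst F x = U i x" "matching U V"
    "snd F = end_N' U V" "snd G = - end_N U V" "fst G \<in> sl_H1 D"
    "\<And>i. i < 4 \<Longrightarrow> AE x in lebesgue_on (piece D i).
         fst G x = of_real (sl_q D x) * U i x - of_real (leading D i) * g i x"
    by (rule graphE[OF 1]) (rule that)
  let ?U = "\<lambda>i x. c * U i x" and ?V = "\<lambda>i x. c * V i x" and ?g = "\<lambda>i x. c * g i x"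
  have "piecewise_W21 (fst (sl_Hscale c F)) ?U ?V ?g"
    unfolding piecewise_W21_def
  proof (intro allI impI conjI ballI)
    fix i :: nat assume i: "i < 4"
    show "W21 (knot D i) (knot D (Suc i)) (?U i) (?V i) (?g i)" by (rule W21_scale[OF r(1)[OF i]])
    show "fst (sl_Hscale c F) x = ?U i x" if "x \<in> piece D i" for x using r(2)[OF i that] by (simp add: sl_Hscale_def)
  qed
  moreover have "matching ?U ?V" by (rule matching_scale[OF r(3)])
  moreover have "snd (sl_Hscale c F) = end_N' ?U ?V" "snd (sl_Hscale c G) = - end_N ?U ?V"
    unfolding sl_Hscale_def snd_conv r(4,5) end_N_def end_N'_def by (simp_all add: algebra_simps)
  moreover have "fst (sl_Hscale c G) \<in> sl_H1 D"
    using H_scale[of G c] r(6) by (auto simp: sl_H_def mem_Times_iff)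
  moreover have "AE x in lebesgue_on (piece D i). fst (sl_Hscale c G) x = of_real (sl_q D x) * ?U i x - of_real (leading D i) * ?g i x"
    if "i < 4" for i
    using r(7)[OF that]
  proof eventually_elim
    case (elim x)
    show ?case unfolding sl_Hscale_def fst_conv elim by (simp add: algebra_simps)
  qed
  ultimately show ?thesis unfolding graph_def by blast
qed

lemma graph_null:
  assumes 1: "(F, G) \<in> graph" and G': "G' \<in> sl_H D" "sn (G' - G) = 0"
  shows "(F, G') \<in> graph"
proof -
  have "G \<in> sl_H D" using graph_H[OF 1] by simp
  then have null: "\<And>i. i < 4 \<Longrightarrow> AE x in lebesgue_on (piece D i). fst (G' - G) x = 0" "snd G' = snd G"
    using G' sn_zero_iff[of "G' - G"] by auto
  obtain U V g where r: "piecewise_W21 (fst F) U V g" "matching U V"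
    "snd F = end_N' U V" "snd G = - end_N U V"
    "\<And>i. i < 4 \<Longrightarrow> AE x in lebesgue_on (piece D i).
         fst G x = of_real (sl_q D x) * U i x - of_real (leading D i) * g i x"
    using 1 unfolding graph_def by auto
  have "AE x in lebesgue_on (piece D i). fst G' x = of_real (sl_q D x) * U i x - of_real (leading D i) * g i x" if "i < 4" for i
    using r(5)[OF that] null(1)[OF that] by eventually_elim simp
  moreover have "fst G' \<in> sl_H1 D" using G' by (auto simp: sl_H_def)
  ultimately show ?thesis unfolding graph_def using r null(2) by auto
qed

text \<open>Up to sign, the Wronskian of the first function and the conjugate of the second.\<close>

definition boundary_form where
  "boundary_form U1 V1 U2 V2 x = V1 x * cnj (U2 x) - U1 x * cnj (V2 x)" for U1 V1 U2 V2 :: "real \<Rightarrow> complex"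

text \<open>The Lagrange identity. The potential is real, so its contributions cancel.\<close>

lemma graph_piece_identity:
  assumes i: "i < 4"
    and 1: "W21 (knot D i) (knot D (Suc i)) U1 V1 g1" "\<And>x. x \<in> piece D i \<Longrightarrow> u1 x = U1 x" "w1 \<in> sl_H1 D"
      "AE x in lebesgue_on (piece D i). w1 x = of_real (sl_q D x) * U1 x - of_real (leading D i) * g1 x"
    and 2: "W21 (knot D i) (knot D (Suc i)) U2 V2 g2" "\<And>x. x \<in> piece D i \<Longrightarrow> u2 x = U2 x" "w2 \<in> sl_H1 D"
      "AE x in lebesgue_on (piece D i). w2 x = of_real (sl_q D x) * U2 x - of_real (leading D i) * g2 x"
  shows "(LINT x|lebesgue_on (piece D i). w1 x * cnj (u2 x)) - (LINT x|lebesgue_on (piece D i). u1 x * cnj (w2 x))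
    = - of_real (leading D i) * (boundary_form U1 V1 U2 V2 (knot D (Suc i)) - boundary_form U1 V1 U2 V2 (knot D i))"
proof -
  let ?a = "knot D i" and ?b = "knot D (Suc i)" and ?M = "lebesgue_on (piece D i)"
  have ab: "?a < ?b" by (rule knot_less[OF i])
  have u: "square_integrable ?M u1" "square_integrable ?M u2"
    unfolding piece_def using 1(2) 2(2) continuous_square_integrable[OF W21_continuous(1)[OF 1(1)], of u1]
      continuous_square_integrable[OF W21_continuous(1)[OF 2(1)], of u2] by (auto simp: piece_def)
  have w: "square_integrable ?M w1" "square_integrable ?M w2" using 1(3) 2(3) i sl_H1_iff by auto
  have gU: "(\<lambda>x. g1 x * cnj (U2 x)) absolutely_integrable_on {?a..?b}"
    "(\<lambda>x. cnj (g2 x) * U1 x) absolutely_integrable_on {?a..?b}"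
    by (auto intro!: abs_int_mult_continuous W21_D(1)[OF 1(1)] W21_D(1)[OF W21_cnj[OF 2(1)]]
        W21_continuous(1)[OF 1(1)] W21_continuous(1)[OF W21_cnj[OF 2(1)]])
  note gUi = abs_int_lebesgue_on_open[OF gU(1), folded piece_def] abs_int_lebesgue_on_open[OF gU(2), folded piece_def]
  have "(LINT x|?M. w1 x * cnj (u2 x)) - (LINT x|?M. u1 x * cnj (w2 x)) = (LINT x|?M. w1 x * cnj (u2 x) - u1 x * cnj (w2 x))"
    by (rule Bochner_Integration.integral_diff[symmetric]) (intro square_integrable_mult u w)+
  also have "\<dots> = (LINT x|?M. - of_real (leading D i) * (g1 x * cnj (U2 x) - cnj (g2 x) * U1 x))"
  proof (rule integral_cong_AE)
    have space: "AE x in ?M. x \<in> piece D i" by (rule AE_I2) simp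
    show "AE x in ?M. w1 x * cnj (u2 x) - u1 x * cnj (w2 x) = - of_real (leading D i) * (g1 x * cnj (U2 x) - cnj (g2 x) * U1 x)"
      using 1(4) 2(4) space
    proof eventually_elim
      case (elim x)
      show ?case unfolding 1(2)[OF elim(3)] 2(2)[OF elim(3)] elim(1,2) by (simp add: algebra_simps)
    qed
    show "(\<lambda>x. w1 x * cnj (u2 x) - u1 x * cnj (w2 x)) \<in> borel_measurable ?M"
      using square_integrable_mult[OF w(1) u(2)] square_integrable_mult[OF u(1) w(2)] by auto
    show "(\<lambda>x. - of_real (leading D i) * (g1 x * cnj (U2 x) - cnj (g2 x) * U1 x)) \<in> borel_measurable ?M"
      by (rule borel_measurable_times[OF borel_measurable_const borel_measurable_diff[OF
          borel_measurable_integrable[OF gUi(1)] borel_measurable_integrable[OF gUi(3)]]])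
  qed
  also have "\<dots> = - of_real (leading D i) * ((LINT x|?M. g1 x * cnj (U2 x)) - (LINT x|?M. cnj (g2 x) * U1 x))"
    using gUi by (subst integral_mult_right_zero) (simp add: Bochner_Integration.integral_diff)
  also have "(LINT x|?M. g1 x * cnj (U2 x)) - (LINT x|?M. cnj (g2 x) * U1 x)
      = boundary_form U1 V1 U2 V2 ?b - boundary_form U1 V1 U2 V2 ?a"
    using Lagrange_identity[OF ab 1(1) W21_cnj[OF 2(1)]] gUi by (simp add: boundary_form_def)
  finally show ?thesis .
qed

text \<open>The transmission matrix at a knot multiplies the boundary form by its determinant, and the weights of
  the inner product divide by the product of the determinants passed so far. Hence the boundary terms
  of adjacent pieces cancel. The condition at \<open>-1\<close> annihilates the boundary form there, and the form
  at \<open>1\<close> cancels against the contribution of the components in \<open>\<complex>\<close>, whose weight contains \<open>1 / \<rho>\<close>.\<close>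

lemma graph_symmetric:
  assumes 1: "(F1, G1) \<in> graph" and 2: "(F2, G2) \<in> graph"
  shows "sl_inner D G1 F2 = sl_inner D F1 G2"
proof -
  obtain U1 V1 g1 where r1: "\<And>i. i < 4 \<Longrightarrow> W21 (knot D i) (knot D (Suc i)) (U1 i) (V1 i) (g1 i)"
    "\<And>i x. i < 4 \<Longrightarrow> x \<in> piece D i \<Longrightarrow> fst F1 x = U1 i x" "matching U1 V1"
    "snd F1 = end_N' U1 V1" "snd G1 = - end_N U1 V1" "fst G1 \<in> sl_H1 D"
    "\<And>i. i < 4 \<Longrightarrow> AE x in lebesgue_on (piece D i).
         fst G1 x = of_real (sl_q D x) * U1 i x - of_real (leading D i) * g1 i x"
    by (rule graphE[OF 1]) (rule that)
  obtain U2 V2 g2 where r2: "\<And>i. i < 4 \<Longrightarrow> W21 (knot D i) (knot D (Suc i)) (U2 i) (V2 i) (g2 i)"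
    "\<And>i x. i < 4 \<Longrightarrow> x \<in> piece D i \<Longrightarrow> fst F2 x = U2 i x" "matching U2 V2"
    "snd F2 = end_N' U2 V2" "snd G2 = - end_N U2 V2" "fst G2 \<in> sl_H1 D"
    "\<And>i. i < 4 \<Longrightarrow> AE x in lebesgue_on (piece D i).
         fst G2 x = of_real (sl_q D x) * U2 i x - of_real (leading D i) * g2 i x"
    by (rule graphE[OF 2]) (rule that)
  define B where "B i x = boundary_form (U1 i) (V1 i) (U2 i) (V2 i) x" for i x
  define c where "c i = complex_of_real (1 / det_prod D i)" for i
  have piece_id: "of_real (weight D i) * (LINT x|lebesgue_on (piece D i). fst G1 x * cnj (fst F2 x))
      - of_real (weight D i) * (LINT x|lebesgue_on (piece D i). fst F1 x * cnj (fst G2 x))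
      = - (c i * (B i (knot D (Suc i)) - B i (knot D i)))" if i: "i < 4" for i
  proof -
    have "of_real (weight D i) * (LINT x|lebesgue_on (piece D i). fst G1 x * cnj (fst F2 x))
      - of_real (weight D i) * (LINT x|lebesgue_on (piece D i). fst F1 x * cnj (fst G2 x))
      = of_real (weight D i) * ((LINT x|lebesgue_on (piece D i). fst G1 x * cnj (fst F2 x))
          - (LINT x|lebesgue_on (piece D i). fst F1 x * cnj (fst G2 x)))"
      by (simp only: right_diff_distrib)
    also have "\<dots> = of_real (weight D i) * (- of_real (leading D i) * (B i (knot D (Suc i)) - B i (knot D i)))"
    proof -
      have "(LINT x|lebesgue_on (piece D i). fst G1 x * cnj (fst F2 x)) - (LINT x|lebesgue_on (piece D i). fst F1 x * cnj (fst G2 x))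
        = - of_real (leading D i) * (B i (knot D (Suc i)) - B i (knot D i))"
        unfolding B_def
        by (rule graph_piece_identity[OF i r1(1)[OF i] r1(2)[OF i] r1(6) r1(7)[OF i] r2(1)[OF i] r2(2)[OF i] r2(6) r2(7)[OF i]])
      then show ?thesis by simp
    qed
    also have "of_real (weight D i) * (- of_real (leading D i) * (B i (knot D (Suc i)) - B i (knot D i)))
      = - (of_real (weight D i * leading D i) * (B i (knot D (Suc i)) - B i (knot D i)))" by simp
    also have "weight D i * leading D i = 1 / det_prod D i"
      using leading_pos[OF i] by (simp add: weight_def)
    finally show ?thesis by (simp add: c_def)
  qed
  have trans: "c (Suc i) * B (Suc i) (knot D (Suc i)) = c i * B i (knot D (Suc i))" if i: "i < 3" for i
  proof -
    define \<Delta> where "\<Delta> = sl_alpha D (2 * i + 3) * sl_beta D (2 * i + 4) - sl_beta D (2 * i + 3) * sl_alpha D (2 * i + 4)"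
    have "i = 0 \<or> i = 1 \<or> i = 2" using i by auto
    then have det: "det_prod D (Suc i) = \<Delta> * det_prod D i"
      by (elim disjE) (simp_all add: det_prod_def \<Delta>_def sl_theta_def sl_gamma_def sl_xi_def)
    have B: "B (Suc i) (knot D (Suc i)) = of_real \<Delta> * B i (knot D (Suc i))"
      using r1(3) r2(3) i unfolding matching_def B_def boundary_form_def \<Delta>_def by (simp add: algebra_simps)
    have "det_prod D (Suc i) > 0" "det_prod D i > 0" using det_prod_pos i by auto
    moreover from this have "\<Delta> \<noteq> 0" unfolding det by auto
    ultimately have "1 / det_prod D (Suc i) * \<Delta> = 1 / det_prod D i" unfolding det by simp
    then have "c (Suc i) * of_real \<Delta> = c i" unfolding c_def of_real_mult[symmetric] by simp
    then show ?thesis unfolding B mult.assoc[symmetric] by simp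
  qed
  have left: "B 0 (knot D 0) = 0"
  proof -
    let ?a = "complex_of_real (sl_alpha D 1)" and ?b = "complex_of_real (sl_alpha D 2)"
    have e1: "?a * U1 0 (knot D 0) + ?b * V1 0 (knot D 0) = 0" using r1(3) by (simp add: matching_def)
    have "?a * U2 0 (knot D 0) + ?b * V2 0 (knot D 0) = 0" using r2(3) by (simp add: matching_def)
    from arg_cong[OF this, of cnj] have e2: "?a * cnj (U2 0 (knot D 0)) + ?b * cnj (V2 0 (knot D 0)) = 0" by simp
    have "?a * B 0 (knot D 0) = 0"
    proof -
      have "?a * B 0 (knot D 0) = V1 0 (knot D 0) * (?a * cnj (U2 0 (knot D 0)) + ?b * cnj (V2 0 (knot D 0)))
        - cnj (V2 0 (knot D 0)) * (?a * U1 0 (knot D 0) + ?b * V1 0 (knot D 0))"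
        unfolding B_def boundary_form_def by (simp only: algebra_simps)
      then show ?thesis unfolding e1 e2 by simp
    qed
    moreover have "?b * B 0 (knot D 0) = 0"
    proof -
      have "?b * B 0 (knot D 0) = cnj (U2 0 (knot D 0)) * (?a * U1 0 (knot D 0) + ?b * V1 0 (knot D 0))
        - U1 0 (knot D 0) * (?a * cnj (U2 0 (knot D 0)) + ?b * cnj (V2 0 (knot D 0)))"
        unfolding B_def boundary_form_def by (simp only: algebra_simps)
      then show ?thesis unfolding e1 e2 by simp
    qed
    moreover have "?a \<noteq> 0 \<or> ?b \<noteq> 0" using valid by (auto simp: sl_valid_def)
    ultimately show ?thesis by auto
  qed
  have right: "of_real (end_weight D) * (snd G1 * cnj (snd F2)) - of_real (end_weight D) * (snd F1 * cnj (snd G2)) = c 3 * B 3 1"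
  proof -
    have "snd G1 * cnj (snd F2) - snd F1 * cnj (snd G2) = of_real (sl_rho D) * B 3 1"
      unfolding r1(4,5) r2(4,5) end_N_def end_N'_def B_def boundary_form_def sl_rho_def by (simp add: algebra_simps)
    moreover have "end_weight D * sl_rho D = 1 / det_prod D 3"
      using valid by (simp add: end_weight_def det_prod_def sl_valid_def eval_nat_numeral)
    then have "of_real (end_weight D) * (of_real (sl_rho D) * B 3 1) = c 3 * B 3 1"
      unfolding c_def mult.assoc[symmetric] of_real_mult[symmetric] by simp
    ultimately show ?thesis by (simp add: right_diff_distrib[symmetric])
  qed
  have "sl_inner D G1 F2 - sl_inner D F1 G2 = (\<Sum>i<4. - (c i * (B i (knot D (Suc i)) - B i (knot D i)))) + c 3 * B 3 1"
  proof -
    have "sl_inner D G1 F2 - sl_inner D F1 G2 = (\<Sum>i<4. of_real (weight D i) * (LINT x|lebesgue_on (piece D i). fst G1 x * cnj (fst F2 x))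
      - of_real (weight D i) * (LINT x|lebesgue_on (piece D i). fst F1 x * cnj (fst G2 x)))
      + (of_real (end_weight D) * (snd G1 * cnj (snd F2)) - of_real (end_weight D) * (snd F1 * cnj (snd G2)))"
      unfolding sl_inner_expand sum_subtractf by (simp add: algebra_simps)
    also have "\<dots> = (\<Sum>i<4. - (c i * (B i (knot D (Suc i)) - B i (knot D i)))) + c 3 * B 3 1"
      unfolding right by (intro arg_cong2[of _ _ _ _ "(+)"] sum.cong piece_id refl) simp
    finally show ?thesis .
  qed
  also have "\<dots> = 0"
  proof -
    have "knot D (Suc 3) = 1" by (simp add: knot_def)
    then show ?thesis
      using trans[of 0] trans[of 1] trans[of 2] left unfolding sum_lessThan_4
      by (simp add: eval_nat_numeral right_diff_distrib)
  qed
  finally show ?thesis by simp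
qed

text \<open>A continuous function that vanishes almost everywhere vanishes, and so does its derivative.\<close>

lemma graph_null_pieces:
  assumes F: "(F, G) \<in> graph" and null: "sn F = 0"
    and W: "\<And>i. i < 4 \<Longrightarrow> W21 (knot D i) (knot D (Suc i)) (U i) (V i) (g i)"
    and u: "\<And>i x. i < 4 \<Longrightarrow> x \<in> piece D i \<Longrightarrow> fst F x = U i x"
    and i: "i < 4" and x: "x \<in> {knot D i..knot D (Suc i)}"
  shows "U i x = 0" "V i x = 0"
proof -
  let ?a = "knot D i" and ?b = "knot D (Suc i)"
  have "AE x in lebesgue_on (piece D i). fst F x = 0"
    using sn_zero_iff[of F] graph_H[OF F] null i by auto
  moreover have "AE x in lebesgue_on (piece D i). x \<in> piece D i" by (rule AE_I2) simp
  ultimately have ae: "AE x in lebesgue_on (piece D i). U i x = 0"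
    by eventually_elim (use u[OF i] in simp)
  have U: "U i y = 0" if "y \<in> {?a..?b}" for y
    by (rule continuous_AE_zero[OF knot_less[OF i] W21_continuous(1)[OF W[OF i]] ae[unfolded piece_def] that])
  show "U i x = 0" by (rule U[OF x])
  have "V i y = 0" if y: "y \<in> {?a..?b}" for y
  proof -
    have "(U i has_vector_derivative V i y) (at y within {?a..?b})" by (rule W21_deriv[OF W[OF i] y])
    moreover have "(U i has_vector_derivative 0) (at y within {?a..?b})"
      by (rule has_vector_derivative_transform[OF y, of _ "\<lambda>_. 0"]) (use U in auto)
    ultimately show ?thesis
      using vector_derivative_unique_within_closed_interval[OF knot_less[OF i], of y] y by simp
  qed
  then show "V i x = 0" using x by blast
qed

text \<open>If the first component is null, all boundary values vanish, and the second derivative vanishes almost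
  everywhere by Lebesgue's differentiation theorem.\<close>

lemma graph_single_valued:
  assumes F: "(F, G) \<in> graph" and null: "sn F = 0"
  shows "sn G = 0"
proof -
  obtain U V g where r: "\<And>i. i < 4 \<Longrightarrow> W21 (knot D i) (knot D (Suc i)) (U i) (V i) (g i)"
    "\<And>i x. i < 4 \<Longrightarrow> x \<in> piece D i \<Longrightarrow> fst F x = U i x" "matching U V"
    "snd F = end_N' U V" "snd G = - end_N U V" "fst G \<in> sl_H1 D"
    "\<And>i. i < 4 \<Longrightarrow> AE x in lebesgue_on (piece D i).
         fst G x = of_real (sl_q D x) * U i x - of_real (leading D i) * g i x"
    by (rule graphE[OF F]) (rule that)
  have zero: "U i x = 0" "V i x = 0" if "i < 4" "x \<in> {knot D i..knot D (Suc i)}" for i x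
    using graph_null_pieces[where U = U and V = V and g = g, OF F null r(1,2) that] by simp_all
  have "AE x in lebesgue_on (piece D i). fst G x = 0" if i: "i < 4" for i
  proof -
    let ?a = "knot D i" and ?b = "knot D (Suc i)"
    have "0 - 0 = integral {x..y} (g i)" if "?a < x" "x \<le> y" "y < ?b" for x y
      using W21_increment(1)[OF r(1)[OF i], of x y] zero(2)[OF i, of x] zero(2)[OF i, of y] that by simp
    then obtain N where N: "negligible N" "\<And>x. \<lbrakk>x \<in> {?a<..<?b}; x \<notin> N\<rbrakk> \<Longrightarrow> ((\<lambda>_. 0) has_vector_derivative g i x) (at x)"
      using indefinite_integral_has_vector_derivative_AE[OF W21_D(1)[OF r(1)[OF i]], of "\<lambda>_. 0"] by metis
    have "g i x = 0" if "x \<in> piece D i" "x \<notin> N" for x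
      using vector_derivative_unique_at[OF N(2)[of x] has_vector_derivative_const] that by (simp add: piece_def)
    then have "AE x in lebesgue_on (piece D i). g i x = 0"
      unfolding AE_restrict_space_iff[of "piece D i" lebesgue, simplified]
      by (intro AE_I'[of N]) (use N(1) in \<open>auto simp: negligible_iff_null_sets\<close>)
    moreover have "AE x in lebesgue_on (piece D i). x \<in> piece D i" by (rule AE_I2) simp
    ultimately show ?thesis using r(7)[OF i]
    proof eventually_elim
      case (elim x)
      then show ?case using zero(1)[OF i, of x] by (simp add: piece_def)
    qed
  qed
  moreover have "snd G = 0"
    using zero[of 3 1] knot_less[of 3] unfolding r(5) end_N_def by (simp add: knot_def)
  moreover have "G \<in> sl_H D" using graph_H[OF F] by simp
  ultimately show ?thesis using sn_zero_iff by blast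
qed

end

section \<open>The resolvent and its compactness\<close>

text \<open>A solution is continued from one interval to the next: its values at the right end of an interval,
  multiplied by the transmission matrix, are the initial values on the following one.\<close>

lemma chained_initial_value_problem:
  fixes t :: "nat \<Rightarrow> real" and k :: "nat \<Rightarrow> real \<Rightarrow> complex" and m11 m12 m21 m22 :: "nat \<Rightarrow> complex"
  assumes "\<And>i. i < n \<Longrightarrow> t i < t (Suc i)" "\<And>i. i < n \<Longrightarrow> k i absolutely_integrable_on {t i..t (Suc i)}"
  shows "\<exists>C\<ge>0. \<forall>f u0 v0. (\<forall>i<n. f i absolutely_integrable_on {t i..t (Suc i)}) \<longrightarrow>
    (\<exists>U V. U 0 (t 0) = u0 \<and> V 0 (t 0) = v0 \<and>
      (\<forall>i<n. W21 (t i) (t (Suc i)) (U i) (V i) (\<lambda>x. k i x * U i x + f i x)) \<and>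
      (\<forall>i. Suc i < n \<longrightarrow> U (Suc i) (t (Suc i)) = m11 i * U i (t (Suc i)) + m12 i * V i (t (Suc i)) \<and>
                          V (Suc i) (t (Suc i)) = m21 i * U i (t (Suc i)) + m22 i * V i (t (Suc i))) \<and>
      (\<forall>i<n. \<forall>x\<in>{t i..t (Suc i)}.
         norm (U i x) \<le> C * (norm u0 + norm v0 + (\<Sum>i<n. integral {t i..t (Suc i)} (\<lambda>x. norm (f i x)))) \<and>
         norm (V i x) \<le> C * (norm u0 + norm v0 + (\<Sum>i<n. integral {t i..t (Suc i)} (\<lambda>x. norm (f i x))))))"
  using assms
proof (induction n)
  case 0
  show ?case by (intro exI[of _ 0]) auto
next
  case (Suc n)
  have IH: "\<And>i. i < n \<Longrightarrow> t i < t (Suc i)" "\<And>i. i < n \<Longrightarrow> k i absolutely_integrable_on {t i..t (Suc i)}"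
    using Suc.prems by simp_all
  obtain C where C: "C \<ge> 0" "\<And>f u0 v0. (\<forall>i<n. f i absolutely_integrable_on {t i..t (Suc i)}) \<Longrightarrow>
    (\<exists>U V. U 0 (t 0) = u0 \<and> V 0 (t 0) = v0 \<and>
      (\<forall>i<n. W21 (t i) (t (Suc i)) (U i) (V i) (\<lambda>x. k i x * U i x + f i x)) \<and>
      (\<forall>i. Suc i < n \<longrightarrow> U (Suc i) (t (Suc i)) = m11 i * U i (t (Suc i)) + m12 i * V i (t (Suc i)) \<and>
                          V (Suc i) (t (Suc i)) = m21 i * U i (t (Suc i)) + m22 i * V i (t (Suc i))) \<and>
      (\<forall>i<n. \<forall>x\<in>{t i..t (Suc i)}.
         norm (U i x) \<le> C * (norm u0 + norm v0 + (\<Sum>i<n. integral {t i..t (Suc i)} (\<lambda>x. norm (f i x)))) \<and>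
         norm (V i x) \<le> C * (norm u0 + norm v0 + (\<Sum>i<n. integral {t i..t (Suc i)} (\<lambda>x. norm (f i x))))))"
    using Suc.IH[OF IH] by blast
  obtain C1 where C1: "C1 \<ge> 0" "\<And>f u0 v0. f absolutely_integrable_on {t n..t (Suc n)} \<Longrightarrow>
    \<exists>U V. U (t n) = u0 \<and> V (t n) = v0 \<and> W21 (t n) (t (Suc n)) U V (\<lambda>x. k n x * U x + f x) \<and>
      (\<forall>x\<in>{t n..t (Suc n)}. norm (U x) \<le> C1 * (norm u0 + norm v0 + integral {t n..t (Suc n)} (\<lambda>x. norm (f x))) \<and>
                  norm (V x) \<le> C1 * (norm u0 + norm v0 + integral {t n..t (Suc n)} (\<lambda>x. norm (f x))))"
    by (rule initial_value_problem[OF Suc.prems(1)[of n] Suc.prems(2)[of n]]) simp_all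
  define q where "q = norm (m11 (n - 1)) + norm (m12 (n - 1)) + norm (m21 (n - 1)) + norm (m22 (n - 1))"
  define Q where "Q = 1 + q * C"
  have q: "q \<ge> 0" by (simp add: q_def)
  have Q: "Q \<ge> 1" using q C(1) by (simp add: Q_def)
  define C' where "C' = C + C1 * Q"
  have C': "C \<le> C'" "C1 * Q \<le> C'" "C' \<ge> 0" using C(1) C1(1) Q by (auto simp: C'_def)
  show ?case
  proof (rule exI[of _ C'], intro conjI allI impI)
    show "C' \<ge> 0" by (rule C'(3))
    fix f :: "nat \<Rightarrow> real \<Rightarrow> complex" and u0 v0 :: complex
    assume "\<forall>i<Suc n. f i absolutely_integrable_on {t i..t (Suc i)}"
    then have f: "\<And>i. i < Suc n \<Longrightarrow> f i absolutely_integrable_on {t i..t (Suc i)}" by blast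
    define I where "I i = integral {t i..t (Suc i)} (\<lambda>x. norm (f i x))" for i
    have I: "I i \<ge> 0" if "i < Suc n" for i
      unfolding I_def by (rule Henstock_Kurzweil_Integration.integral_nonneg) (use abs_int_subinterval(3)[OF f[OF that]] in auto)
    define S where "S = norm u0 + norm v0 + (\<Sum>i<n. I i)"
    have S0: "S \<ge> 0" using I by (auto simp: S_def intro!: add_nonneg_nonneg sum_nonneg)
    obtain U V where UV: "U 0 (t 0) = u0" "V 0 (t 0) = v0"
      "\<And>i. i < n \<Longrightarrow> W21 (t i) (t (Suc i)) (U i) (V i) (\<lambda>x. k i x * U i x + f i x)"
      "\<And>i. Suc i < n \<Longrightarrow> U (Suc i) (t (Suc i)) = m11 i * U i (t (Suc i)) + m12 i * V i (t (Suc i))"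
      "\<And>i. Suc i < n \<Longrightarrow> V (Suc i) (t (Suc i)) = m21 i * U i (t (Suc i)) + m22 i * V i (t (Suc i))"
      "\<And>i x. i < n \<Longrightarrow> x \<in> {t i..t (Suc i)} \<Longrightarrow> norm (U i x) \<le> C * S"
      "\<And>i x. i < n \<Longrightarrow> x \<in> {t i..t (Suc i)} \<Longrightarrow> norm (V i x) \<le> C * S"
    proof -
      have "\<forall>i<n. f i absolutely_integrable_on {t i..t (Suc i)}" using f by simp
      from C(2)[OF this, of u0 v0, folded I_def, folded S_def] show thesis using that by blast
    qed
    define un where "un = (if n = 0 then u0 else m11 (n - 1) * U (n - 1) (t n) + m12 (n - 1) * V (n - 1) (t n))"
    define vn where "vn = (if n = 0 then v0 else m21 (n - 1) * U (n - 1) (t n) + m22 (n - 1) * V (n - 1) (t n))"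
    have data: "norm un + norm vn \<le> Q * S"
    proof (cases "n = 0")
      case True
      then have "norm un + norm vn = S" by (simp add: un_def vn_def S_def)
      also have "\<dots> \<le> Q * S" using Q S0 mult_right_mono[of 1 Q S] by simp
      finally show ?thesis .
    next
      case False
      then have b: "norm (U (n - 1) (t n)) \<le> C * S" "norm (V (n - 1) (t n)) \<le> C * S"
      proof -
        have n1: "Suc (n - 1) = n" "n - 1 < n" using False by simp_all
        have "t (n - 1) < t n" using Suc.prems(1)[of "n - 1", OF diff_less_Suc] unfolding n1(1) .
        then have "t n \<in> {t (n - 1)..t (Suc (n - 1))}" unfolding n1(1) by simp
        from UV(6)[OF n1(2) this] UV(7)[OF n1(2) this]
        show "norm (U (n - 1) (t n)) \<le> C * S" "norm (V (n - 1) (t n)) \<le> C * S" .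
      qed
      have *: "norm (x * U (n - 1) (t n) + y * V (n - 1) (t n)) \<le> (norm x + norm y) * (C * S)" for x y
      proof -
        have "norm (x * U (n - 1) (t n) + y * V (n - 1) (t n)) \<le> norm x * norm (U (n - 1) (t n)) + norm y * norm (V (n - 1) (t n))"
          by (metis norm_triangle_ineq norm_mult)
        also have "\<dots> \<le> norm x * (C * S) + norm y * (C * S)"
          by (intro add_mono mult_left_mono b) auto
        finally show ?thesis by (simp add: distrib_right)
      qed
      have "norm un + norm vn \<le> (norm (m11 (n - 1)) + norm (m12 (n - 1))) * (C * S) + (norm (m21 (n - 1)) + norm (m22 (n - 1))) * (C * S)"
        unfolding un_def vn_def using False * by (intro add_mono) auto
      also have "\<dots> = q * C * S" by (simp add: q_def distrib_right)
      also have "\<dots> \<le> Q * S" using S0 by (intro mult_right_mono) (auto simp: Q_def)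
      finally show ?thesis .
    qed
    obtain Uk Vk where n: "Uk (t n) = un" "Vk (t n) = vn" "W21 (t n) (t (Suc n)) Uk Vk (\<lambda>x. k n x * Uk x + f n x)"
      "\<And>x. x \<in> {t n..t (Suc n)} \<Longrightarrow> norm (Uk x) \<le> C1 * (norm un + norm vn + I n)"
      "\<And>x. x \<in> {t n..t (Suc n)} \<Longrightarrow> norm (Vk x) \<le> C1 * (norm un + norm vn + I n)"
      using C1(2)[OF f[of n], of un vn] unfolding I_def by auto
    define S' where "S' = norm u0 + norm v0 + (\<Sum>i<Suc n. I i)"
    have SS': "S' = S + I n" by (simp add: S'_def S_def)
    have In: "I n \<ge> 0" by (rule I) simp
    have new: "C1 * (norm un + norm vn + I n) \<le> C' * S'"
    proof -
      have "I n \<le> Q * I n" using mult_right_mono[OF Q In] by simp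
      then have "norm un + norm vn + I n \<le> Q * S'" using data unfolding SS' distrib_left by linarith
      then have "C1 * (norm un + norm vn + I n) \<le> C1 * (Q * S')" using C1(1) by (rule mult_left_mono)
      also have "\<dots> \<le> C' * S'" using C'(2) S0 In unfolding mult.assoc[symmetric] by (intro mult_right_mono) (auto simp: SS')
      finally show ?thesis .
    qed
    have old: "C * S \<le> C' * S'" using C'(1,3) S0 In C(1) by (intro mult_mono) (auto simp: SS')
    let ?U = "U(n := Uk)" and ?V = "V(n := Vk)"
    have "?U 0 (t 0) = u0 \<and> ?V 0 (t 0) = v0"
      using UV(1,2) n(1,2) by (auto simp: un_def vn_def)
    moreover have "\<forall>i<Suc n. W21 (t i) (t (Suc i)) (?U i) (?V i) (\<lambda>x. k i x * ?U i x + f i x)"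
      using UV(3) n(3) by (auto simp: less_Suc_eq)
    moreover have "\<forall>i. Suc i < Suc n \<longrightarrow> ?U (Suc i) (t (Suc i)) = m11 i * ?U i (t (Suc i)) + m12 i * ?V i (t (Suc i)) \<and>
                          ?V (Suc i) (t (Suc i)) = m21 i * ?U i (t (Suc i)) + m22 i * ?V i (t (Suc i))"
    proof (intro allI impI)
      fix i assume i: "Suc i < Suc n"
      show "?U (Suc i) (t (Suc i)) = m11 i * ?U i (t (Suc i)) + m12 i * ?V i (t (Suc i)) \<and>
                          ?V (Suc i) (t (Suc i)) = m21 i * ?U i (t (Suc i)) + m22 i * ?V i (t (Suc i))"
      proof (cases "Suc i = n")
        case True
        then show ?thesis using n(1,2) by (auto simp: un_def vn_def)
      next
        case False
        then show ?thesis using i UV(4,5)[of i] by auto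
      qed
    qed
    moreover have "norm (?U i x) \<le> C' * S' \<and> norm (?V i x) \<le> C' * S'" if "i < Suc n" "x \<in> {t i..t (Suc i)}" for i x
    proof (cases "i = n")
      case True
      then show ?thesis using order_trans[OF n(4) new] order_trans[OF n(5) new] that by simp
    next
      case False
      then have "i < n" using that by simp
      then show ?thesis using order_trans[OF UV(6) old] order_trans[OF UV(7) old] that(2) False by simp
    qed
    ultimately show "\<exists>U V. U 0 (t 0) = u0 \<and> V 0 (t 0) = v0 \<and>
      (\<forall>i<Suc n. W21 (t i) (t (Suc i)) (U i) (V i) (\<lambda>x. k i x * U i x + f i x)) \<and>
      (\<forall>i. Suc i < Suc n \<longrightarrow> U (Suc i) (t (Suc i)) = m11 i * U i (t (Suc i)) + m12 i * V i (t (Suc i)) \<and>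
                          V (Suc i) (t (Suc i)) = m21 i * U i (t (Suc i)) + m22 i * V i (t (Suc i))) \<and>
      (\<forall>i<Suc n. \<forall>x\<in>{t i..t (Suc i)}.
         norm (U i x) \<le> C' * (norm u0 + norm v0 + (\<Sum>i<Suc n. integral {t i..t (Suc i)} (\<lambda>x. norm (f i x)))) \<and>
         norm (V i x) \<le> C' * (norm u0 + norm v0 + (\<Sum>i<Suc n. integral {t i..t (Suc i)} (\<lambda>x. norm (f i x)))))"
      unfolding I_def[symmetric] S'_def[symmetric]
      by (rule_tac exI[of _ ?U], rule_tac exI[of _ ?V]) blast
  qed
qed

context sl_problem
begin

lemma lebesgue_on_piece_abs_int:
  fixes f :: "real \<Rightarrow> complex"
  assumes "integrable (lebesgue_on (piece D i)) f"
  shows "f absolutely_integrable_on {knot D i..knot D (Suc i)}"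
  unfolding absolutely_integrable_on_Icc_iff_Ioo
  using assms by (simp add: set_integrable_def integrable_restrict_space piece_def)

lemma potential_abs_int:
  assumes i: "i < 4"
  shows "(\<lambda>x. (of_real (sl_q D x) - \<mu>) / complex_of_real (leading D i)) absolutely_integrable_on {knot D i..knot D (Suc i)}"
proof (rule lebesgue_on_piece_abs_int)
  interpret finite_measure "lebesgue_on (piece D i)" by (rule finite_piece)
  have "integrable (lebesgue_on (sl_I D)) (sl_q D)" using valid by (simp add: sl_valid_def)
  then have "integrable (lebesgue_on (piece D i)) (sl_q D)" using integrable_sl_I_iff[of "sl_q D"] i by blast
  then have "integrable (lebesgue_on (piece D i)) (\<lambda>x. complex_of_real (sl_q D x) - \<mu>)"
    by (intro Bochner_Integration.integrable_diff integrable_of_real integrable_const)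
  then show "integrable (lebesgue_on (piece D i)) (\<lambda>x. (of_real (sl_q D x) - \<mu>) / of_real (leading D i))"
    by (rule integrable_divide_zero)
qed

lemma H1_abs_int:
  assumes "f \<in> sl_H1 D" "i < 4"
  shows "f absolutely_integrable_on {knot D i..knot D (Suc i)}"
  using assms finite_measure.square_integrable_integrable[OF finite_piece]
  by (intro lebesgue_on_piece_abs_int) (auto simp: sl_H1_iff)

text \<open>On piece \<open>i\<close> the function \<open>U i\<close> solves \<open>- p * U'' + q * U = \<mu> * U + fst F\<close>, and the last hypothesis
  is the second component of the same equation. The glued functions are therefore the value of the
  resolvent at \<open>\<mu>\<close> for the argument \<open>F\<close>.\<close>

lemma graph_from_solution:
  assumes f: "fst F \<in> sl_H1 D"
    and W: "\<And>i. i < 4 \<Longrightarrow> W21 (knot D i) (knot D (Suc i)) (U i) (V i)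
        (\<lambda>x. (of_real (sl_q D x) - \<mu>) / of_real (leading D i) * U i x - fst F x / of_real (leading D i))"
    and m: "matching U V" and e: "snd F + \<mu> * end_N' U V = - end_N U V"
  shows "((glue U, end_N' U V), F + sl_Hscale \<mu> (glue U, end_N' U V)) \<in> graph"
proof -
  let ?g = "\<lambda>i x. (of_real (sl_q D x) - \<mu>) / of_real (leading D i) * U i x - fst F x / of_real (leading D i)"
  have p: "piecewise_W21 (glue U) U V ?g"
    unfolding piecewise_W21_def using W glue by auto
  have "(glue U, end_N' U V) \<in> sl_H D" "F \<in> sl_H D" using piecewise_W21_H1[OF p] f by (auto simp: sl_H_def mem_Times_iff)
  then have "F + sl_Hscale \<mu> (glue U, end_N' U V) \<in> sl_H D" by (intro H_add H_scale)
  then have H1: "fst (F + sl_Hscale \<mu> (glue U, end_N' U V)) \<in> sl_H1 D" by (auto simp: sl_H_def mem_Times_iff)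
  have "AE x in lebesgue_on (piece D i). fst (F + sl_Hscale \<mu> (glue U, end_N' U V)) x
      = of_real (sl_q D x) * U i x - of_real (leading D i) * ?g i x" if i: "i < 4" for i
  proof (rule AE_I2)
    fix x assume "x \<in> space (lebesgue_on (piece D i))"
    then have gx: "glue U x = U i x" using glue[OF i] by simp
    have "complex_of_real (leading D i) \<noteq> 0" using leading_pos[OF i] by simp
    then have "of_real (leading D i) * ?g i x = (of_real (sl_q D x) - \<mu>) * U i x - fst F x"
      by (simp add: right_diff_distrib)
    then show "fst (F + sl_Hscale \<mu> (glue U, end_N' U V)) x = of_real (sl_q D x) * U i x - of_real (leading D i) * ?g i x"
      by (simp add: sl_Hscale_def gx algebra_simps)
  qed
  then show ?thesis
    unfolding graph_def using p m e H1 by (auto simp: sl_Hscale_def)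
qed

lemma end_N_linear:
  "end_N (\<lambda>i x. U1 i x + c * U2 i x) (\<lambda>i x. V1 i x + c * V2 i x) = end_N U1 V1 + c * end_N U2 V2"
  "end_N' (\<lambda>i x. U1 i x + c * U2 i x) (\<lambda>i x. V1 i x + c * V2 i x) = end_N' U1 V1 + c * end_N' U2 V2"
  by (simp_all add: end_N_def end_N'_def algebra_simps)

lemma norm_linear_le:
  fixes x y :: complex
  assumes "norm x \<le> B" "norm y \<le> B"
  shows "norm (of_real r * x - of_real s * y) \<le> (\<bar>r\<bar> + \<bar>s\<bar>) * B"
proof -
  have "norm (of_real r * x - of_real s * y) \<le> norm (of_real r * x) + norm (of_real s * y)" by (rule norm_triangle_ineq4)
  also have "\<dots> = \<bar>r\<bar> * norm x + \<bar>s\<bar> * norm y" by (simp add: norm_mult)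
  also have "\<dots> \<le> \<bar>r\<bar> * B + \<bar>s\<bar> * B" using assms by (intro add_mono mult_left_mono) auto
  finally show ?thesis by (simp add: distrib_right)
qed

text \<open>The solution of the initial value problem with zero initial values satisfies all conditions except
  the one at \<open>1\<close>. It is corrected by a multiple of the homogeneous solution \<open>\<Phi>\<close> that satisfies the
  condition at \<open>-1\<close> and the transmission conditions. If \<open>\<Phi>\<close> satisfied the condition at \<open>1\<close> as well,
  it would be an eigenfunction for the nonreal eigenvalue \<open>\<mu>\<close>, contrary to symmetry; so the
  denominator \<open>\<omega>\<close> of the correction factor is not zero. All bounds depend on \<open>F\<close> through \<open>C0\<close> only.\<close>

lemma resolvent_bounded:
  assumes \<mu>: "Im \<mu> \<noteq> 0"
  obtains B where "\<And>F. F \<in> sl_H D \<Longrightarrow> sn F \<le> C0 \<Longrightarrow>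
    \<exists>U V g. ((glue U, end_N' U V), F + sl_Hscale \<mu> (glue U, end_N' U V)) \<in> graph \<and>
      (\<forall>i<4. W21 (knot D i) (knot D (Suc i)) (U i) (V i) (g i)) \<and>
      (\<forall>i<4. \<forall>x\<in>{knot D i..knot D (Suc i)}. norm (U i x) \<le> B \<and> norm (V i x) \<le> B)"
proof -
  define k where "k i x = (of_real (sl_q D x) - \<mu>) / of_real (leading D i)" for i x
  obtain C where C: "C \<ge> 0" "\<And>f u0 v0. (\<forall>i<4. f i absolutely_integrable_on {knot D i..knot D (Suc i)}) \<Longrightarrow>
    \<exists>U V. U 0 (knot D 0) = u0 \<and> V 0 (knot D 0) = v0 \<and>
      (\<forall>i<4. W21 (knot D i) (knot D (Suc i)) (U i) (V i) (\<lambda>x. k i x * U i x + f i x)) \<and>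
      (\<forall>i. Suc i < 4 \<longrightarrow> U (Suc i) (knot D (Suc i)) = of_real (sl_alpha D (2 * i + 3)) * U i (knot D (Suc i)) + of_real (sl_beta D (2 * i + 3)) * V i (knot D (Suc i)) \<and>
                          V (Suc i) (knot D (Suc i)) = of_real (sl_alpha D (2 * i + 4)) * U i (knot D (Suc i)) + of_real (sl_beta D (2 * i + 4)) * V i (knot D (Suc i))) \<and>
      (\<forall>i<4. \<forall>x\<in>{knot D i..knot D (Suc i)}.
         norm (U i x) \<le> C * (norm u0 + norm v0 + (\<Sum>i<4. integral {knot D i..knot D (Suc i)} (\<lambda>x. norm (f i x)))) \<and>
         norm (V i x) \<le> C * (norm u0 + norm v0 + (\<Sum>i<4. integral {knot D i..knot D (Suc i)} (\<lambda>x. norm (f i x)))))"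
  proof -
    have "\<And>i. i < 4 \<Longrightarrow> k i absolutely_integrable_on {knot D i..knot D (Suc i)}"
      unfolding k_def by (rule potential_abs_int)
    then show thesis
      using chained_initial_value_problem[where n = 4 and t = "knot D" and k = k
        and ?m11.0 = "\<lambda>i. of_real (sl_alpha D (2 * i + 3))" and ?m12.0 = "\<lambda>i. of_real (sl_beta D (2 * i + 3))"
        and ?m21.0 = "\<lambda>i. of_real (sl_alpha D (2 * i + 4))" and ?m22.0 = "\<lambda>i. of_real (sl_beta D (2 * i + 4))", OF knot_less]
      by (elim meta_impE exE conjE) (simp, simp, rule that, assumption, drule spec, drule spec, drule spec, erule mp, assumption)
  qed
  have Suc4: "Suc i < 4 \<longleftrightarrow> i < 3" for i :: nat by auto
  define a1 where "a1 = complex_of_real (sl_alpha D 1)"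
  define a2 where "a2 = complex_of_real (sl_alpha D 2)"
  define P where "P = C * (norm a2 + norm (- a1))"
  obtain \<Phi> \<Psi> where \<Phi>: "\<Phi> 0 (knot D 0) = a2" "\<Psi> 0 (knot D 0) = - a1"
      "\<And>i. i < 4 \<Longrightarrow> W21 (knot D i) (knot D (Suc i)) (\<Phi> i) (\<Psi> i) (\<lambda>x. k i x * \<Phi> i x + 0)"
      "matching \<Phi> \<Psi>"
      "\<And>i x. i < 4 \<Longrightarrow> x \<in> {knot D i..knot D (Suc i)} \<Longrightarrow> norm (\<Phi> i x) \<le> P \<and> norm (\<Psi> i x) \<le> P"
  proof -
    have "\<forall>i<4. (\<lambda>x::real. 0::complex) absolutely_integrable_on {knot D i..knot D (Suc i)}" by simp
    from C(2)[of "\<lambda>i x. 0" a2 "- a1", OF this] obtain \<Phi> \<Psi> where *: "\<Phi> 0 (knot D 0) = a2" "\<Psi> 0 (knot D 0) = - a1"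
      "\<forall>i<4. W21 (knot D i) (knot D (Suc i)) (\<Phi> i) (\<Psi> i) (\<lambda>x. k i x * \<Phi> i x + 0)"
      "\<forall>i. Suc i < 4 \<longrightarrow> \<Phi> (Suc i) (knot D (Suc i)) = of_real (sl_alpha D (2 * i + 3)) * \<Phi> i (knot D (Suc i)) + of_real (sl_beta D (2 * i + 3)) * \<Psi> i (knot D (Suc i)) \<and>
                          \<Psi> (Suc i) (knot D (Suc i)) = of_real (sl_alpha D (2 * i + 4)) * \<Phi> i (knot D (Suc i)) + of_real (sl_beta D (2 * i + 4)) * \<Psi> i (knot D (Suc i))"
      "\<forall>i<4. \<forall>x\<in>{knot D i..knot D (Suc i)}. norm (\<Phi> i x) \<le> P \<and> norm (\<Psi> i x) \<le> P"
      unfolding P_def by auto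
    have "matching \<Phi> \<Psi>" using *(1,2,4) unfolding matching_def Suc4 a1_def a2_def by simp
    show thesis
    proof (rule that[of \<Phi> \<Psi>])
      show "W21 (knot D i) (knot D (Suc i)) (\<Phi> i) (\<Psi> i) (\<lambda>x. k i x * \<Phi> i x + 0)" if "i < 4" for i
        using *(3) that by blast
      show "norm (\<Phi> i x) \<le> P \<and> norm (\<Psi> i x) \<le> P" if "i < 4" "x \<in> {knot D i..knot D (Suc i)}" for i x
        using *(5) that by blast
    qed fact+
  qed
  have P0: "P \<ge> 0" using C(1) by (simp add: P_def)
  define \<omega> where "\<omega> = - end_N \<Phi> \<Psi> - \<mu> * end_N' \<Phi> \<Psi>"
  have \<omega>: "\<omega> \<noteq> 0"
  proof
    assume "\<omega> = 0"
    let ?F = "(glue \<Phi>, end_N' \<Phi> \<Psi>)"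
    have "(?F, 0 + sl_Hscale \<mu> ?F) \<in> graph"
    proof (rule graph_from_solution)
      show "fst (0 :: sl_pair) \<in> sl_H1 D" using H_zero by (auto simp: sl_H_def mem_Times_iff)
      show "W21 (knot D i) (knot D (Suc i)) (\<Phi> i) (\<Psi> i)
        (\<lambda>x. (of_real (sl_q D x) - \<mu>) / of_real (leading D i) * \<Phi> i x - fst (0 :: sl_pair) x / of_real (leading D i))" if "i < 4" for i
        using \<Phi>(3)[OF that] by (simp add: k_def)
      show "snd 0 + \<mu> * end_N' \<Phi> \<Psi> = - end_N \<Phi> \<Psi>" using \<open>\<omega> = 0\<close> by (simp add: \<omega>_def algebra_simps)
    qed (rule \<Phi>(4))
    then have g: "(?F, sl_Hscale \<mu> ?F) \<in> graph" by simp
    have FH: "?F \<in> sl_H D" using graph_H[OF g] by simp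
    have "\<mu> * sl_inner D ?F ?F = cnj \<mu> * sl_inner D ?F ?F"
      using graph_symmetric[OF g g] FH by (simp add: ip_scale ip_scale_right)
    moreover have "\<mu> \<noteq> cnj \<mu>" using \<mu> by (simp add: complex_eq_iff)
    ultimately have "sn ?F = 0" by (simp add: ip_self[OF FH])
    then have "\<Phi> 0 (knot D 0) = 0" "\<Psi> 0 (knot D 0) = 0"
      using graph_null_pieces[OF g _ \<Phi>(3), of 0 "knot D 0"] glue knot_less[of 0] by auto
    then show False using \<Phi>(1,2) valid by (auto simp: a1_def a2_def sl_valid_def)
  qed
  define EN where "EN = \<bar>sl_beta D 1\<bar> + \<bar>sl_beta D 2\<bar>"
  define EN' where "EN' = \<bar>sl_beta1' D\<bar> + \<bar>sl_beta2' D\<bar>"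
  \<comment> \<open>The \<open>L\<^sup>1\<close> norm on a piece is at most the length of the piece, which is at most \<open>2\<close>, plus the
    square of the \<open>L\<^sup>2\<close> norm.\<close>
  define S0 where "S0 = (\<Sum>i<4. (2 + C0\<^sup>2 / weight D i) / leading D i)"
  define B0 where "B0 = C * S0"
  define c0 where "c0 = (sqrt (C0\<^sup>2 / end_weight D) + EN * B0 + norm \<mu> * (EN' * B0)) / norm \<omega>"
  have main: "\<exists>U V g. ((glue U, end_N' U V), F + sl_Hscale \<mu> (glue U, end_N' U V)) \<in> graph \<and>
      (\<forall>i<4. W21 (knot D i) (knot D (Suc i)) (U i) (V i) (g i)) \<and>
      (\<forall>i<4. \<forall>x\<in>{knot D i..knot D (Suc i)}. norm (U i x) \<le> B0 + c0 * P \<and> norm (V i x) \<le> B0 + c0 * P)"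
    if F: "F \<in> sl_H D" and F_le: "sn F \<le> C0" for F
  proof -
    have f: "fst F \<in> sl_H1 D" using F by (auto simp: sl_H_def)
    have sn2: "(sn F)\<^sup>2 \<le> C0\<^sup>2" using F_le sn_nonneg[OF F] by (intro power_mono)
    have term_nonneg: "0 \<le> weight D i * (LINT x|lebesgue_on (piece D i). (norm (fst F x))\<^sup>2)" if "i < 4" for i
      using weight_pos[OF that] by (auto intro!: mult_nonneg_nonneg integral_nonneg)
    have end_nonneg: "0 \<le> end_weight D * (norm (snd F))\<^sup>2" using end_weight_pos by simp
    have sqF: "(LINT x|lebesgue_on (piece D i). (norm (fst F x))\<^sup>2) \<le> C0\<^sup>2 / weight D i" if i: "i < 4" for i
    proof -
      have "weight D i * (LINT x|lebesgue_on (piece D i). (norm (fst F x))\<^sup>2)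
        \<le> (\<Sum>i<4. weight D i * (LINT x|lebesgue_on (piece D i). (norm (fst F x))\<^sup>2))"
        by (rule member_le_sum) (use i term_nonneg in auto)
      also have "\<dots> \<le> C0\<^sup>2" using sn_expand[OF F] sn2 end_nonneg by simp
      finally show ?thesis using weight_pos[OF i] by (simp add: field_simps)
    qed
    have "end_weight D * (norm (snd F))\<^sup>2 \<le> C0\<^sup>2"
      using sn_expand[OF F] sn2 sum_nonneg[of "{..<4}" "\<lambda>i. weight D i * (LINT x|lebesgue_on (piece D i). (norm (fst F x))\<^sup>2)"] term_nonneg
      by simp
    then have "(norm (snd F))\<^sup>2 \<le> C0\<^sup>2 / end_weight D" using end_weight_pos by (simp add: field_simps)
    then have sndF: "norm (snd F) \<le> sqrt (C0\<^sup>2 / end_weight D)" by (rule real_le_rsqrt)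
    define f' where "f' i x = - (fst F x / of_real (leading D i))" for i x
    have f'_abs: "f' i absolutely_integrable_on {knot D i..knot D (Suc i)}" if "i < 4" for i
    proof -
      have "(\<lambda>x. - (1 / of_real (leading D i)) * fst F x) absolutely_integrable_on {knot D i..knot D (Suc i)}"
        by (rule set_integrable_mult_right) (rule H1_abs_int[OF f that])
      moreover have "f' i = (\<lambda>x. - (1 / of_real (leading D i)) * fst F x)" by (simp add: f'_def fun_eq_iff)
      ultimately show ?thesis by simp
    qed
    have f'_le: "integral {knot D i..knot D (Suc i)} (\<lambda>x. norm (f' i x)) \<le> (2 + C0\<^sup>2 / weight D i) / leading D i" if i: "i < 4" for i
    proof -
      interpret finite_measure "lebesgue_on (piece D i)" by (rule finite_piece)
      have fi: "integrable (lebesgue_on (piece D i)) (\<lambda>x. norm (fst F x))"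
        using square_integrable_integrable[OF sl_H_piece[OF F i]] by simp
      have sq: "integrable (lebesgue_on (piece D i)) (\<lambda>x. (norm (fst F x))\<^sup>2)"
        using sl_H_piece[OF F i] by (simp add: square_integrable_def)
      have "integral {knot D i..knot D (Suc i)} (\<lambda>x. norm (fst F x)) = integral (piece D i) (\<lambda>x. norm (fst F x))"
        unfolding piece_def by (simp add: integral_open_interval_real)
      also have "\<dots> = (LINT x|lebesgue_on (piece D i). norm (fst F x))"
        by (rule lebesgue_integral_eq_integral[OF fi, symmetric]) simp
      also have "\<dots> \<le> (LINT x|lebesgue_on (piece D i). 1 + (norm (fst F x))\<^sup>2)"
      proof (rule integral_mono)
        show "norm (fst F x) \<le> 1 + (norm (fst F x))\<^sup>2" for x
          by (rule order_trans[of _ "2 * norm (fst F x)"]) (use sum_squares_bound[of 1 "norm (fst F x)"] in auto)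
      qed (use fi sq in auto)
      also have "\<dots> = measure (lebesgue_on (piece D i)) (piece D i) + (LINT x|lebesgue_on (piece D i). (norm (fst F x))\<^sup>2)"
        using sq by simp
      also have "\<dots> \<le> 2 + C0\<^sup>2 / weight D i"
      proof -
        have "measure (lebesgue_on (piece D i)) (piece D i) = knot D (Suc i) - knot D i"
          using knot_less[OF i] by (simp add: measure_restrict_space piece_def)
        then show ?thesis using sqF[OF i] knot_bounds[OF i] by simp
      qed
      finally have le: "integral {knot D i..knot D (Suc i)} (\<lambda>x. norm (fst F x)) \<le> 2 + C0\<^sup>2 / weight D i" .
      have "integral {knot D i..knot D (Suc i)} (\<lambda>x. norm (f' i x)) = integral {knot D i..knot D (Suc i)} (\<lambda>x. norm (fst F x)) / leading D i"
        using leading_pos[OF i] by (simp add: f'_def norm_divide)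
      also have "\<dots> \<le> (2 + C0\<^sup>2 / weight D i) / leading D i"
        using leading_pos[OF i] le by (intro divide_right_mono) auto
      finally show ?thesis .
    qed
    define Sf where "Sf = (\<Sum>i<4. integral {knot D i..knot D (Suc i)} (\<lambda>x. norm (f' i x)))"
    have "Sf \<le> S0" unfolding Sf_def S0_def by (intro sum_mono f'_le) simp
    then have CSf: "C * (norm (0::complex) + norm (0::complex) + Sf) \<le> B0" using C(1) by (simp add: B0_def mult_left_mono)
    obtain U V where UV: "U 0 (knot D 0) = 0" "V 0 (knot D 0) = 0"
      "\<forall>i<4. W21 (knot D i) (knot D (Suc i)) (U i) (V i) (\<lambda>x. k i x * U i x + f' i x)"
      "\<forall>i. Suc i < 4 \<longrightarrow> U (Suc i) (knot D (Suc i)) = of_real (sl_alpha D (2 * i + 3)) * U i (knot D (Suc i)) + of_real (sl_beta D (2 * i + 3)) * V i (knot D (Suc i)) \<and>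
                          V (Suc i) (knot D (Suc i)) = of_real (sl_alpha D (2 * i + 4)) * U i (knot D (Suc i)) + of_real (sl_beta D (2 * i + 4)) * V i (knot D (Suc i))"
      "\<forall>i<4. \<forall>x\<in>{knot D i..knot D (Suc i)}. norm (U i x) \<le> C * (norm (0::complex) + norm (0::complex) + Sf) \<and> norm (V i x) \<le> C * (norm (0::complex) + norm (0::complex) + Sf)"
    proof -
      have "\<forall>i<4. f' i absolutely_integrable_on {knot D i..knot D (Suc i)}" using f'_abs by blast
      from C(2)[OF this, of 0 0, folded Sf_def] show thesis using that by blast
    qed
    have UV_le: "norm (U i x) \<le> B0" "norm (V i x) \<le> B0" if "i < 4" "x \<in> {knot D i..knot D (Suc i)}" for i x
      using UV(5) that order_trans[OF _ CSf] by blast+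
    have mUV: "matching U V" using UV(1,2,4) unfolding matching_def Suc4 by simp
    define c where "c = (snd F + end_N U V + \<mu> * end_N' U V) / \<omega>"
    have k4: "knot D (Suc 3) = 1" "knot D 3 < 1" using knots_ordered by (simp_all add: knot_def)
    have one: "norm (U 3 1) \<le> B0" "norm (V 3 1) \<le> B0" using UV_le[of 3 1] k4 by auto
    have c_le: "norm c \<le> c0"
    proof -
      have "norm (snd F + end_N U V + \<mu> * end_N' U V) \<le> norm (snd F) + norm (end_N U V) + norm (\<mu> * end_N' U V)"
        by (meson norm_triangle_ineq norm_triangle_le order_trans add_right_mono)
      also have "\<dots> \<le> sqrt (C0\<^sup>2 / end_weight D) + EN * B0 + norm \<mu> * (EN' * B0)"
        unfolding norm_mult end_N_def end_N'_def EN_def EN'_def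
        by (intro add_mono mult_left_mono sndF norm_linear_le one) auto
      finally show ?thesis unfolding c_def c0_def norm_divide by (rule divide_right_mono) simp
    qed
    let ?U = "\<lambda>i x. U i x + c * \<Phi> i x" and ?V = "\<lambda>i x. V i x + c * \<Psi> i x"
    have W: "W21 (knot D i) (knot D (Suc i)) (?U i) (?V i)
        (\<lambda>x. (of_real (sl_q D x) - \<mu>) / of_real (leading D i) * ?U i x - fst F x / of_real (leading D i))" if i: "i < 4" for i
    proof -
      have "W21 (knot D i) (knot D (Suc i)) (?U i) (?V i) (\<lambda>x. (k i x * U i x + f' i x) + c * (k i x * \<Phi> i x + 0))"
        using W21_add[OF UV(3)[rule_format, OF i] W21_scale[OF \<Phi>(3)[OF i], of c]] .
      moreover have "(k i x * U i x + f' i x) + c * (k i x * \<Phi> i x + 0)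
        = (of_real (sl_q D x) - \<mu>) / of_real (leading D i) * ?U i x - fst F x / of_real (leading D i)" for x
        unfolding f'_def k_def[symmetric] by (simp add: algebra_simps)
      ultimately show ?thesis by simp
    qed
    have m: "matching ?U ?V" by (rule matching_add[OF mUV matching_scale[OF \<Phi>(4)]])
    have e: "snd F + \<mu> * end_N' ?U ?V = - end_N ?U ?V"
    proof -
      have "c * \<omega> = snd F + end_N U V + \<mu> * end_N' U V" using \<omega> by (simp add: c_def)
      then show ?thesis unfolding end_N_linear \<omega>_def by (simp add: algebra_simps)
    qed
    show ?thesis
    proof (rule exI[of _ ?U], rule exI[of _ ?V], rule exI, intro conjI allI impI ballI)
      show "((glue ?U, end_N' ?U ?V), F + sl_Hscale \<mu> (glue ?U, end_N' ?U ?V)) \<in> graph"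
        by (rule graph_from_solution[OF f W m e])
      show "W21 (knot D i) (knot D (Suc i)) (?U i) (?V i)
        ((\<lambda>i x. (of_real (sl_q D x) - \<mu>) / of_real (leading D i) * ?U i x - fst F x / of_real (leading D i)) i)" if "i < 4" for i
        using W[OF that] .
      fix i x assume ix: "i < 4" "x \<in> {knot D i..knot D (Suc i)}"
      have "norm (c * \<Phi> i x) \<le> c0 * P" "norm (c * \<Psi> i x) \<le> c0 * P"
        unfolding norm_mult using \<Phi>(5)[OF ix] c_le order_trans[OF norm_ge_zero c_le] by (auto intro!: mult_mono)
      then show "norm (?U i x) \<le> B0 + c0 * P" "norm (?V i x) \<le> B0 + c0 * P"
        using UV_le[OF ix] by (auto intro!: norm_triangle_le add_mono)
    qed
  qed
  show thesis by (rule that) (rule main)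
qed

end

text \<open>The Arzela-Ascoli theorem is applied on one interval after the other, each time to the subsequence
  chosen before.\<close>

lemma equi_Lipschitz_family_subsequence:
  fixes F :: "nat \<Rightarrow> nat \<Rightarrow> real \<Rightarrow> complex" and a b :: "nat \<Rightarrow> real"
  assumes bound: "\<And>n i x. i < m \<Longrightarrow> x \<in> {a i..b i} \<Longrightarrow> norm (F n i x) \<le> B"
    and Lip: "\<And>n i x y. i < m \<Longrightarrow> x \<in> {a i..b i} \<Longrightarrow> y \<in> {a i..b i} \<Longrightarrow> norm (F n i x - F n i y) \<le> B * \<bar>x - y\<bar>"
  shows "\<exists>G (r :: nat \<Rightarrow> nat). strict_mono r \<and> (\<forall>i<m. continuous_on {a i..b i} (G i) \<and>
    (\<forall>e>0. \<exists>N. \<forall>n x. n \<ge> N \<and> x \<in> {a i..b i} \<longrightarrow> norm (F (r n) i x - G i x) < e))"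
  using assms
proof (induction m)
  case 0
  show ?case by (rule exI, rule exI[of _ id]) (simp add: strict_mono_def)
next
  case (Suc m)
  obtain G and r :: "nat \<Rightarrow> nat" where r: "strict_mono r" and G: "\<And>i. i < m \<Longrightarrow> continuous_on {a i..b i} (G i)"
    "\<And>i e. i < m \<Longrightarrow> e > 0 \<Longrightarrow> \<exists>N. \<forall>n x. n \<ge> N \<and> x \<in> {a i..b i} \<longrightarrow> norm (F (r n) i x - G i x) < e"
  proof -
    have "\<exists>G (r :: nat \<Rightarrow> nat). strict_mono r \<and> (\<forall>i<m. continuous_on {a i..b i} (G i) \<and>
      (\<forall>e>0. \<exists>N. \<forall>n x. n \<ge> N \<and> x \<in> {a i..b i} \<longrightarrow> norm (F (r n) i x - G i x) < e))"
      by (rule Suc.IH) (use Suc.prems in simp_all)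
    then show thesis using that by blast
  qed
  have equi: "\<exists>d. 0 < d \<and> (\<forall>n y. y \<in> {a m..b m} \<and> norm (x - y) < d \<longrightarrow> norm (F (r n) m x - F (r n) m y) < e)"
    if x: "x \<in> {a m..b m}" and e: "0 < e" for x e
  proof (intro exI conjI allI impI)
    show "0 < e / (\<bar>B\<bar> + 1)" using e by (simp add: add_nonneg_pos)
    fix n y assume y: "y \<in> {a m..b m} \<and> norm (x - y) < e / (\<bar>B\<bar> + 1)"
    have "norm (F (r n) m x - F (r n) m y) \<le> B * \<bar>x - y\<bar>" using Suc.prems(2)[of m x y "r n"] x y by simp
    also have "\<dots> \<le> (\<bar>B\<bar> + 1) * \<bar>x - y\<bar>" by (intro mult_right_mono) auto
    also have "\<dots> < e" using y by (simp add: pos_less_divide_eq add_nonneg_pos mult.commute)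
    finally show "norm (F (r n) m x - F (r n) m y) < e" .
  qed
  obtain H and s :: "nat \<Rightarrow> nat" where H: "continuous_on {a m..b m} H" and s: "strict_mono s"
    and lim: "\<And>e. 0 < e \<Longrightarrow> \<exists>N. \<forall>n x. n \<ge> N \<and> x \<in> {a m..b m} \<longrightarrow> norm (F (r (s n)) m x - H x) < e"
    using Arzela_Ascoli[of "{a m..b m}" "\<lambda>n. F (r n) m" B] Suc.prems(1)[of m] equi by auto
  have "continuous_on {a i..b i} ((G(m := H)) i) \<and>
    (\<forall>e>0. \<exists>N. \<forall>n x. n \<ge> N \<and> x \<in> {a i..b i} \<longrightarrow> norm (F ((r \<circ> s) n) i x - (G(m := H)) i x) < e)" if i: "i < Suc m" for i
  proof (cases "i = m")
    case True
    then show ?thesis using H lim by simp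
  next
    case False
    then have im: "i < m" using i by simp
    have "\<exists>N. \<forall>n x. n \<ge> N \<and> x \<in> {a i..b i} \<longrightarrow> norm (F (r (s n)) i x - G i x) < e" if e: "e > 0" for e
    proof -
      obtain N where N: "\<And>n x. n \<ge> N \<Longrightarrow> x \<in> {a i..b i} \<Longrightarrow> norm (F (r n) i x - G i x) < e"
        using G(2)[OF im e] by blast
      have "s n \<ge> N" if "n \<ge> N" for n using strict_mono_imp_increasing[OF s, of n] that by simp
      then show ?thesis using N by blast
    qed
    then show ?thesis using G(1)[OF im] False by simp
  qed
  moreover have "strict_mono (r \<circ> s)" using r s by (simp add: strict_mono_o)
  ultimately show ?case by blast
qed

context sl_problem
begin

text \<open>Bounded data give solutions with uniformly bounded derivatives. By Arzela-Ascoli a subsequence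
  converges uniformly on each piece, hence in \<open>L\<^sup>2\<close>, and the bounded components in \<open>\<complex>\<close> have a
  convergent subsequence.\<close>

lemma resolvent_compactness:
  assumes \<mu>: "Im \<mu> \<noteq> 0" and X: "\<And>n. X n \<in> sl_H D" "\<And>n. sn (X n) \<le> C"
  shows "\<exists>Y y (r :: nat \<Rightarrow> nat). (\<forall>n. (Y n, X n + sl_Hscale \<mu> (Y n)) \<in> graph) \<and> y \<in> sl_H D \<and> strict_mono r \<and>
        (\<lambda>n. sn (Y (r n) - y)) \<longlonglongrightarrow> 0"
proof -
  obtain B where B: "\<And>F. F \<in> sl_H D \<Longrightarrow> sn F \<le> C \<Longrightarrow>
    \<exists>U V g. ((glue U, end_N' U V), F + sl_Hscale \<mu> (glue U, end_N' U V)) \<in> graph \<and>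
      (\<forall>i<4. W21 (knot D i) (knot D (Suc i)) (U i) (V i) (g i)) \<and>
      (\<forall>i<4. \<forall>x\<in>{knot D i..knot D (Suc i)}. norm (U i x) \<le> B \<and> norm (V i x) \<le> B)"
    using resolvent_bounded[OF \<mu>, of C] by blast
  obtain U V g where UV: "\<And>n. ((glue (U n), end_N' (U n) (V n)), X n + sl_Hscale \<mu> (glue (U n), end_N' (U n) (V n))) \<in> graph"
      "\<And>n i. i < 4 \<Longrightarrow> W21 (knot D i) (knot D (Suc i)) (U n i) (V n i) (g n i)"
      "\<And>n i x. i < 4 \<Longrightarrow> x \<in> {knot D i..knot D (Suc i)} \<Longrightarrow> norm (U n i x) \<le> B"
      "\<And>n i x. i < 4 \<Longrightarrow> x \<in> {knot D i..knot D (Suc i)} \<Longrightarrow> norm (V n i x) \<le> B"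
  proof -
    define P where "P n U V g \<longleftrightarrow> ((glue U, end_N' U V), X n + sl_Hscale \<mu> (glue U, end_N' U V)) \<in> graph \<and>
      (\<forall>i<4. W21 (knot D i) (knot D (Suc i)) (U i) (V i) (g i)) \<and>
      (\<forall>i<4. \<forall>x\<in>{knot D i..knot D (Suc i)}. norm (U i x) \<le> B \<and> norm (V i x) \<le> B)" for n U V g
    have "\<forall>n. \<exists>U V g. P n U V g" unfolding P_def using B[OF X] by blast
    then obtain U V g where P: "\<And>n. P n (U n) (V n) (g n)" by metis
    show thesis by (rule that[of U V g]) (use P[unfolded P_def] in blast)+
  qed
  define Y where "Y n = (glue (U n), end_N' (U n) (V n))" for n
  have YG: "(Y n, X n + sl_Hscale \<mu> (Y n)) \<in> graph" for n using UV(1) by (simp add: Y_def)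
  have YH: "Y n \<in> sl_H D" for n using graph_H[OF YG] by simp
  have Lip: "norm (U n i x - U n i y) \<le> B * \<bar>x - y\<bar>"
    if i: "i < 4" and x: "x \<in> {knot D i..knot D (Suc i)}" and y: "y \<in> {knot D i..knot D (Suc i)}" for n i x y
  proof -
    have *: "norm (U n i z - U n i w) \<le> B * (z - w)" if "knot D i \<le> w" "w \<le> z" "z \<le> knot D (Suc i)" for w z
    proof -
      have Vc: "continuous_on {w..z} (V n i)"
        by (rule continuous_on_subset[OF W21_continuous(2)[OF UV(2)[OF i]]]) (use that in auto)
      have "norm (integral {w..z} (V n i)) \<le> integral {w..z} (\<lambda>_. B)"
        by (rule Henstock_Kurzweil_Integration.integral_norm_bound_integral)
          (use that UV(4)[OF i] Vc in \<open>auto intro: integrable_continuous_real\<close>)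
      then show ?thesis using W21_increment(2)[OF UV(2)[OF i] that] that by (simp add: mult.commute)
    qed
    show ?thesis using *[of x y] *[of y x] x y by (cases "x \<le> y") (auto simp: norm_minus_commute)
  qed
  obtain G and r :: "nat \<Rightarrow> nat" where r: "strict_mono r"
    and G: "\<And>i. i < 4 \<Longrightarrow> continuous_on {knot D i..knot D (Suc i)} (G i)"
      "\<And>i e. i < 4 \<Longrightarrow> e > 0 \<Longrightarrow> \<exists>N. \<forall>n x. n \<ge> N \<and> x \<in> {knot D i..knot D (Suc i)} \<longrightarrow> norm (U (r n) i x - G i x) < e"
  proof -
    have "\<exists>G (r :: nat \<Rightarrow> nat). strict_mono r \<and> (\<forall>i<4. continuous_on {knot D i..knot D (Suc i)} (G i) \<and>
      (\<forall>e>0. \<exists>N. \<forall>n x. n \<ge> N \<and> x \<in> {knot D i..knot D (Suc i)} \<longrightarrow> norm (U (r n) i x - G i x) < e))"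
      by (rule equi_Lipschitz_family_subsequence[where B = B]) (use UV(3) Lip in blast)+
    then show thesis using that by blast
  qed
  have k4: "knot D (Suc 3) = 1" "knot D 3 < 1" using knots_ordered by (simp_all add: knot_def)
  have "bounded (range (\<lambda>n. end_N' (U (r n)) (V (r n))))"
    unfolding bounded_iff
  proof (intro exI ballI)
    fix z assume "z \<in> range (\<lambda>n. end_N' (U (r n)) (V (r n)))"
    then show "norm z \<le> (\<bar>sl_beta1' D\<bar> + \<bar>sl_beta2' D\<bar>) * B"
      using UV(3,4)[of 3 1] k4 by (auto simp: end_N'_def intro!: norm_linear_le)
  qed
  then obtain h and s :: "nat \<Rightarrow> nat" where s: "strict_mono s" and h: "(\<lambda>n. end_N' (U (r (s n))) (V (r (s n)))) \<longlonglongrightarrow> h"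
    using bounded_imp_convergent_subsequence[of "\<lambda>n. end_N' (U (r n)) (V (r n))"] by (auto simp: o_def)
  define y where "y = (glue G, h)"
  have "square_integrable (lebesgue_on (piece D i)) (glue G)" if "i < 4" for i
    unfolding piece_def by (rule continuous_square_integrable[OF G(1)[OF that]]) (rule glue[OF that], simp add: piece_def)
  then have yH: "y \<in> sl_H D" using sl_H1_iff by (auto simp: y_def sl_H_def)
  have piece_lim: "(\<lambda>n. LINT x|lebesgue_on (piece D i). (norm (fst (Y (r (s n)) - y) x))\<^sup>2) \<longlonglongrightarrow> 0" if i: "i < 4" for i
    unfolding LIMSEQ_def
  proof (intro allI impI)
    fix e :: real assume e: "e > 0"
    interpret finite_measure "lebesgue_on (piece D i)" by (rule finite_piece)
    have "sqrt (e / 4) > 0" using e by simp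
    then obtain N where N: "\<And>n x. n \<ge> N \<Longrightarrow> x \<in> {knot D i..knot D (Suc i)} \<Longrightarrow> norm (U (r n) i x - G i x) < sqrt (e / 4)"
      using G(2)[OF i] by blast
    have "dist (LINT x|lebesgue_on (piece D i). (norm (fst (Y (r (s n)) - y) x))\<^sup>2) 0 < e" if n: "n \<ge> N" for n
    proof -
      have sn: "s n \<ge> N" using strict_mono_imp_increasing[OF s, of n] n by simp
      have "(LINT x|lebesgue_on (piece D i). (norm (fst (Y (r (s n)) - y) x))\<^sup>2) \<le> (LINT x|lebesgue_on (piece D i). e / 4)"
      proof (rule integral_mono)
        show "integrable (lebesgue_on (piece D i)) (\<lambda>x. (norm (fst (Y (r (s n)) - y) x))\<^sup>2)"
          using sl_H_piece[OF H_diff[OF YH yH] i] by (simp add: square_integrable_def)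
        fix x assume "x \<in> space (lebesgue_on (piece D i))"
        then have x: "x \<in> piece D i" by simp
        have "norm (fst (Y (r (s n)) - y) x) = norm (U (r (s n)) i x - G i x)"
          using glue[OF i x] by (simp add: Y_def y_def)
        also have "\<dots> \<le> sqrt (e / 4)" using N[OF sn, of x] x by (simp add: piece_def less_imp_le)
        finally have "(norm (fst (Y (r (s n)) - y) x))\<^sup>2 \<le> (sqrt (e / 4))\<^sup>2" by (intro power_mono) auto
        then show "(norm (fst (Y (r (s n)) - y) x))\<^sup>2 \<le> e / 4" using e by simp
      qed simp
      also have "\<dots> = (e / 4) * measure (lebesgue_on (piece D i)) (piece D i)" by simp
      also have "measure (lebesgue_on (piece D i)) (piece D i) = knot D (Suc i) - knot D i"
        using knot_less[OF i] by (simp add: measure_restrict_space piece_def)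
      also have "(e / 4) * (knot D (Suc i) - knot D i) \<le> (e / 4) * 2"
        using knot_bounds[OF i] e by (intro mult_left_mono) auto
      finally show ?thesis using e by (simp add: dist_real_def)
    qed
    then show "\<exists>no. \<forall>n\<ge>no. dist (LINT x|lebesgue_on (piece D i). (norm (fst (Y (r (s n)) - y) x))\<^sup>2) 0 < e" by blast
  qed
  have "(\<lambda>n. sqrt ((\<Sum>i<4. weight D i * (LINT x|lebesgue_on (piece D i). (norm (fst (Y (r (s n)) - y) x))\<^sup>2))
      + end_weight D * (norm (snd (Y (r (s n)) - y)))\<^sup>2)) \<longlonglongrightarrow> sqrt ((\<Sum>i<4::nat. weight D i * 0) + end_weight D * (norm (h - h))\<^sup>2)"
    unfolding snd_diff Y_def snd_conv y_def unfolding Y_def[symmetric] y_def[symmetric]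
    by (intro tendsto_intros piece_lim h) auto
  moreover have "sn F = sqrt ((\<Sum>i<4. weight D i * (LINT x|lebesgue_on (piece D i). (norm (fst F x))\<^sup>2)) + end_weight D * (norm (snd F))\<^sup>2)" for F
    unfolding sn_def sl_inner_self by simp
  ultimately have "(\<lambda>n. sn (Y ((r \<circ> s) n) - y)) \<longlonglongrightarrow> 0" by simp
  moreover have "strict_mono (r \<circ> s)" using r s by (simp add: strict_mono_o)
  ultimately show ?thesis using YG yH by blast
qed

sublocale self_adjoint_relation sl_Hscale "sl_H D" "sl_inner D" graph
proof unfold_locales
  show "sn x' = 0" if "(x, x') \<in> graph" "sn x = 0" for x x' using graph_single_valued that .
  show "x \<in> sl_H D \<and> x' \<in> sl_H D" if "(x, x') \<in> graph" for x x' using graph_H that .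
  show "(x + y, x' + y') \<in> graph" if "(x, x') \<in> graph" "(y, y') \<in> graph" for x x' y y' using graph_add that .
  show "(sl_Hscale c x, sl_Hscale c x') \<in> graph" if "(x, x') \<in> graph" for c x x' using graph_scale that .
  show "(x, x'') \<in> graph" if "(x, x') \<in> graph" "x'' \<in> sl_H D" "sn (x'' - x') = 0" for x x' x'' using graph_null that .
  show "sl_inner D x' y = sl_inner D x y'" if "(x, x') \<in> graph" "(y, y') \<in> graph" for x x' y y' using graph_symmetric that .
  show "\<exists>y. (y, x - sl_Hscale \<i> y) \<in> graph" if "x \<in> sl_H D" for x
  proof -
    have "Im (- \<i>) \<noteq> 0" by simp
    from resolvent_compactness[OF this, of "\<lambda>_. x" "sn x", OF that order_refl]
    obtain Y where "\<forall>n::nat. (Y n, x + sl_Hscale (- \<i>) (Y n)) \<in> graph" by blast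
    then have "(Y 0, x + sl_Hscale (- \<i>) (Y 0)) \<in> graph" by blast
    moreover have "x + sl_Hscale (- \<i>) (Y 0) = x - sl_Hscale \<i> (Y 0)" by (simp add: scale_minus_left)
    ultimately show ?thesis by metis
  qed
  show "\<exists>Y y (r :: nat \<Rightarrow> nat). (\<forall>n. (Y n, X n + sl_Hscale \<i> (Y n)) \<in> graph) \<and> y \<in> sl_H D \<and> strict_mono r \<and>
        (\<lambda>n. sn (Y (r n) - y)) \<longlonglongrightarrow> 0" if "\<And>n. X n \<in> sl_H D" "\<And>n. sn (X n) \<le> C" for X C
    by (rule resolvent_compactness[OF _ that]) simp
qed

end

section \<open>Eigenvectors of the relation and eigenfunctions of the problem\<close>

lemma one_sided_limits:
  fixes U :: "real \<Rightarrow> complex"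
  assumes ab: "a < b" and U: "continuous_on {a..b} U" and f: "\<And>x. x \<in> {a<..<b} \<Longrightarrow> f x = U x"
  shows "Lim (at_right a) f = U a" "Lim (at_left b) f = U b"
proof -
  have "(U \<longlongrightarrow> U a) (at a within {a..b})" "(U \<longlongrightarrow> U b) (at b within {a..b})"
    using U ab by (auto simp: continuous_on_def)
  then have "(U \<longlongrightarrow> U a) (at_right a)" "(U \<longlongrightarrow> U b) (at_left b)"
    using ab by (simp_all add: at_within_Icc_at_right at_within_Icc_at_left)
  moreover have "\<forall>\<^sub>F x in at_right a. U x = f x" "\<forall>\<^sub>F x in at_left b. U x = f x"
    using ab f by (auto simp: eventually_at_right_field eventually_at_left_field)
  ultimately have "(f \<longlongrightarrow> U a) (at_right a)" "(f \<longlongrightarrow> U b) (at_left b)"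
    using Lim_transform_eventually by blast+
  then show "Lim (at_right a) f = U a" "Lim (at_left b) f = U b"
    by (auto intro!: tendsto_Lim)
qed

text \<open>Only values on the open interval are known, so \<open>\<phi>\<close> and \<open>\<psi>\<close> are reconstructed from their values at the
  midpoint by integration over the closed interval.\<close>

lemma W21_from_interior:
  assumes ab: "a < b" and g: "g absolutely_integrable_on {a..b}"
    and \<phi>: "\<And>x. x \<in> {a<..<b} \<Longrightarrow> (\<phi> has_vector_derivative \<psi> x) (at x)"
    and \<psi>: "\<And>x y. \<lbrakk>a < x; x \<le> y; y < b\<rbrakk> \<Longrightarrow> \<psi> y - \<psi> x = integral {x..y} g"
  obtains U V where "W21 a b U V g" "\<And>x. x \<in> {a<..<b} \<Longrightarrow> \<phi> x = U x"
proof -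
  define m where "m = (a + b) / 2"
  have m: "a < m" "m < b" using ab by (auto simp: m_def)
  define V where "V x = \<psi> m + (integral {a..x} g - integral {a..m} g)" for x
  have gI: "g integrable_on {a..b}" using abs_int_subinterval(2)[OF g] by simp
  have V: "V x = \<psi> x" if x: "x \<in> {a<..<b}" for x
  proof (cases "m \<le> x")
    case True
    then have "integral {a..x} g - integral {a..m} g = \<psi> x - \<psi> m"
      using integral_split[OF gI, of m x] \<psi>[of m x] m x by simp
    then show ?thesis by (simp only: V_def) simp
  next
    case False
    have "integral {a..x} g - integral {a..m} g = - (integral {a..m} g - integral {a..x} g)" by simp
    also have "\<dots> = - (\<psi> m - \<psi> x)" using integral_split[OF gI, of x m] \<psi>[of x m] m x False by simp
    finally show ?thesis by (simp add: V_def)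
  qed
  have Vc: "continuous_on {a..b} V"
    unfolding V_def by (intro continuous_intros indefinite_integral_continuous_1 gI)
  have VI: "V integrable_on {a..b}" by (rule integrable_continuous_real[OF Vc])
  define U where "U x = \<phi> m + (integral {a..x} V - integral {a..m} V)" for x
  have FTC: "\<phi> y - \<phi> x = integral {x..y} V" if xy: "a < x" "x \<le> y" "y < b" for x y
  proof -
    have "(V has_integral (\<phi> y - \<phi> x)) {x..y}"
    proof (rule fundamental_theorem_of_calculus[OF xy(2)])
      fix t assume "t \<in> {x..y}"
      then have t: "t \<in> {a<..<b}" using xy by auto
      show "(\<phi> has_vector_derivative V t) (at t within {x..y})"
        unfolding V[OF t] by (rule has_vector_derivative_at_within[OF \<phi>[OF t]])
    qed
    then show ?thesis by (simp add: integral_unique)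
  qed
  have U: "\<phi> x = U x" if x: "x \<in> {a<..<b}" for x
  proof (cases "m \<le> x")
    case True
    then have "integral {a..x} V - integral {a..m} V = \<phi> x - \<phi> m"
      using integral_split[OF VI, of m x] FTC[of m x] m x by simp
    then show ?thesis by (simp only: U_def) simp
  next
    case False
    have "integral {a..x} V - integral {a..m} V = - (integral {a..m} V - integral {a..x} V)" by simp
    also have "\<dots> = - (\<phi> m - \<phi> x)" using integral_split[OF VI, of x m] FTC[of x m] m x False by simp
    finally show ?thesis by (simp add: U_def)
  qed
  have "W21 a b U V g"
    unfolding W21_def
  proof (intro conjI ballI)
    show "V x = V a + integral {a..x} g" "U x = U a + integral {a..x} V" for x
      by (simp_all add: V_def[of x] V_def[of a] U_def)
  qed (rule g)
  then show thesis using that U by blast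
qed

lemma square_integrable_AE_cong:
  fixes f g :: "real \<Rightarrow> complex"
  assumes S: "S \<in> sets lebesgue" and g: "square_integrable (lebesgue_on S) g" and ae: "AE x in lebesgue_on S. f x = g x"
  shows "square_integrable (lebesgue_on S) f"
proof -
  have "AE x in lebesgue. indicator S x *\<^sub>R g x = indicator S x *\<^sub>R f x"
    using ae S by (auto simp: AE_restrict_space_iff indicator_def elim!: eventually_mono)
  moreover have "(\<lambda>x. indicator S x *\<^sub>R g x) \<in> borel_measurable lebesgue"
    using g S by (simp add: square_integrable_def borel_measurable_restrict_space_iff)
  ultimately have "(\<lambda>x. indicator S x *\<^sub>R f x) \<in> borel_measurable lebesgue"
    by (rule borel_measurable_AE[rotated])
  then have f: "f \<in> borel_measurable (lebesgue_on S)"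
    using S by (simp add: borel_measurable_restrict_space_iff)
  moreover have "integrable (lebesgue_on S) (\<lambda>x. (norm (f x))\<^sup>2) \<longleftrightarrow> integrable (lebesgue_on S) (\<lambda>x. (norm (g x))\<^sup>2)"
  proof (rule Bochner_Integration.integrable_cong_AE)
    show "(\<lambda>x. (norm (f x))\<^sup>2) \<in> borel_measurable (lebesgue_on S)" using f by measurable
    show "(\<lambda>x. (norm (g x))\<^sup>2) \<in> borel_measurable (lebesgue_on S)"
      using g by (intro borel_measurable_integrable) (simp add: square_integrable_def)
    show "AE x in lebesgue_on S. (norm (f x))\<^sup>2 = (norm (g x))\<^sup>2" using ae by eventually_elim simp
  qed
  ultimately show ?thesis using g by (simp add: square_integrable_def)
qed

context sl_problem
begin

lemma sl_subintervals_pieces: "sl_subintervals D = piece D ` {..<4}"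
proof -
  have "{..<4::nat} = {0, 1, 2, 3}" by auto
  then show ?thesis unfolding sl_subintervals_def by (simp only: image_insert image_empty piece_simps)
qed

lemma sl_p_piece:
  assumes i: "i < 4" and x: "x \<in> piece D i"
  shows "sl_p D x = leading D i"
  using less_4_cases[OF i] x knots_ordered
  by (elim disjE) (simp_all add: piece_def knot_def leading_def sl_p_def eval_nat_numeral)

lemma piecewise_derivative:
  assumes p: "piecewise_W21 u U V g" and i: "i < 4" and x: "x \<in> piece D i"
  shows "(u has_vector_derivative V i x) (at x)" "sl_deriv u x = V i x"
proof -
  have "(U i has_vector_derivative V i x) (at x)"
    using W21_deriv_at[of "knot D i" "knot D (Suc i)" "U i" "V i" "g i" x] p i x by (auto simp: piecewise_W21_def piece_def)
  then show d: "(u has_vector_derivative V i x) (at x)"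
    by (rule has_vector_derivative_transform_within_open[of _ _ _ "piece D i"])
      (use p i x in \<open>auto simp: piecewise_W21_def piece_def\<close>)
  then show "sl_deriv u x = V i x" unfolding sl_deriv_def by (rule vector_derivative_at)
qed

lemma piecewise_limits:
  assumes p: "piecewise_W21 u U V g" and i: "i < 4"
  shows "lim_plus u (knot D i) = U i (knot D i)" "lim_minus u (knot D (Suc i)) = U i (knot D (Suc i))"
    "lim_plus (sl_deriv u) (knot D i) = V i (knot D i)" "lim_minus (sl_deriv u) (knot D (Suc i)) = V i (knot D (Suc i))"
proof -
  have W: "W21 (knot D i) (knot D (Suc i)) (U i) (V i) (g i)" using p i by (simp add: piecewise_W21_def)
  have u: "\<And>x. x \<in> {knot D i<..<knot D (Suc i)} \<Longrightarrow> u x = U i x" using p i by (simp add: piecewise_W21_def piece_def)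
  show "lim_plus u (knot D i) = U i (knot D i)" "lim_minus u (knot D (Suc i)) = U i (knot D (Suc i))"
    by (rule one_sided_limits[OF knot_less[OF i] W21_continuous(1)[OF W] u]; assumption)+
  have v: "\<And>x. x \<in> {knot D i<..<knot D (Suc i)} \<Longrightarrow> sl_deriv u x = V i x"
    using piecewise_derivative(2)[OF p i] by (simp add: piece_def)
  show "lim_plus (sl_deriv u) (knot D i) = V i (knot D i)" "lim_minus (sl_deriv u) (knot D (Suc i)) = V i (knot D (Suc i))"
    by (rule one_sided_limits[OF knot_less[OF i] W21_continuous(2)[OF W] v]; assumption)+
qed

lemma knot_values: "knot D 0 = -1" "knot D (Suc 0) = sl_h1 D" "knot D 1 = sl_h1 D" "knot D 2 = sl_h2 D" "knot D (Suc (Suc 0)) = sl_h2 D"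
  "knot D 3 = sl_h3 D" "knot D (Suc 1) = sl_h2 D" "knot D (Suc 2) = sl_h3 D" "knot D (Suc 3) = 1"
  by (simp_all add: knot_def eval_nat_numeral)

lemma less_3_iff: "(\<forall>i<3. P i) \<longleftrightarrow> P 0 \<and> P (1::nat) \<and> P 2"
proof -
  have "i < 3 \<longleftrightarrow> i = 0 \<or> i = 1 \<or> i = 2" for i :: nat by auto
  then show ?thesis by auto
qed

lemma sl_bc_iff_matching:
  assumes p: "piecewise_W21 u U V g"
  shows "sl_bc D u \<longleftrightarrow> matching U V"
proof -
  note l0 = piecewise_limits[OF p, of 0, simplified, unfolded knot_values]
  note l1 = piecewise_limits[OF p, of 1, simplified, unfolded knot_values]
  note l2 = piecewise_limits[OF p, of 2, simplified, unfolded knot_values]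
  note l3 = piecewise_limits[OF p, of 3, simplified, unfolded knot_values]
  have e: "(2::nat) * 0 + 3 = 3" "(2::nat) * 0 + 4 = 4" "(2::nat) * 1 + 3 = 5" "(2::nat) * 1 + 4 = 6" "(2::nat) * 2 + 3 = 7" "(2::nat) * 2 + 4 = 8"
    "Suc 0 = 1" "Suc 1 = 2" "Suc 2 = 3"
    by simp_all
  have eq: "a - b - c = 0 \<longleftrightarrow> a = b + c" for a b c :: complex by (simp add: algebra_simps)
  show ?thesis
    unfolding sl_bc_def sl_tau1_def sl_tau3_def sl_tau4_def sl_tau5_def sl_tau6_def sl_tau7_def sl_tau8_def
      matching_def less_3_iff knot_values l0 l1 l2 l3 e eq
    using l0 l1 l2 l3 by (simp add: conj_ac)
qed

lemma sl_N_eq_end_N: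
  assumes p: "piecewise_W21 u U V g"
  shows "sl_N D u = end_N U V" "sl_N' D u = end_N' U V"
  using piecewise_limits[OF p, of 3] unfolding sl_N_def sl_N'_def end_N_def end_N'_def knot_values by simp_all

text \<open>Lebesgue's differentiation theorem makes the integrable second derivative \<open>g i\<close> the pointwise
  derivative of \<open>V i\<close> almost everywhere, and \<open>sl_p D\<close> is constant near every point of a piece.\<close>

lemma sl_tau_AE:
  assumes p: "piecewise_W21 u U V g" and i: "i < 4"
  shows "AE x in lebesgue_on (piece D i). sl_tau D u x = of_real (sl_q D x) * U i x - of_real (leading D i) * g i x"
proof -
  have W: "W21 (knot D i) (knot D (Suc i)) (U i) (V i) (g i)" using p i by (simp add: piecewise_W21_def)
  have inc: "V i y - V i x = integral {x..y} (g i)" if "knot D i < x" "x \<le> y" "y < knot D (Suc i)" for x y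
    using W21_increment(1)[OF W] that by simp
  obtain N where N: "negligible N" "\<And>x. \<lbrakk>x \<in> {knot D i<..<knot D (Suc i)}; x \<notin> N\<rbrakk> \<Longrightarrow> (V i has_vector_derivative g i x) (at x)"
    using indefinite_integral_has_vector_derivative_AE[OF W21_D(1)[OF W] inc] by blast
  have "sl_tau D u x = of_real (sl_q D x) * U i x - of_real (leading D i) * g i x" if x: "x \<in> piece D i" "x \<notin> N" for x
  proof -
    have "((\<lambda>y. of_real (leading D i) * V i y) has_vector_derivative of_real (leading D i) * g i x) (at x)"
      using N(2)[of x] x by (intro has_vector_derivative_mult_right) (simp add: piece_def)
    then have "((\<lambda>y. of_real (sl_p D y) * sl_deriv u y) has_vector_derivative of_real (leading D i) * g i x) (at x)"
      by (rule has_vector_derivative_transform_within_open[of _ _ _ "piece D i"])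
        (use x piecewise_derivative(2)[OF p i] sl_p_piece[OF i] in \<open>auto simp: piece_def\<close>)
    then have "sl_deriv (\<lambda>y. of_real (sl_p D y) * sl_deriv u y) x = of_real (leading D i) * g i x"
      unfolding sl_deriv_def by (rule vector_derivative_at)
    moreover have "u x = U i x" using p i x by (simp add: piecewise_W21_def)
    ultimately show ?thesis by (simp add: sl_tau_def)
  qed
  then show ?thesis
    unfolding AE_restrict_space_iff[of "piece D i" lebesgue, simplified]
    by (intro AE_I'[of N]) (use N(1) in \<open>auto simp: negligible_iff_null_sets\<close>)
qed

text \<open>Up to null sets the relation is part of the graph of \<open>A\<close>: indefinite integrals are absolutely
  continuous, and \<open>sl_tau_AE\<close> identifies the second component.\<close>

lemma graph_eigenvector_sl_A:
  assumes F: "(F, sl_Hscale \<mu> F) \<in> graph" and nz: "sn F \<noteq> 0"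
  shows "F \<in> sl_A_eigenfunctions D"
proof -
  obtain u h where Fuh: "F = (u, h)" by (cases F)
  obtain U V g where p: "piecewise_W21 u U V g" and m: "matching U V" and h: "h = end_N' U V" "\<mu> * h = - end_N U V"
    and ae: "\<And>i. i < 4 \<Longrightarrow> AE x in lebesgue_on (piece D i). \<mu> * u x = of_real (sl_q D x) * U i x - of_real (leading D i) * g i x"
    using F unfolding graph_def Fuh by (auto simp: sl_Hscale_def)
  have FH: "F \<in> sl_H D" using graph_H[OF F] by simp
  have tau: "AE x in lebesgue_on (piece D i). sl_tau D u x = \<mu> * u x" if "i < 4" for i
    using sl_tau_AE[OF p that] ae[OF that] by eventually_elim simp
  have "F \<in> sl_domain D"
    unfolding sl_domain_def Fuh
  proof (clarify, intro conjI ballI)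
    show "(u, h) \<in> sl_H D" using FH Fuh by simp
    fix S assume "S \<in> sl_subintervals D"
    then obtain i where i: "i < 4" "S = piece D i" by (auto simp: sl_subintervals_pieces)
    have W: "W21 (knot D i) (knot D (Suc i)) (U i) (V i) (g i)" using p i by (simp add: piecewise_W21_def)
    have u: "\<And>x. x \<in> piece D i \<Longrightarrow> u x = U i x" using p i by (simp add: piecewise_W21_def)
    have in_piece: "knot D i \<le> c \<and> d \<le> knot D (Suc i)" if "{c..d} \<subseteq> S" "c \<le> d" for c d
      using that i by (auto simp: piece_def)
    \<comment> \<open>Local absolute continuity is also required on \<open>{c..d}\<close> for \<open>d < c\<close>, which is empty.\<close>
    have trivial: "abs_cont_on {c..d} f" if "d < c" for c d f
      using that unfolding abs_cont_on_iff_small_variation small_variation_on_def nonoverlapping_def var_sum_def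
      by (auto intro!: exI[of _ 1] sum.neutral[THEN order_eq_refl, THEN le_less_trans])
    show "loc_abs_cont_on S u"
      unfolding loc_abs_cont_on_def
    proof (intro allI impI)
      fix c d assume cd: "{c..d} \<subseteq> S"
      show "abs_cont_on {c..d} u"
      proof (cases "c \<le> d")
        case True
        note k = in_piece[OF cd True]
        have "V i absolutely_integrable_on {c..d}"
          by (rule absolutely_integrable_continuous_real, rule continuous_on_subset[OF W21_continuous(2)[OF W]]) (use k in auto)
        moreover have "u y - u x = integral {x..y} (V i)" if "c \<le> x" "x \<le> y" "y \<le> d" for x y
        proof -
          have "x \<in> piece D i" "y \<in> piece D i" using cd i that by auto
          then show ?thesis using W21_increment(2)[OF W, of x y] u k that by simp
        qed
        ultimately show ?thesis unfolding abs_cont_on_iff_small_variation by (rule indefinite_integral_small_variation)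
      next
        case False
        then show ?thesis by (intro trivial) simp
      qed
    qed
    show "loc_abs_cont_on S (sl_deriv u)"
      unfolding loc_abs_cont_on_def
    proof (intro allI impI)
      fix c d assume cd: "{c..d} \<subseteq> S"
      show "abs_cont_on {c..d} (sl_deriv u)"
      proof (cases "c \<le> d")
        case True
        note k = in_piece[OF cd True]
        have "g i absolutely_integrable_on {c..d}"
          by (rule abs_int_subinterval(1)[OF W21_D(1)[OF W]]) (use k in auto)
        moreover have "sl_deriv u y - sl_deriv u x = integral {x..y} (g i)" if "c \<le> x" "x \<le> y" "y \<le> d" for x y
        proof -
          have "x \<in> piece D i" "y \<in> piece D i" using cd i that by auto
          then show ?thesis using W21_increment(1)[OF W, of x y] piecewise_derivative(2)[OF p i(1)] k that by simp
        qed
        ultimately show ?thesis unfolding abs_cont_on_iff_small_variation by (rule indefinite_integral_small_variation)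
      next
        case False
        then show ?thesis by (intro trivial) simp
      qed
    qed
    show "u differentiable (at x)" if "x \<in> S" for x
      using piecewise_derivative(1)[OF p i(1)] that i by (auto intro: differentiableI_vector)
  next
    show "sl_tau D u \<in> sl_H1 D"
      unfolding sl_H1_iff
    proof (intro allI impI)
      fix i :: nat assume i: "i < 4"
      show "square_integrable (lebesgue_on (piece D i)) (sl_tau D u)"
        using square_integrable_AE_cong[OF piece_lebesgue _ tau[OF i]] square_integrable_scale[OF sl_H_piece[OF FH i], of \<mu>]
        by (simp add: Fuh)
    qed
    show "sl_bc D u" using m sl_bc_iff_matching[OF p] by simp
    show "h = sl_N' D u" using h sl_N_eq_end_N[OF p] by simp
  qed
  moreover have "\<not> sl_Heq D F ((\<lambda>x. 0), 0)"
    using nz sn_zero_iff[OF FH] AE_sl_I_iff[of "\<lambda>x. fst F x = 0"] by (auto simp: sl_Heq_def)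
  moreover have "sl_Heq D (sl_A D F) (sl_Hscale \<mu> F)"
    using tau AE_sl_I_iff[of "\<lambda>x. sl_tau D u x = \<mu> * u x"] h sl_N_eq_end_N[OF p]
    by (auto simp: sl_Heq_def sl_A_def sl_Hscale_def Fuh)
  ultimately show ?thesis unfolding sl_A_eigenfunctions_def by blast
qed

text \<open>The derivative of a solution is absolutely continuous, hence the integral of its own derivative. The
  equation identifies the latter with the function \<open>g i\<close>, which is integrable on the closed piece since
  the solution is bounded.\<close>

lemma solution_in_graph:
  assumes sol: "sl_solution D \<mu> \<phi>"
  shows "(sl_augment D \<phi>, sl_Hscale \<mu> (sl_augment D \<phi>)) \<in> graph"
proof -
  define g where "g i x = (of_real (sl_q D x) - \<mu>) / complex_of_real (leading D i) * \<phi> x" for i x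
  have "\<exists>U V. W21 (knot D i) (knot D (Suc i)) U V (g i) \<and> (\<forall>x\<in>piece D i. \<phi> x = U x)" if i: "i < 4" for i
  proof -
    let ?a = "knot D i" and ?b = "knot D (Suc i)"
    have "piece D i \<in> sl_subintervals D" using i by (auto simp: sl_subintervals_pieces)
    then have S: "abs_cont_on (piece D i) \<phi>" "\<And>x. x \<in> piece D i \<Longrightarrow> \<phi> differentiable (at x)"
      "abs_cont_on (piece D i) (sl_deriv \<phi>)"
      using sol by (auto simp: sl_solution_def)
    have iv: "is_interval (piece D i)" by (simp add: piece_def is_interval_oo)
    have uc: "uniformly_continuous_on (piece D i) \<phi>"
      using S(1) iv by (auto simp: abs_cont_on_iff_small_variation intro: small_variation_continuous)
    have bdd: "bounded (\<phi> ` piece D i)"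
      by (rule bounded_uniformly_continuous_image[OF uc]) (simp add: piece_def)
    have meas: "\<phi> \<in> borel_measurable (lebesgue_on (piece D i))"
      by (rule continuous_imp_measurable_on_sets_lebesgue[OF uniformly_continuous_imp_continuous[OF uc]]) simp
    have g_abs: "g i absolutely_integrable_on {?a..?b}"
    proof -
      have k: "(\<lambda>x. (of_real (sl_q D x) - \<mu>) / complex_of_real (leading D i)) absolutely_integrable_on piece D i"
        using potential_abs_int[OF i, of \<mu>] unfolding piece_def absolutely_integrable_on_Icc_iff_Ioo .
      have "(\<lambda>x. \<phi> x * ((of_real (sl_q D x) - \<mu>) / complex_of_real (leading D i))) absolutely_integrable_on piece D i"
        by (rule absolutely_integrable_bounded_measurable_product[of "(*)", OF bilinear_times meas _ bdd k]) simp
      then show ?thesis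
        unfolding absolutely_integrable_on_Icc_iff_Ioo piece_def[symmetric]
        by (simp add: g_def[abs_def] mult.commute)
    qed
    have d: "(\<phi> has_vector_derivative sl_deriv \<phi> x) (at x)" if "x \<in> {?a<..<?b}" for x
      using S(2)[of x] that unfolding sl_deriv_def piece_def by (simp add: vector_derivative_works)
    have ae: "AE x in lebesgue_on (piece D i). sl_tau D \<phi> x = \<mu> * \<phi> x"
      using sol AE_sl_I_iff[of "\<lambda>x. sl_tau D \<phi> x = \<mu> * \<phi> x"] i by (auto simp: sl_solution_def)
    then have "AE x in lebesgue. x \<in> piece D i \<longrightarrow> sl_tau D \<phi> x = \<mu> * \<phi> x" by (simp add: AE_restrict_space_iff)
    then obtain N0 where "N0 \<in> null_sets lebesgue"
      "{x \<in> space lebesgue. \<not> (x \<in> piece D i \<longrightarrow> sl_tau D \<phi> x = \<mu> * \<phi> x)} \<subseteq> N0"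
      unfolding eventually_ae_filter by (elim bexE)
    then have N0: "negligible N0" "\<And>x. x \<in> piece D i \<Longrightarrow> x \<notin> N0 \<Longrightarrow> sl_tau D \<phi> x = \<mu> * \<phi> x"
      by (auto simp: negligible_iff_null_sets)
    have inc: "sl_deriv \<phi> y - sl_deriv \<phi> x = integral {x..y} (g i)" if xy: "?a < x" "x \<le> y" "y < ?b" for x y
    proof (cases "x = y")
      case False
      then have "x < y" using xy by simp
      have sub: "{x..y} \<subseteq> piece D i" using xy by (auto simp: piece_def)
      have sv: "small_variation_on {x..y} (sl_deriv \<phi>)"
        using S(3) small_variation_on_subset[OF _ sub] by (simp add: abs_cont_on_iff_small_variation)
      obtain g' N where g': "negligible N"
        "\<And>t. \<lbrakk>t \<in> {x<..<y}; t \<notin> N\<rbrakk> \<Longrightarrow> (sl_deriv \<phi> has_vector_derivative g' t) (at t)"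
        "sl_deriv \<phi> y - sl_deriv \<phi> x = integral {x..y} g'"
        using absolutely_continuous_FTC[OF \<open>x < y\<close> sv] xy(2) by (metis order_refl)
      have "integral {x..y} g' = integral {x..y} (g i)"
      proof (rule integral_spike)
        show "negligible (N \<union> N0 \<union> {x, y})" using g'(1) N0(1) by simp
        fix t assume t: "t \<in> {x..y} - (N \<union> N0 \<union> {x, y})"
        then have tp: "t \<in> piece D i" "t \<in> {x<..<y}" using sub by auto
        have "((\<lambda>y. of_real (leading D i) * sl_deriv \<phi> y) has_vector_derivative of_real (leading D i) * g' t) (at t)"
          by (rule has_vector_derivative_mult_right[OF g'(2)]) (use tp t in auto)
        then have "((\<lambda>y. of_real (sl_p D y) * sl_deriv \<phi> y) has_vector_derivative of_real (leading D i) * g' t) (at t)"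
          by (rule has_vector_derivative_transform_within_open[of _ _ _ "piece D i"])
            (use tp sl_p_piece[OF i] in \<open>auto simp: piece_def\<close>)
        then have "sl_deriv (\<lambda>y. of_real (sl_p D y) * sl_deriv \<phi> y) t = of_real (leading D i) * g' t"
          unfolding sl_deriv_def by (rule vector_derivative_at)
        then have "- (of_real (leading D i) * g' t) + of_real (sl_q D t) * \<phi> t = \<mu> * \<phi> t"
          using N0(2)[OF tp(1)] t by (simp add: sl_tau_def)
        then have "of_real (leading D i) * g' t = (of_real (sl_q D t) - \<mu>) * \<phi> t" by (simp add: algebra_simps)
        moreover have "complex_of_real (leading D i) \<noteq> 0" using leading_pos[OF i] by simp
        ultimately show "g i t = g' t" by (simp add: g_def field_simps)
      qed
      then show ?thesis using g'(3) by simp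
    qed simp
    obtain U V where "W21 ?a ?b U V (g i)" "\<And>x. x \<in> {?a<..<?b} \<Longrightarrow> \<phi> x = U x"
      using W21_from_interior[OF knot_less[OF i] g_abs d inc] by blast
    then show ?thesis by (auto simp: piece_def)
  qed
  then have "\<forall>i. \<exists>U V. i < 4 \<longrightarrow> W21 (knot D i) (knot D (Suc i)) U V (g i) \<and> (\<forall>x\<in>piece D i. \<phi> x = U x)" by blast
  then obtain U V where UV: "\<And>i. i < 4 \<Longrightarrow> W21 (knot D i) (knot D (Suc i)) (U i) (V i) (g i) \<and> (\<forall>x\<in>piece D i. \<phi> x = U i x)"
    by metis
  then have p: "piecewise_W21 \<phi> U V g" by (simp add: piecewise_W21_def)
  have "matching U V" using sol sl_bc_iff_matching[OF p] by (simp add: sl_solution_def)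
  moreover have "\<mu> * sl_N' D \<phi> = - end_N U V"
    using sol sl_N_eq_end_N[OF p] by (simp add: sl_solution_def add_eq_0_iff)
  moreover have "(\<lambda>x. \<mu> * \<phi> x) \<in> sl_H1 D"
    using piecewise_W21_H1[OF p] square_integrable_scale by (auto simp: sl_H1_iff)
  moreover have "AE x in lebesgue_on (piece D i). \<mu> * \<phi> x = of_real (sl_q D x) * U i x - of_real (leading D i) * g i x" if i: "i < 4" for i
  proof (rule AE_I2)
    fix x assume "x \<in> space (lebesgue_on (piece D i))"
    then have "\<phi> x = U i x" using UV[OF i] by simp
    moreover have "complex_of_real (leading D i) \<noteq> 0" using leading_pos[OF i] by simp
    then have "of_real (leading D i) * g i x = (of_real (sl_q D x) - \<mu>) * \<phi> x" by (simp add: g_def)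
    ultimately show "\<mu> * \<phi> x = of_real (sl_q D x) * U i x - of_real (leading D i) * g i x"
      by (simp add: algebra_simps)
  qed
  ultimately show ?thesis
    unfolding graph_def sl_augment_def sl_Hscale_def using p sl_N_eq_end_N(2)[OF p] by auto
qed

section \<open>Completeness of the eigenfunctions\<close>

text \<open>An eigenvector of positive seminorm orthogonal to the family could be normalised and added to it,
  contrary to maximality.\<close>

lemma completeness:
  assumes \<phi>: "\<And>n. sl_eigenfunction D (\<phi> n)" and inj: "inj \<phi>"
    and max: "sl_maximal_orthonormal_eigenfunctions D (range (\<lambda>n. sl_augment D (\<phi> n)))"
    and F: "F \<in> sl_H D"
  shows "sl_Hsums D (\<lambda>n. sl_Hscale (sl_inner D F (sl_augment D (\<phi> n))) (sl_augment D (\<phi> n))) F"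
proof -
  define e where "e n = sl_augment D (\<phi> n)" for n
  have "inj e"
    by (rule injI) (use inj in \<open>auto simp: e_def sl_augment_def dest: injD\<close>)
  have S: "range e \<subseteq> sl_A_eigenfunctions D" "sl_orthonormal D (range e)"
    "\<And>T. range e \<subseteq> T \<Longrightarrow> T \<subseteq> sl_A_eigenfunctions D \<Longrightarrow> sl_orthonormal D T \<Longrightarrow> T = range e"
    using max unfolding sl_maximal_orthonormal_eigenfunctions_def e_def by blast+
  have orth: "sl_inner D (e m) (e n) = (if m = n then 1 else 0)" for m n
    using S(2) \<open>inj e\<close> unfolding sl_orthonormal_def by (auto simp: inj_eq)
  have "\<forall>n. \<exists>l. (e n, sl_Hscale l (e n)) \<in> graph"
    using \<phi> solution_in_graph unfolding sl_eigenfunction_def e_def by blast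
  then obtain l where l: "\<And>n. (e n, sl_Hscale (l n) (e n)) \<in> graph" by metis
  have eH: "e n \<in> sl_H D" for n using graph_H[OF l] by simp
  have "sn z = 0" if z: "(z, sl_Hscale (of_real k) z) \<in> graph" and orth_z: "\<And>n. sl_inner D z (e n) = 0" for z and k :: real
  proof (rule ccontr)
    assume nz: "sn z \<noteq> 0"
    have zH: "z \<in> sl_H D" using graph_H[OF z] by simp
    define z1 where "z1 = sl_Hscale (of_real (1 / sn z)) z"
    have z1H: "z1 \<in> sl_H D" using zH by (simp add: z1_def H_scale)
    have sn1: "sn z1 = 1" using nz sn_nonneg[OF zH] zH by (simp add: z1_def sn_scale norm_divide)
    have "(z1, sl_Hscale (of_real k) z1) \<in> graph"
      using graph_scale[OF z, of "of_real (1 / sn z)"] by (simp add: z1_def scale_left_commute)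
    then have z1A: "z1 \<in> sl_A_eigenfunctions D" using graph_eigenvector_sl_A sn1 by auto
    have z1e: "sl_inner D z1 (e n) = 0" "sl_inner D (e n) z1 = 0" for n
    proof -
      show "sl_inner D z1 (e n) = 0" using ip_scale[OF zH eH] orth_z by (simp add: z1_def)
      then show "sl_inner D (e n) z1 = 0" using ip_cnj[OF z1H eH] by simp
    qed
    have z1z1: "sl_inner D z1 z1 = 1" using ip_self[OF z1H] sn1 by simp
    have notin: "z1 \<noteq> e n" for n using z1e(1)[of n] orth[of n n] by auto
    have "sl_orthonormal D (insert z1 (range e))"
    proof -
      have "z1 \<noteq> e n" "e n \<noteq> z1" for n using notin by metis+
      moreover have "sl_inner D (e m) (e n) = (if e m = e n then 1 else 0)" for m n
        using orth \<open>inj e\<close> by (simp add: inj_eq)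
      ultimately show ?thesis unfolding sl_orthonormal_def using z1e z1z1 by simp
    qed
    then have "insert z1 (range e) = range e" using S(1) z1A by (intro S(3)) auto
    then show False using notin by blast
  qed
  then have lim: "(\<lambda>m. sn (F - (\<Sum>n<m. sl_Hscale (sl_inner D F (e n)) (e n)))) \<longlonglongrightarrow> 0"
    using Fourier_series_converges[OF l orth _ F] by blast
  have "F - (\<Sum>n<m. sl_Hscale (sl_inner D F (e n)) (e n)) = ((\<lambda>x. fst F x - (\<Sum>n<m. fst (sl_Hscale (sl_inner D F (e n)) (e n)) x)),
      snd F - (\<Sum>n<m. snd (sl_Hscale (sl_inner D F (e n)) (e n))))" for m
    by (simp add: prod_eq_iff fun_eq_iff fst_sum snd_sum sum_fun_apply)
  then show ?thesis
    using lim unfolding sl_Hsums_def sn_eq_Hnorm e_def by simp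
qed

end

theorem theorem3p3:
  fixes D :: sl_data and \<phi> :: "nat \<Rightarrow> real \<Rightarrow> complex"
  assumes "sl_valid D"
    and "\<And>n. sl_eigenfunction D (\<phi> n)"
    and "inj \<phi>"
    and "sl_maximal_orthonormal_eigenfunctions D (range (\<lambda>n. sl_augment D (\<phi> n)))"
  shows "\<forall>F \<in> sl_H D.
           sl_Hsums D (\<lambda>n. sl_Hscale (sl_inner D F (sl_augment D (\<phi> n))) (sl_augment D (\<phi> n))) F"
proof -
  interpret sl_problem D by unfold_locales (rule assms(1))
  show ?thesis using completeness[OF assms(2-4)] by blast
qed

end
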